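(* The $2$-covariate FBS problem (the case $\kappa=1$, $P=2$) can be solved as a minimum cost network flow problem in time $O\big(n\cdot(\min\{n+n',k_1k_2\}+(k_1+k_2)\log(k_1+k_2))\big)$.
   Context: An instance consists of a finite set $\mathcal{T}$ of $n$ treatment samples, a finite set $\mathcal{C}$ of $n'$ control samples, and two covariates. For $p=1,2$, covariate $p$ has $k_p$ levels and assigns each sample one level. This partitions $\mathcal{T}$ into $L_{p,1},\dots,L_{p,k_p}$ and $\mathcal{C}$ into $L'_{p,1},\dots,L'_{p,k_p}$. Selections $S\subseteq\mathcal{T}$, $S'\subseteq\mathcal{C}$ satisfy $(S,S')$-fine-balance if $|S\cap L_{p,i}|=|S'\cap L'_{p,i}|$ for all $p=1,2$ and $i=1,\dots,k_p$. The FBS problem is: find $S,S'$ satisfying $(S,S')$-fine-balance that maximize $|S|$.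
   Formalization: The time is counted for n ≥ 1 and from input whose samples are already grouped by pair of levels, with group sizes available; if the levels of all n' controls had to be read, the bound would fail, e.g. for n=1, k1=k2=2 and large n'. *)

theory Defs
  imports Complex_Main
begin

section \<open>The two-covariate fine balance selection (FBS) problem\<close>

text \<open>
  Samples are identified by natural numbers, so that a machine can store them; treatment and
  control samples are separate kinds, and an identifier may occur in both sets.  The covariates
  are numbered 1 and 2, the levels of covariate \<open>p\<close> are numbered \<open>1, \<dots>, levels I p\<close>, and a
  level may contain no sample.
\<close>

record fbs_instance =
  treated :: "nat set"
  control :: "nat set"
  levels :: "nat \<Rightarrow> nat"
  tlevel :: "nat \<Rightarrow> nat \<Rightarrow> nat"
  clevel :: "nat \<Rightarrow> nat \<Rightarrow> nat"

definition valid_instance :: "fbs_instance \<Rightarrow> bool" where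
  "valid_instance I \<longleftrightarrow> finite (treated I) \<and> finite (control I) \<and>
     (\<forall>p\<in>{1,2}. (\<forall>s\<in>treated I. tlevel I p s \<in> {1..levels I p}) \<and>
                (\<forall>s\<in>control I. clevel I p s \<in> {1..levels I p}))"

definition tpart :: "fbs_instance \<Rightarrow> nat \<Rightarrow> nat \<Rightarrow> nat set" where
  "tpart I p i = {s \<in> treated I. tlevel I p s = i}"

definition cpart :: "fbs_instance \<Rightarrow> nat \<Rightarrow> nat \<Rightarrow> nat set" where
  "cpart I p i = {s \<in> control I. clevel I p s = i}"

definition fine_balance :: "fbs_instance \<Rightarrow> nat set \<Rightarrow> nat set \<Rightarrow> bool" where
  "fine_balance I S S' \<longleftrightarrow>
     (\<forall>p\<in>{1,2}. \<forall>i\<in>{1..levels I p}. card (S \<inter> tpart I p i) = card (S' \<inter> cpart I p i))"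

definition fbs_feasible :: "fbs_instance \<Rightarrow> nat set \<Rightarrow> nat set \<Rightarrow> bool" where
  "fbs_feasible I S S' \<longleftrightarrow> S \<subseteq> treated I \<and> S' \<subseteq> control I \<and> fine_balance I S S'"

definition fbs_optimal :: "fbs_instance \<Rightarrow> nat set \<Rightarrow> nat set \<Rightarrow> bool" where
  "fbs_optimal I S S' \<longleftrightarrow> fbs_feasible I S S' \<and>
     (\<forall>R R'. fbs_feasible I R R' \<longrightarrow> card R \<le> card S)"


section \<open>Minimum cost network flow\<close>

record 'v network =
  nodes :: "'v set"
  arcs :: "('v \<times> 'v) set"
  capacity :: "'v \<times> 'v \<Rightarrow> real"
  cost :: "'v \<times> 'v \<Rightarrow> real"
  balance :: "'v \<Rightarrow> real"

definition feasible_flow :: "'v network \<Rightarrow> ('v \<times> 'v \<Rightarrow> real) \<Rightarrow> bool" where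
  "feasible_flow N f \<longleftrightarrow> (\<forall>a\<in>arcs N. 0 \<le> f a \<and> f a \<le> capacity N a) \<and>
     (\<forall>v\<in>nodes N. (\<Sum>a\<in>{a\<in>arcs N. fst a = v}. f a) - (\<Sum>a\<in>{a\<in>arcs N. snd a = v}. f a)
                   = balance N v)"

definition flow_cost :: "'v network \<Rightarrow> ('v \<times> 'v \<Rightarrow> real) \<Rightarrow> real" where
  "flow_cost N f = (\<Sum>a\<in>arcs N. cost N a * f a)"

definition min_cost_flow :: "'v network \<Rightarrow> ('v \<times> 'v \<Rightarrow> real) \<Rightarrow> bool" where
  "min_cost_flow N f \<longleftrightarrow> feasible_flow N f \<and>
     (\<forall>g. feasible_flow N g \<longrightarrow> flow_cost N f \<le> flow_cost N g)"

text \<open>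
  The network of an FBS instance.  Node \<open>(p, i)\<close> is level \<open>i\<close> of covariate \<open>p\<close>.  Treatment
  samples flow from the levels of covariate 1 to those of covariate 2, and each selected one is
  rewarded; control samples flow back at no cost.  All node balances are 0, so flow conservation at
  \<open>(p, i)\<close> is fine balance at that level.
\<close>

definition fbs_network :: "fbs_instance \<Rightarrow> (nat \<times> nat) network" where
  "fbs_network I =
     \<lparr> nodes = {1} \<times> {1..levels I 1} \<union> {2} \<times> {1..levels I 2},
       arcs = {((1, i), (2, j)) | i j. tpart I 1 i \<inter> tpart I 2 j \<noteq> {}} \<union>
              {((2, j), (1, i)) | i j. cpart I 1 i \<inter> cpart I 2 j \<noteq> {}},
       capacity = (\<lambda>((p, i), (q, j)). if p = 1 then real (card (tpart I 1 i \<inter> tpart I 2 j))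
                                      else real (card (cpart I 1 j \<inter> cpart I 2 i))),
       cost = (\<lambda>((p, i), (q, j)). if p = 1 then - 1 else 0),
       balance = (\<lambda>_. 0) \<rparr>"

definition selection_flow ::
    "fbs_instance \<Rightarrow> nat set \<Rightarrow> nat set \<Rightarrow> (nat \<times> nat) \<times> (nat \<times> nat) \<Rightarrow> real" where
  "selection_flow I S S' =
     (\<lambda>((p, i), (q, j)). if p = 1 then real (card (S \<inter> (tpart I 1 i \<inter> tpart I 2 j)))
                         else real (card (S' \<inter> (cpart I 1 j \<inter> cpart I 2 i))))"


section \<open>Machine model and running time\<close>

text \<open>
  A unit-cost random access machine with integer words, in structured form.  A program uses
  finitely many named scalar variables and finitely many named, unbounded arrays.  The only
  arithmetic operations are addition and subtraction.  Every assignment and every evaluation of a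
  test takes one step; this is the usual measure up to a factor that depends on the program only,
  because the expressions in a program have fixed size.
\<close>

datatype aexp =
    Const int
  | Var string
  | Read string aexp
  | Plus aexp aexp
  | Minus aexp aexp

datatype bexp =
    Less aexp aexp
  | Not bexp
  | And bexp bexp

datatype com =
    Skip
  | Assign string aexp
  | Write string aexp aexp
  | Seq com com
  | If bexp com com
  | While bexp com

record state =
  scal :: "string \<Rightarrow> int"
  arr :: "string \<Rightarrow> int \<Rightarrow> int"

primrec aval :: "aexp \<Rightarrow> state \<Rightarrow> int" where
  "aval (Const z) s = z"
| "aval (Var x) s = scal s x"
| "aval (Read a e) s = arr s a (aval e s)"
| "aval (Plus e e') s = aval e s + aval e' s"
| "aval (Minus e e') s = aval e s - aval e' s"

primrec bval :: "bexp \<Rightarrow> state \<Rightarrow> bool" where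
  "bval (Less e e') s \<longleftrightarrow> aval e s < aval e' s"
| "bval (Not b) s \<longleftrightarrow> \<not> bval b s"
| "bval (And b b') s \<longleftrightarrow> bval b s \<and> bval b' s"

text \<open>\<open>run c s t s'\<close>: started in \<open>s\<close>, the program \<open>c\<close> halts in \<open>s'\<close> after exactly \<open>t\<close> steps.\<close>

inductive run :: "com \<Rightarrow> state \<Rightarrow> nat \<Rightarrow> state \<Rightarrow> bool" where
  Skip: "run Skip s 1 s"
| Assign: "run (Assign x e) s 1 (s\<lparr>scal := (scal s)(x := aval e s)\<rparr>)"
| Write: "run (Write a e e') s 1
            (s\<lparr>arr := (arr s)(a := (arr s a)(aval e s := aval e' s))\<rparr>)"
| Seq: "run c s t s' \<Longrightarrow> run d s' t' s'' \<Longrightarrow> run (Seq c d) s (t + t') s''"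
| IfTrue: "bval b s \<Longrightarrow> run c s t s' \<Longrightarrow> run (If b c d) s (Suc t) s'"
| IfFalse: "\<not> bval b s \<Longrightarrow> run d s t s' \<Longrightarrow> run (If b c d) s (Suc t) s'"
| WhileFalse: "\<not> bval b s \<Longrightarrow> run (While b c) s 1 s"
| WhileTrue: "bval b s \<Longrightarrow> run c s t s' \<Longrightarrow> run (While b c) s' t' s'' \<Longrightarrow>
              run (While b c) s (Suc (t + t')) s''"

inductive_cases SkipE: "run Skip s t s'"
inductive_cases AssignE: "run (Assign x e) s t s'"
inductive_cases WriteE: "run (Write a e e') s t s'"
inductive_cases SeqE: "run (Seq c d) s t s'"
inductive_cases IfE: "run (If b c d) s t s'"
inductive_cases WhileE: "run (While b c) s t s'"

lemma run_deterministic: "run c s t s' \<Longrightarrow> run c s u s'' \<Longrightarrow> t = u \<and> s' = s''"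
proof (induction arbitrary: u s'' rule: run.induct)
  case Skip then show ?case by (auto elim: SkipE)
next
  case Assign then show ?case by (auto elim: AssignE)
next
  case Write then show ?case by (auto elim: WriteE)
next
  case Seq from Seq.prems show ?case by (rule SeqE) (use Seq.IH in blast)
next
  case IfTrue from IfTrue.prems show ?case by (rule IfE) (use IfTrue in \<open>blast | simp\<close>)+
next
  case IfFalse from IfFalse.prems show ?case by (rule IfE) (use IfFalse in \<open>blast | simp\<close>)+
next
  case WhileFalse from WhileFalse.prems show ?case by (rule WhileE) (use WhileFalse in \<open>blast | simp\<close>)+
next
  case WhileTrue from WhileTrue.prems show ?case by (rule WhileE) (use WhileTrue in \<open>blast | simp\<close>)+
qed


section \<open>Input and output\<close>

text \<open>
  The input is the network together with the samples behind each arc: a list \<open>cs\<close> of the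
  nonempty cells (pairs of levels) in any order and, for each cell, its treatment samples and its
  control samples in any order.  A sample list is given by its position in an array, so that the
  capacity of an arc is a difference of two offsets, available without scanning the samples.
  There are at most \<open>min (n + n') (k1 * k2)\<close> cells.  The samples are grouped in advance because the
  time bound does not grow with \<open>n'\<close> once \<open>n + n' \<ge> k1 * k2\<close>, so a machine that keeps to it cannot
  inspect the level of every control sample.
\<close>

definition cells :: "fbs_instance \<Rightarrow> (nat \<times> nat) set" where
  "cells I = {(i, j). tpart I 1 i \<inter> tpart I 2 j \<noteq> {} \<or> cpart I 1 i \<inter> cpart I 2 j \<noteq> {}}"

definition cell_listing ::
    "fbs_instance \<Rightarrow> (nat \<times> nat) list \<Rightarrow> nat list list \<Rightarrow> nat list list \<Rightarrow> bool" where
  "cell_listing I cs ts us \<longleftrightarrow>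
     distinct cs \<and> set cs = cells I \<and> length ts = length cs \<and> length us = length cs \<and>
     (\<forall>c<length cs. case cs ! c of (i, j) \<Rightarrow>
        distinct (ts ! c) \<and> set (ts ! c) = tpart I 1 i \<inter> tpart I 2 j \<and>
        distinct (us ! c) \<and> set (us ! c) = cpart I 1 i \<inter> cpart I 2 j)"

definition offsets :: "nat list list \<Rightarrow> nat list" where
  "offsets xss = map (\<lambda>c. length (concat (take c xss))) [0..<Suc (length xss)]"

definition array_of :: "nat list \<Rightarrow> int \<Rightarrow> int" where
  "array_of xs i = (if 0 \<le> i \<and> nat i < length xs then int (xs ! nat i) else 0)"

text \<open>
  The samples of cell \<open>c\<close> are the entries at positions \<open>toff c, \<dots>, toff (c + 1) - 1\<close> of the
  array \<open>treated\<close>, and likewise for \<open>coff\<close> and \<open>control\<close>.  All other memory is initially 0.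
\<close>

definition input_state ::
    "fbs_instance \<Rightarrow> (nat \<times> nat) list \<Rightarrow> nat list list \<Rightarrow> nat list list \<Rightarrow> state" where
  "input_state I cs ts us =
     \<lparr> scal = (\<lambda>_. 0)(''k1'' := int (levels I 1), ''k2'' := int (levels I 2),
                      ''m'' := int (length cs)),
       arr = (\<lambda>_ _. 0)(''row'' := array_of (map fst cs), ''col'' := array_of (map snd cs),
                       ''toff'' := array_of (offsets ts), ''treated'' := array_of (concat ts),
                       ''coff'' := array_of (offsets us), ''control'' := array_of (concat us)) \<rparr>"

text \<open>The set \<open>A\<close> is listed without repetition in the first \<open>x\<close> entries of the array \<open>a\<close>.\<close>

definition holds_set :: "state \<Rightarrow> string \<Rightarrow> string \<Rightarrow> nat set \<Rightarrow> bool" where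
  "holds_set s x a A \<longleftrightarrow> (\<exists>xs. distinct xs \<and> set xs = A \<and> scal s x = int (length xs) \<and>
     (\<forall>i<length xs. arr s a (int i) = int (xs ! i)))"

text \<open>
  The arrays \<open>tflow\<close> and \<open>cflow\<close> hold, for each cell \<open>(i, j)\<close>, the flow on the arcs from \<open>(1, i)\<close>
  to \<open>(2, j)\<close> and back.  A cell without treatment (control) samples lacks the respective arc; a
  \<open>selection_flow\<close> is 0 there.
\<close>

definition holds_flow ::
    "state \<Rightarrow> (nat \<times> nat) list \<Rightarrow> ((nat \<times> nat) \<times> (nat \<times> nat) \<Rightarrow> real) \<Rightarrow> bool" where
  "holds_flow s cs f \<longleftrightarrow> (\<forall>c<length cs. case cs ! c of (i, j) \<Rightarrow>
     of_int (arr s ''tflow'' (int c)) = f ((1, i), (2, j)) \<and>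
     of_int (arr s ''cflow'' (int c)) = f ((2, j), (1, i)))"

definition time_bound :: "fbs_instance \<Rightarrow> real" where
  "time_bound I =
     (let n = card (treated I); n' = card (control I); k1 = levels I 1; k2 = levels I 2
      in real n * (real (min (n + n') (k1 * k2)) + real (k1 + k2) * log 2 (real (k1 + k2))))"

end

theory Submission
  imports Defs
begin

text \<open>
  Start from selecting every treatment sample and no control sample.  This flow has least cost among
  all flows within the capacities, but the levels of covariate 2 have excess and those of covariate 1
  deficit, \<open>n\<close> units in total.  The primal-dual method repairs it: search the residual network
  from the nodes with excess along arcs of reduced cost 0; if a node with deficit is reached, push
  one unit along the path found, otherwise raise the potential of every unreached node by 1.  All
  costs are integers, so reduced costs stay nonnegative.

  Nodes with excess keep potential 0 and nodes with deficit share the potential \<open>D\<close>, the number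
  of raises so far.  Weak duality therefore gives \<open>D * E \<le> n\<close> for the remaining excess \<open>E\<close>,
  because selecting nothing is feasible.  Hence there are at most \<open>2 * n\<close> searches.  Each is a breadth-first search over
  \<open>k1 + k2\<close> nodes and at most \<open>4 * min (n + n') (k1 * k2)\<close> arcs, so no priority queue is needed.

  The final potentials certify that the integral flow computed is optimal among all real flows.  As
  every instance has a listing of its cells, this also shows that a largest balanced selection is a
  minimum cost flow.
\<close>

section \<open>Weakest preconditions with running time\<close>

text \<open>Correctness and running time are proved together: each loop carries a potential in the
  natural numbers that pays for its iterations. For the outer loop it is a multiple of
  \<open>E + (n - D)\<close>, since a search either lowers \<open>E\<close> or raises
  \<open>D\<close> by 1. The bound \<open>D \<le> n\<close> holds only while some excess is left,
  which is exactly when a further search takes place. No bottleneck capacity is computed: a search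
  moves at most one unit, which the factor \<open>n\<close> of the bound affords. Control samples
  are the obstacle, as \<open>n'\<close> may exceed the whole time budget. They are never scanned;
  only selected ones are copied to the output, and conservation makes their number equal to that of
  the selected treatment samples, hence at most \<open>n\<close>. Weak duality serves twice. Applied
  to the integral zero circulation it limits \<open>D\<close>; applied to an arbitrary real flow it
  proves the computed one optimal. For this reason the compared flow takes values in any linearly
  ordered integral domain, whereas residual capacities and potentials of the machine are
  integers.\<close>

notation Seq (infixr \<open>;;\<close> 60)

text \<open>Programs are deterministic, so the existence of one halting run is total correctness.
  The step count is an argument of the postcondition, so that time composes in the same way as the
  state.\<close>

definition wp :: "com \<Rightarrow> state \<Rightarrow> (nat \<Rightarrow> state \<Rightarrow> bool) \<Rightarrow> bool" where
  "wp c s Q \<longleftrightarrow> (\<exists>t s'. run c s t s' \<and> Q t s')"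

lemma wp_simps [simp]:
  "wp Skip s Q \<longleftrightarrow> Q 1 s"
  "wp (Assign x e) s Q \<longleftrightarrow> Q 1 (s\<lparr>scal := (scal s)(x := aval e s)\<rparr>)"
  "wp (Write a e e') s Q \<longleftrightarrow> Q 1 (s\<lparr>arr := (arr s)(a := (arr s a)(aval e s := aval e' s))\<rparr>)"
  "wp (c ;; d) s Q \<longleftrightarrow> wp c s (\<lambda>t s'. wp d s' (\<lambda>t'. Q (t + t')))"
  "wp (If b c d) s Q \<longleftrightarrow>
     (if bval b s then wp c s (\<lambda>t. Q (Suc t)) else wp d s (\<lambda>t. Q (Suc t)))"
  unfolding wp_def
      apply (fastforce elim: SkipE AssignE WriteE SeqE intro: run.intros)+
  apply (cases "bval b s")
   apply (fastforce elim: IfE intro: run.intros)+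
  done

primrec svars :: "com \<Rightarrow> string set" where
  "svars Skip = {}"
| "svars (Assign x e) = {x}"
| "svars (Write a e e') = {}"
| "svars (Seq c d) = svars c \<union> svars d"
| "svars (If b c d) = svars c \<union> svars d"
| "svars (While b c) = svars c"

primrec avars :: "com \<Rightarrow> string set" where
  "avars Skip = {}"
| "avars (Assign x e) = {}"
| "avars (Write a e e') = {a}"
| "avars (Seq c d) = avars c \<union> avars d"
| "avars (If b c d) = avars c \<union> avars d"
| "avars (While b c) = avars c"

text \<open>Read off the syntax, so that loop invariants need not mention the variables and arrays
  that a loop leaves alone.\<close>

definition frame :: "com \<Rightarrow> state \<Rightarrow> state \<Rightarrow> bool" where
  "frame c s s' \<longleftrightarrow> (\<forall>x. x \<notin> svars c \<longrightarrow> scal s' x = scal s x) \<and>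
                  (\<forall>a. a \<notin> avars c \<longrightarrow> arr s' a = arr s a)"

lemma frame_scal: "frame c s s' \<Longrightarrow> x \<notin> svars c \<Longrightarrow> scal s' x = scal s x"
  and frame_arr: "frame c s s' \<Longrightarrow> a \<notin> avars c \<Longrightarrow> arr s' a = arr s a"
  by (auto simp: frame_def)

lemma run_frame: "run c s t s' \<Longrightarrow> frame c s s'"
  by (induction rule: run.induct) (auto simp: frame_def)

lemma wp_conseq:
  assumes "wp c s P" and "\<And>t s'. P t s' \<Longrightarrow> frame c s s' \<Longrightarrow> Q t s'"
  shows "wp c s Q"
  using assms run_frame unfolding wp_def by blast

text \<open>\<open>\<Phi>\<close> is both the termination measure and the time budget. The strict
  decrease pays for the successful test of each iteration; the \<open>+ 1\<close> at the exit is the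
  final failing test.\<close>

lemma wp_while:
  fixes \<Phi> :: "state \<Rightarrow> nat"
  assumes "I s0"
    and step: "\<And>s. I s \<Longrightarrow> frame (While b c) s0 s \<Longrightarrow> bval b s \<Longrightarrow>
                 wp c s (\<lambda>t s'. I s' \<and> \<Phi> s' + t < \<Phi> s)"
    and exit: "\<And>s t. I s \<Longrightarrow> frame (While b c) s0 s \<Longrightarrow> \<not> bval b s \<Longrightarrow>
                 t + \<Phi> s \<le> \<Phi> s0 + 1 \<Longrightarrow> Q t s"
  shows "wp (While b c) s0 Q"
proof -
  have "\<exists>t s'. run (While b c) s t s' \<and> I s' \<and> \<not> bval b s' \<and> t + \<Phi> s' \<le> \<Phi> s + 1"
    if "I s" "frame (While b c) s0 s" for s
    using that
  proof (induction "\<Phi> s" arbitrary: s rule: less_induct)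
    case less
    show ?case
    proof (cases "bval b s")
      case True
      then obtain t s' where 1: "run c s t s'" "I s'" "\<Phi> s' + t < \<Phi> s"
        using step[OF less.prems True] by (auto simp: wp_def)
      have "frame (While b c) s0 s'"
        using run_frame[OF 1(1)] less.prems(2) by (auto simp: frame_def)
      then obtain t' s'' where
        "run (While b c) s' t' s''" "I s''" "\<not> bval b s''" "t' + \<Phi> s'' \<le> \<Phi> s' + 1"
        using less.hyps[of s'] 1 by auto
      with 1 True show ?thesis
        by (intro exI[of _ "Suc (t + t')"] exI[of _ s'']) (auto intro: run.WhileTrue)
    next
      case False
      with less.prems show ?thesis
        by (intro exI[of _ 1] exI[of _ s]) (auto intro: run.WhileFalse[unfolded One_nat_def])
    qed
  qed
  moreover have "frame (While b c) s0 s0" by (simp add: frame_def)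
  ultimately obtain t s' where
    "run (While b c) s0 t s'" "I s'" "\<not> bval b s'" "t + \<Phi> s' \<le> \<Phi> s0 + 1"
    using \<open>I s0\<close> by blast
  with exit run_frame show ?thesis unfolding wp_def by blast
qed

section \<open>Residual networks and weak duality\<close>

text \<open>Arcs are numbered from 1 to \<open>M\<close>, each with its reversal \<open>rv a\<close>; \<open>z\<close> gives the residual
  capacities of the zero circulation.  A flow is represented by its residual capacities, so the
  excess of a node is measured by comparison with \<open>z\<close>.\<close>

locale residual_network =
  fixes k M :: int and src dst cs rv z :: "int \<Rightarrow> int"
  assumes src_range: "a \<in> {1..M} \<Longrightarrow> src a \<in> {1..k}"
    and dst_range: "a \<in> {1..M} \<Longrightarrow> dst a \<in> {1..k}"
    and rv_range: "a \<in> {1..M} \<Longrightarrow> rv a \<in> {1..M}"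
    and rv_rv: "a \<in> {1..M} \<Longrightarrow> rv (rv a) = a"
    and src_rv: "a \<in> {1..M} \<Longrightarrow> src (rv a) = dst a"
    and cs_rv: "a \<in> {1..M} \<Longrightarrow> cs (rv a) = - cs a"
    and z_nonneg: "a \<in> {1..M} \<Longrightarrow> 0 \<le> z a"
    and k_nonneg: "0 \<le> k"
    and M_nonneg: "0 \<le> M"
begin

lemma dst_rv: "a \<in> {1..M} \<Longrightarrow> dst (rv a) = src a"
  using src_rv[of "rv a"] rv_rv rv_range by auto

lemma bij_rv: "bij_betw rv {1..M} {1..M}"
  by (rule bij_betw_byWitness[where f' = rv]) (use rv_rv rv_range in auto)

lemma sum_rv: "(\<Sum>a\<in>{1..M}. g (rv a)) = (\<Sum>a\<in>{1..M}. g a)"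
  by (rule sum.reindex_bij_betw[OF bij_rv])

lemma sum_by_tail:
  fixes g :: "int \<Rightarrow> 'b::comm_monoid_add"
  shows "(\<Sum>v\<in>{1..k}. \<Sum>a\<in>{a\<in>{1..M}. src a = v}. g a) = (\<Sum>a\<in>{1..M}. g a)"
  by (rule sum.group) (auto dest: src_range)

definition residual :: "(int \<Rightarrow> 'b::linordered_idom) \<Rightarrow> bool" where
  "residual r \<longleftrightarrow> (\<forall>a\<in>{1..M}. 0 \<le> r a \<and> r a + r (rv a) = of_int (z a + z (rv a)))"

text \<open>For a \<open>residual\<close> function, \<open>z a - r a\<close> is the net flow along
  \<open>a\<close> and changes sign under \<open>rv\<close>. The sum is therefore inflow minus
  outflow.\<close>

definition excess :: "(int \<Rightarrow> 'b::linordered_idom) \<Rightarrow> int \<Rightarrow> 'b" where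
  "excess r v = (\<Sum>a\<in>{a\<in>{1..M}. src a = v}. r a - of_int (z a))"

definition rc :: "(int \<Rightarrow> int) \<Rightarrow> int \<Rightarrow> int" where
  "rc \<pi> a = cs a + \<pi> (src a) - \<pi> (dst a)"

lemma rc_rv: "a \<in> {1..M} \<Longrightarrow> rc \<pi> (rv a) = - rc \<pi> a"
  by (simp add: rc_def src_rv dst_rv cs_rv)

text \<open>Dual feasibility of the potential, that is, the reduced cost optimality
  condition.\<close>

definition rc_nonneg :: "(int \<Rightarrow> int) \<Rightarrow> (int \<Rightarrow> int) \<Rightarrow> bool" where
  "rc_nonneg r \<pi> \<longleftrightarrow> (\<forall>a\<in>{1..M}. 0 < r a \<longrightarrow> 0 \<le> rc \<pi> a)"

lemma residual_z: "residual (\<lambda>a. of_int (z a) :: 'b::linordered_idom)"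
  by (auto simp: residual_def z_nonneg)

lemma sum_excess:
  fixes r :: "int \<Rightarrow> int"
  assumes "residual r"
  shows "(\<Sum>v\<in>{1..k}. excess r v) = 0"
proof -
  have "(\<Sum>a\<in>{1..M}. r a + r (rv a)) = (\<Sum>a\<in>{1..M}. z a + z (rv a))"
    using assms by (intro sum.cong) (auto simp: residual_def)
  hence "(\<Sum>a\<in>{1..M}. r a) = (\<Sum>a\<in>{1..M}. z a)"
    by (simp add: sum.distrib sum_rv)
  thus ?thesis
    unfolding excess_def sum_by_tail by (simp add: sum_subtractf)
qed

text \<open>The difference \<open>r - h\<close> is antisymmetric under \<open>rv\<close>, and where
  it is positive \<open>r\<close> has residual capacity and so nonnegative reduced cost. Summing
  reduced cost times difference turns the potentials into excesses. The factor 2 appears because an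
  arc is counted together with its reversal.\<close>

lemma weak_duality:
  fixes h :: "int \<Rightarrow> 'b::linordered_idom" and r \<pi> :: "int \<Rightarrow> int"
  assumes r: "residual r" and t: "rc_nonneg r \<pi>" and h: "residual h"
    and h0: "\<And>v. v \<in> {1..k} \<Longrightarrow> excess h v = 0"
  shows "of_int (- 2 * (\<Sum>v\<in>{1..k}. \<pi> v * excess r v))
           \<le> (\<Sum>a\<in>{1..M}. of_int (cs a) * (of_int (r a) - h a))"
proof -
  let ?x = "\<lambda>a. of_int (r a) - h a :: 'b"
  have x_rv: "?x (rv a) = - ?x a" if "a \<in> {1..M}" for a
  proof -
    have "h a + h (rv a) = of_int (r a + r (rv a))"
      using r h that by (auto simp: residual_def)
    thus ?thesis by (simp add: algebra_simps)
  qed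
  \<comment> \<open>A negative difference is handled on the reversal, where both the difference and
    the reduced cost change sign.\<close>
  have nonneg: "0 \<le> of_int (rc \<pi> a) * ?x a" if a: "a \<in> {1..M}" for a
  proof (cases "0 < ?x a")
    case True
    hence "(0::'b) < of_int (r a)"
      using h a unfolding residual_def by (smt (verit) diff_gt_0_iff_gt order_le_less_trans)
    hence "0 < r a" by simp
    hence "0 \<le> rc \<pi> a" using t a by (auto simp: rc_nonneg_def)
    thus ?thesis using True by simp
  next
    case False
    show ?thesis
    proof (cases "?x a = 0")
      case True
      thus ?thesis by simp
    next
      case F: False
      have ra: "rv a \<in> {1..M}" using a by (rule rv_range)
      have "0 < ?x (rv a)" using x_rv[OF a] F False by auto
      hence "(0::'b) < of_int (r (rv a))"
        using h ra unfolding residual_def by (smt (verit) diff_gt_0_iff_gt order_le_less_trans)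
      hence "0 < r (rv a)" by simp
      hence "0 \<le> rc \<pi> (rv a)" using t ra by (auto simp: rc_nonneg_def)
      hence "rc \<pi> a \<le> 0" using a by (simp add: rc_rv)
      thus ?thesis using False by (intro mult_nonpos_nonpos) auto
    qed
  qed
  have tails: "(\<Sum>a\<in>{1..M}. of_int (\<pi> (src a)) * ?x a) = of_int (\<Sum>v\<in>{1..k}. \<pi> v * excess r v)"
  proof -
    have "(\<Sum>a\<in>{1..M}. of_int (\<pi> (src a)) * ?x a)
        = (\<Sum>v\<in>{1..k}. \<Sum>a\<in>{a\<in>{1..M}. src a = v}. of_int (\<pi> (src a)) * ?x a)"
      by (rule sum_by_tail[symmetric])
    also have "\<dots> = (\<Sum>v\<in>{1..k}. of_int (\<pi> v) * (\<Sum>a\<in>{a\<in>{1..M}. src a = v}. ?x a))"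
      by (auto simp: sum_distrib_left intro!: sum.cong)
    also have "\<dots> = (\<Sum>v\<in>{1..k}. of_int (\<pi> v) * (of_int (excess r v) - excess h v))"
      by (intro sum.cong refl) (simp add: excess_def sum_subtractf)
    also have "\<dots> = of_int (\<Sum>v\<in>{1..k}. \<pi> v * excess r v)"
      using h0 by simp
    finally show ?thesis .
  qed
  \<comment> \<open>A head is the tail of the reversed arc, whose difference has the opposite sign.
    The two potential sums hence add up instead of cancelling.\<close>
  have heads: "(\<Sum>a\<in>{1..M}. of_int (\<pi> (dst a)) * ?x a)
             = - (\<Sum>a\<in>{1..M}. of_int (\<pi> (src a)) * ?x a)"
  proof -
    have "(\<Sum>a\<in>{1..M}. of_int (\<pi> (dst a)) * ?x a)
        = (\<Sum>a\<in>{1..M}. of_int (\<pi> (src (rv a))) * - ?x (rv a))"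
      by (rule sum.cong[OF refl]) (simp only: src_rv x_rv minus_minus)
    also have "\<dots> = (\<Sum>a\<in>{1..M}. of_int (\<pi> (src a)) * - ?x a)"
      by (rule sum_rv)
    finally show ?thesis by (simp only: mult_minus_right sum_negf)
  qed
  have "0 \<le> (\<Sum>a\<in>{1..M}. of_int (rc \<pi> a) * ?x a)"
    by (rule sum_nonneg) (rule nonneg)
  also have "\<dots> = (\<Sum>a\<in>{1..M}. of_int (cs a) * ?x a)
      + (\<Sum>a\<in>{1..M}. of_int (\<pi> (src a)) * ?x a) - (\<Sum>a\<in>{1..M}. of_int (\<pi> (dst a)) * ?x a)"
    by (simp only: rc_def of_int_add of_int_diff distrib_right left_diff_distrib
        sum.distrib sum_subtractf)
  finally show ?thesis
    unfolding heads tails by simp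
qed

section \<open>A bound on the common potential of the deficit nodes\<close>

definition cost_bound :: int where
  "cost_bound = (\<Sum>a\<in>{1..M}. \<bar>cs a\<bar> * z a)"

definition total_excess :: "(int \<Rightarrow> int) \<Rightarrow> int" where
  "total_excess x = (\<Sum>v\<in>{1..k}. max 0 (x v))"

definition state_inv :: "(int \<Rightarrow> int) \<Rightarrow> (int \<Rightarrow> int) \<Rightarrow> (int \<Rightarrow> int) \<Rightarrow> int \<Rightarrow> bool" where
  "state_inv r x \<pi> D \<longleftrightarrow> residual r \<and> rc_nonneg r \<pi> \<and> 0 \<le> D \<and>
     (\<forall>v\<in>{1..k}. x v = excess r v \<and> (0 < x v \<longrightarrow> \<pi> v = 0) \<and> (x v < 0 \<longrightarrow> \<pi> v = D))"

text \<open>Weak duality against the zero circulation \<open>z\<close>. Nodes with excess have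
  potential 0, so only deficits enter the dual term, each weighted by \<open>D\<close>; the excesses
  sum to 0, which makes the total deficit \<open>total_excess x\<close>.\<close>

lemma distance_bound:
  assumes "state_inv r x \<pi> D"
  shows "D * total_excess x \<le> cost_bound"
proof -
  have r: "residual r" and t: "rc_nonneg r \<pi>" and x: "\<And>v. v \<in> {1..k} \<Longrightarrow> x v = excess r v"
    using assms by (auto simp: state_inv_def)
  have pi: "\<pi> v * x v = D * (x v - max 0 (x v))" if "v \<in> {1..k}" for v
    using assms that unfolding state_inv_def by (cases "x v" "0::int" rule: linorder_cases) auto
  have "(\<Sum>v\<in>{1..k}. x v) = 0"
    using sum_excess[OF r] x by simp
  hence "(\<Sum>v\<in>{1..k}. \<pi> v * x v) = - (D * total_excess x)"
    by (simp add: pi total_excess_def sum_subtractf flip: sum_distrib_left)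
  hence pe: "(\<Sum>v\<in>{1..k}. \<pi> v * excess r v) = - (D * total_excess x)"
    using x by simp
  have "2 * (D * total_excess x) \<le> (\<Sum>a\<in>{1..M}. cs a * (r a - z a))"
    using weak_duality[OF r t, of z] residual_z[where ?'b = int] pe
    by (simp add: excess_def)
  also have "\<dots> \<le> (\<Sum>a\<in>{1..M}. \<bar>cs a\<bar> * z a + \<bar>cs (rv a)\<bar> * z (rv a))"
  proof (rule sum_mono)
    fix a assume a: "a \<in> {1..M}"
    have ra: "rv a \<in> {1..M}" using a by (rule rv_range)
    \<comment> \<open>Both \<open>r a\<close> and \<open>z a\<close> lie between 0 and the pair sum
      \<open>z a + z (rv a)\<close>.\<close>
    have "\<bar>r a - z a\<bar> \<le> z a + z (rv a)"
      using r a ra z_nonneg[OF a] z_nonneg[OF ra] unfolding residual_def by (smt (verit) of_int_eq_id id_apply)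
    hence "\<bar>cs a\<bar> * \<bar>r a - z a\<bar> \<le> \<bar>cs a\<bar> * (z a + z (rv a))"
      by (intro mult_left_mono) auto
    moreover have "cs a * (r a - z a) \<le> \<bar>cs a\<bar> * \<bar>r a - z a\<bar>"
      by (metis abs_ge_self abs_mult)
    ultimately show "cs a * (r a - z a) \<le> \<bar>cs a\<bar> * z a + \<bar>cs (rv a)\<bar> * z (rv a)"
      using cs_rv[OF a] by (simp add: distrib_left)
  qed
  also have "\<dots> = 2 * cost_bound"
    using sum_rv[of "\<lambda>a. \<bar>cs a\<bar> * z a"] by (simp add: sum.distrib cost_bound_def)
  finally show ?thesis by simp
qed

end

section \<open>Breadth-first search along tight arcs\<close>

text \<open>\<open>vis w\<close> is the position of \<open>w\<close> in the queue \<open>q\<close>, and 0 for nodes that never entered it.\<close>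

definition queue :: "int set \<Rightarrow> int \<Rightarrow> (int \<Rightarrow> int) \<Rightarrow> (int \<Rightarrow> int) \<Rightarrow> bool" where
  "queue W n vis q \<longleftrightarrow> 0 \<le> n \<and>
     (\<forall>w\<in>W. 0 \<le> vis w \<and> vis w \<le> n \<and> (0 < vis w \<longrightarrow> q (vis w) = w)) \<and>
     (\<forall>i\<in>{1..n}. q i \<in> W \<and> vis (q i) = i)"

text \<open>The disjunction covers two uses: initialising a node whose \<open>vis\<close> entry is
  left over from an earlier search, and discovering a known node whose entry is 0.\<close>

lemma queue_push:
  assumes "queue W n vis q" "w \<notin> W \<or> vis w = 0"
  shows "queue (insert w W) (n + 1) (vis(w := n + 1)) (q(n + 1 := w))"
  using assms unfolding queue_def by (auto simp: order.order_iff_strict)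

lemma queue_skip:
  assumes "queue W n vis q" "w \<notin> W"
  shows "queue (insert w W) n (vis(w := 0)) q"
  using assms unfolding queue_def by auto

text \<open>\<open>vis\<close> inverts \<open>q\<close> on the occupied positions, so no node is
  queued twice. This limits both the number of dequeue steps and the length of an augmenting
  path.\<close>

lemma queue_bound:
  assumes "queue {1..k} n vis q"
  shows "n \<le> max 0 k"
proof -
  have "inj_on q {1..n}"
    using assms unfolding queue_def by (metis inj_onI)
  hence "card {1..n} \<le> card {1..k}"
    using assms by (intro card_inj_on_le) (auto simp: queue_def)
  thus ?thesis by simp
qed

text \<open>The arcs leaving \<open>v\<close> form a linked list in decreasing order, from \<open>first v\<close> on and terminated
  by 0.\<close>

definition linked :: "(int \<Rightarrow> int) \<Rightarrow> int \<Rightarrow> (int \<Rightarrow> int) \<Rightarrow> (int \<Rightarrow> int) \<Rightarrow> bool" where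
  "linked src A first nxt \<longleftrightarrow>
     (\<forall>v. first v \<in> {0..A} \<and> (0 < first v \<longrightarrow> src (first v) = v) \<and>
          (\<forall>b\<in>{1..A}. src b = v \<longrightarrow> b \<le> first v)) \<and>
     (\<forall>a\<in>{1..A}. nxt a \<in> {0..<a} \<and> (0 < nxt a \<longrightarrow> src (nxt a) = src a) \<and>
          (\<forall>b\<in>{1..<a}. src b = src a \<longrightarrow> b \<le> nxt a))"

context residual_network
begin

text \<open>\<open>par v\<close> is the arc through which \<open>v\<close> was found, and 0 for the sources of the search.\<close>

definition tree ::
    "(int \<Rightarrow> int) \<Rightarrow> (int \<Rightarrow> int) \<Rightarrow> (int \<Rightarrow> int) \<Rightarrow> (int \<Rightarrow> int) \<Rightarrow> (int \<Rightarrow> int) \<Rightarrow> bool" where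
  "tree r x \<pi> vis par \<longleftrightarrow> (\<forall>v\<in>{1..k}. 0 < vis v \<longrightarrow>
     (if par v = 0 then 0 < x v
      else par v \<in> {1..M} \<and> dst (par v) = v \<and> 0 < r (par v) \<and> rc \<pi> (par v) = 0 \<and>
           0 < vis (src (par v)) \<and> vis (src (par v)) < vis v))"

text \<open>The nodes at positions up to \<open>qh\<close> have been dequeued; \<open>u\<close> is the last of them, and
  \<open>a\<close> is its next arc to be scanned (0 if there is none).\<close>

definition search_inv where
  "search_inv r x \<pi> qh qt a u tgt vis q par \<longleftrightarrow>
     queue {1..k} qt vis q \<and> 0 \<le> qh \<and> qh \<le> qt \<and>
     a \<in> {0..M} \<and> (0 < a \<longrightarrow> src a = u \<and> 0 < qh \<and> u = q qh) \<and>
     (\<forall>v\<in>{1..k}. 0 < x v \<longrightarrow> 0 < vis v) \<and> tree r x \<pi> vis par \<and>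
     (\<forall>b\<in>{1..M}. 0 < vis (src b) \<and> vis (src b) \<le> qh \<and> \<not> (b \<le> a \<and> src b = u) \<and>
        0 < r b \<and> rc \<pi> b = 0 \<longrightarrow> 0 < vis (dst b)) \<and>
     (if tgt = 0 then \<forall>v\<in>{1..k}. 0 < vis v \<and> vis v \<le> qh \<longrightarrow> 0 \<le> x v
      else tgt \<in> {1..k} \<and> 0 < vis tgt \<and> x tgt < (0::int))"

text \<open>The search exhausts the queue even after meeting a deficit node. Closure under tight
  residual arcs is thus available in both outcomes, and there is a single exit condition.\<close>

definition search_post where
  "search_post r x \<pi> tgt vis par \<longleftrightarrow>
     (\<forall>v\<in>{1..k}. 0 \<le> vis v \<and> vis v \<le> k) \<and>
     (\<forall>v\<in>{1..k}. 0 < x v \<longrightarrow> 0 < vis v) \<and> tree r x \<pi> vis par \<and>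
     (\<forall>b\<in>{1..M}. 0 < vis (src b) \<and> 0 < r b \<and> rc \<pi> b = 0 \<longrightarrow> 0 < vis (dst b)) \<and>
     (if tgt = 0 then \<forall>v\<in>{1..k}. 0 < vis v \<longrightarrow> 0 \<le> x v
      else tgt \<in> {1..k} \<and> 0 < vis tgt \<and> x tgt < (0::int))"

text \<open>The arcs still to be scanned: their tail is undiscovered, or waits in the queue, or is
  the current node with the arc not yet passed. Discovering a node moves its arcs from the first
  kind to the second, so the set shrinks only by scanning.\<close>

definition pending :: "int \<Rightarrow> int \<Rightarrow> int \<Rightarrow> (int \<Rightarrow> int) \<Rightarrow> int set" where
  "pending qh a u vis =
     {b\<in>{1..M}. vis (src b) \<le> 0 \<or> qh < vis (src b) \<or> (b \<le> a \<and> src b = u)}"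

lemma card_pending_le: "card (pending qh a u vis) \<le> nat M"
proof -
  have "card (pending qh a u vis) \<le> card {1..M}"
    by (rule card_mono) (auto simp: pending_def)
  thus ?thesis by simp
qed

lemma finite_pending [simp]: "finite (pending qh a u vis)"
  by (rule finite_subset[of _ "{1..M}"]) (auto simp: pending_def)

lemma search_inv_exit:
  assumes "search_inv r x \<pi> qh qt a u tgt vis q par" "\<not> 0 < a" "\<not> qh < qt"
  shows "search_post r x \<pi> tgt vis par"
proof -
  have "qt \<le> k"
    using assms(1) queue_bound[of k qt vis q] k_nonneg by (auto simp: search_inv_def)
  moreover have a: "a = 0" and qh: "qh = qt"
    using assms by (auto simp: search_inv_def)
  moreover have vis: "0 \<le> vis v \<and> vis v \<le> qt" if "v \<in> {1..k}" for v
    using assms(1) that by (simp add: search_inv_def queue_def)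
  moreover have "vis (src b) \<le> qt" if "b \<in> {1..M}" for b
    using vis[OF src_range[OF that]] by simp
  ultimately show ?thesis
    using assms(1) unfolding search_inv_def search_post_def by (smt (verit) atLeastAtMost_iff)
qed

text \<open>Position \<open>qh + 1\<close> belongs to \<open>u'\<close> alone, and all arcs leaving
  \<open>u'\<close> are numbered at most \<open>first u'\<close>. They all count as unscanned, so
  the closure condition asks nothing new. Progress is measured by \<open>k - qh\<close>, since the
  pending set need not shrink.\<close>

lemma search_inv_pop:
  assumes inv: "search_inv r x \<pi> qh qt 0 u tgt vis q par" and lt: "qh < qt"
    and l: "linked src M first nxt"
    and u': "u' = q (qh + 1)"
    and tgt': "tgt' = (if x u' < 0 then u' else tgt)"
  shows "search_inv r x \<pi> (qh + 1) qt (first u') u' tgt' vis q par"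
    and "qh < k"
    and "card (pending (qh + 1) (first u') u' vis) \<le> card (pending qh 0 u vis)"
proof -
  have q: "queue {1..k} qt vis q" and qh: "0 \<le> qh"
    using inv by (auto simp: search_inv_def)
  have mem: "qh + 1 \<in> {1..qt}" using lt qh by auto
  have V: "u' \<in> {1..k}" using q mem u' by (auto simp: queue_def)
  have vu: "vis u' = qh + 1" using q mem u' by (auto simp: queue_def)
  show "qh < k" using queue_bound[OF q] lt k_nonneg by auto
  have inj: "v = u'" if "v \<in> {1..k}" "vis v = qh + 1" for v
    using q that u' qh unfolding queue_def by force
  have f: "first u' \<in> {0..M}" "0 < first u' \<Longrightarrow> src (first u') = u'"
    "\<And>b. b \<in> {1..M} \<Longrightarrow> src b = u' \<Longrightarrow> b \<le> first u'"
    using l by (auto simp: linked_def)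
  have closed: "0 < vis (dst b)"
    if b: "b \<in> {1..M}" "0 < vis (src b)" "vis (src b) \<le> qh + 1"
      "\<not> (b \<le> first u' \<and> src b = u')" "0 < r b" "rc \<pi> b = 0" for b
  proof -
    have "src b \<noteq> u'" using b f(3) by blast
    hence "vis (src b) \<noteq> qh + 1" using inj src_range b(1) by blast
    hence "vis (src b) \<le> qh" using b(3) by auto
    thus ?thesis using inv b unfolding search_inv_def by force
  qed
  have tgt: "if tgt' = 0 then \<forall>v\<in>{1..k}. 0 < vis v \<and> vis v \<le> qh + 1 \<longrightarrow> 0 \<le> x v
     else tgt' \<in> {1..k} \<and> 0 < vis tgt' \<and> x tgt' < 0"
  proof (cases "x u' < 0")
    case True
    thus ?thesis using tgt' V vu qh by auto
  next
    case False
    have "0 \<le> x v" if "tgt = 0" "v \<in> {1..k}" "0 < vis v" "vis v \<le> qh + 1" for v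
    proof (cases "vis v = qh + 1")
      case True
      then show ?thesis using inj that False by auto
    next
      case F: False
      then show ?thesis using inv that by (auto simp: search_inv_def)
    qed
    thus ?thesis using inv False tgt' unfolding search_inv_def by auto
  qed
  show "search_inv r x \<pi> (qh + 1) qt (first u') u' tgt' vis q par"
    using inv f(1,2) closed tgt lt qh u' unfolding search_inv_def by auto
  show "card (pending (qh + 1) (first u') u' vis) \<le> card (pending qh 0 u vis)"
    using vu by (intro card_mono finite_pending) (auto simp: pending_def)
qed

text \<open>As the list is decreasing and complete, the arcs of \<open>u\<close> numbered at most
  \<open>a\<close> are \<open>a\<close> itself and those at most \<open>nxt a\<close>. Only
  \<open>a\<close> has to be checked for closure, and only \<open>a\<close> leaves the pending
  set.\<close>

lemma search_inv_advance:
  assumes inv: "search_inv r x \<pi> qh qt a u tgt vis q par" and a: "0 < a"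
    and l: "linked src M first nxt"
    and c: "\<not> (0 < r a \<and> rc \<pi> a = 0) \<or> 0 < vis (dst a)"
  shows "search_inv r x \<pi> qh qt (nxt a) u tgt vis q par"
    and "card (pending qh (nxt a) u vis) < card (pending qh a u vis)"
proof -
  have aM: "a \<in> {1..M}" and tla: "src a = u" and qh: "0 < qh" "qh \<le> qt" and u: "u = q qh"
    and q: "queue {1..k} qt vis q"
    using inv a by (auto simp: search_inv_def)
  have n: "nxt a \<in> {0..<a}" "0 < nxt a \<Longrightarrow> src (nxt a) = src a"
    "\<And>b. b \<in> {1..<a} \<Longrightarrow> src b = src a \<Longrightarrow> b \<le> nxt a"
    using l aM by (auto simp: linked_def)
  have vu: "vis u = qh" using q qh u by (auto simp: queue_def)
  have closed: "0 < vis (dst b)"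
    if b: "b \<in> {1..M}" "0 < vis (src b)" "vis (src b) \<le> qh" "\<not> (b \<le> nxt a \<and> src b = u)"
      "0 < r b" "rc \<pi> b = 0" for b
  proof (cases "b = a")
    case True
    thus ?thesis using c b by auto
  next
    case False
    have "\<not> (b \<le> a \<and> src b = u)"
    proof
      assume "b \<le> a \<and> src b = u"
      hence "b \<in> {1..<a}" "src b = src a" using False b(1) tla by auto
      thus False using n(3) b(4) \<open>b \<le> a \<and> src b = u\<close> by auto
    qed
    thus ?thesis using inv b unfolding search_inv_def by blast
  qed
  show "search_inv r x \<pi> qh qt (nxt a) u tgt vis q par"
    using inv closed n(1,2) aM tla unfolding search_inv_def by auto
  have "pending qh (nxt a) u vis \<subset> pending qh a u vis"
  proof
    show "pending qh (nxt a) u vis \<subseteq> pending qh a u vis"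
      using n(1) by (auto simp: pending_def)
    have "a \<in> pending qh a u vis" "a \<notin> pending qh (nxt a) u vis"
      using aM tla vu qh n(1) by (auto simp: pending_def)
    thus "pending qh (nxt a) u vis \<noteq> pending qh a u vis" by blast
  qed
  thus "card (pending qh (nxt a) u vis) < card (pending qh a u vis)"
    by (intro psubset_card_mono) auto
qed

text \<open>The new node is queued behind \<open>qh\<close>, so nothing is claimed yet about its
  outgoing arcs. It differs from \<open>u\<close>, which already has a positive position; hence the
  current scan is undisturbed.\<close>

lemma search_inv_push:
  assumes inv: "search_inv r x \<pi> qh qt a u tgt vis q par" and a: "0 < a"
    and c: "0 < r a" "rc \<pi> a = 0" "vis (dst a) = 0"
    and vis': "vis' = vis(dst a := qt + 1)"
  shows "search_inv r x \<pi> qh (qt + 1) a u tgt vis' (q(qt + 1 := dst a)) (par(dst a := a))"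
    and "pending qh a u vis' = pending qh a u vis"
proof -
  let ?w = "dst a"
  have aM: "a \<in> {1..M}" and tla: "src a = u" and qh: "0 < qh" "qh \<le> qt" and u: "u = q qh"
    and q: "queue {1..k} qt vis q"
    using inv a by (auto simp: search_inv_def)
  have vu: "vis u = qh" using q qh u by (auto simp: queue_def)
  have wu: "?w \<noteq> u" using vu qh c(3) by auto
  have wV: "?w \<in> {1..k}" using aM by (rule dst_range)
  have "queue (insert ?w {1..k}) (qt + 1) vis' (q(qt + 1 := ?w))"
    unfolding vis' by (rule queue_push[OF q]) (simp add: c(3))
  hence q': "queue {1..k} (qt + 1) vis' (q(qt + 1 := ?w))"
    using wV by (simp add: insert_absorb)
  have tree': "tree r x \<pi> vis' (par(?w := a))"
    unfolding tree_def
  proof (intro ballI impI)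
    fix v assume v: "v \<in> {1..k}" "0 < vis' v"
    show "if (par(?w := a)) v = 0 then 0 < x v
      else (par(?w := a)) v \<in> {1..M} \<and> dst ((par(?w := a)) v) = v \<and> 0 < r ((par(?w := a)) v) \<and>
        rc \<pi> ((par(?w := a)) v) = 0 \<and> 0 < vis' (src ((par(?w := a)) v)) \<and>
        vis' (src ((par(?w := a)) v)) < vis' v"
    proof (cases "v = ?w")
      case True
      thus ?thesis using a aM c wu vu qh tla by (auto simp: vis')
    next
      case False
      hence "0 < vis v" using v by (simp add: vis')
      hence t: "if par v = 0 then 0 < x v
        else par v \<in> {1..M} \<and> dst (par v) = v \<and> 0 < r (par v) \<and> rc \<pi> (par v) = 0 \<and>
           0 < vis (src (par v)) \<and> vis (src (par v)) < vis v"
        using inv v(1) unfolding search_inv_def tree_def by blast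
      show ?thesis
      proof (cases "par v = 0")
        case True
        thus ?thesis using t False by simp
      next
        case F: False
        hence "src (par v) \<noteq> ?w" using t c(3) by auto
        thus ?thesis using t False F by (simp add: vis')
      qed
    qed
  qed
  show "search_inv r x \<pi> qh (qt + 1) a u tgt vis' (q(qt + 1 := ?w)) (par(?w := a))"
    unfolding search_inv_def
  proof (intro conjI)
    show "queue {1..k} (qt + 1) vis' (q(qt + 1 := ?w))" by (rule q')
    show "tree r x \<pi> vis' (par(?w := a))" by (rule tree')
    show "\<forall>b\<in>{1..M}. 0 < vis' (src b) \<and> vis' (src b) \<le> qh \<and> \<not> (b \<le> a \<and> src b = u) \<and>
        0 < r b \<and> rc \<pi> b = 0 \<longrightarrow> 0 < vis' (dst b)"
    proof (intro ballI impI, elim conjE)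
      fix b assume b: "b \<in> {1..M}" "0 < vis' (src b)" "vis' (src b) \<le> qh"
        "\<not> (b \<le> a \<and> src b = u)" "0 < r b" "rc \<pi> b = 0"
      hence "src b \<noteq> ?w" using qh by (auto simp: vis')
      hence "0 < vis (src b)" "vis (src b) \<le> qh" using b by (auto simp: vis')
      hence "0 < vis (dst b)" using inv b unfolding search_inv_def by blast
      thus "0 < vis' (dst b)" using qh by (simp add: vis')
    qed
    show "if tgt = 0 then \<forall>v\<in>{1..k}. 0 < vis' v \<and> vis' v \<le> qh \<longrightarrow> 0 \<le> x v
      else tgt \<in> {1..k} \<and> 0 < vis' tgt \<and> x tgt < 0"
      using inv qh unfolding search_inv_def by (auto simp: vis')
  qed (use inv qh u in \<open>auto simp: search_inv_def vis'\<close>)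
  show "pending qh a u vis' = pending qh a u vis"
    using qh c(3) by (auto simp: pending_def vis')
qed

section \<open>Pushing flow and raising potentials after a search\<close>

lemma treeD:
  assumes "tree r x \<pi> vis par" "v \<in> {1..k}" "0 < vis v"
  shows "par v = 0 \<Longrightarrow> 0 < x v"
    and "par v \<noteq> 0 \<Longrightarrow> par v \<in> {1..M} \<and> dst (par v) = v \<and> 0 < r (par v) \<and> rc \<pi> (par v) = 0 \<and>
           0 < vis (src (par v)) \<and> vis (src (par v)) < vis v"
  using assms unfolding tree_def by (metis (full_types))+

lemma search_postD:
  assumes "search_post r x \<pi> tgt vis par"
  shows "v \<in> {1..k} \<Longrightarrow> 0 \<le> vis v \<and> vis v \<le> k"
    and "v \<in> {1..k} \<Longrightarrow> 0 < x v \<Longrightarrow> 0 < vis v"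
    and "tree r x \<pi> vis par"
    and "b \<in> {1..M} \<Longrightarrow> 0 < vis (src b) \<Longrightarrow> 0 < r b \<Longrightarrow> rc \<pi> b = 0 \<Longrightarrow> 0 < vis (dst b)"
    and "tgt = 0 \<Longrightarrow> v \<in> {1..k} \<Longrightarrow> 0 < vis v \<Longrightarrow> 0 \<le> x v"
    and "tgt \<noteq> 0 \<Longrightarrow> tgt \<in> {1..k} \<and> 0 < vis tgt \<and> x tgt < 0"
  using assms unfolding search_post_def by (meson | simp)+

text \<open>Only \<open>rv a\<close> can become residual by the push. As \<open>a\<close> is tight,
  so is \<open>rv a\<close>, and dual feasibility survives.\<close>

lemma push_unit:
  assumes r: "residual r" and t: "rc_nonneg r \<pi>" and a: "a \<in> {1..M}" "0 < r a" "rc \<pi> a = 0"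
    and ne: "src a \<noteq> dst a" and r': "r' = r(a := r a - 1, rv a := r (rv a) + (1::int))"
  shows "residual r'" "rc_nonneg r' \<pi>"
    and "excess r' w = excess r w - (if w = src a then 1 else 0) + (if w = dst a then 1 else 0)"
proof -
  have ra: "rv a \<in> {1..M}" "rv (rv a) = a" "src (rv a) = dst a"
    using rv_range[OF a(1)] rv_rv[OF a(1)] src_rv[OF a(1)] by auto
  \<comment> \<open>Keeps the two updates in \<open>r'\<close> from hitting the same arc.\<close>
  have ne': "rv a \<noteq> a" using ra(3) ne by metis
  have r0: "0 \<le> r b" "r b + r (rv b) = z b + z (rv b)" if "b \<in> {1..M}" for b
    using r that by (auto simp: residual_def)
  show "residual r'"
    unfolding residual_def
  proof
    fix b assume b: "b \<in> {1..M}"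
    consider "b = a" | "b = rv a" | "b \<noteq> a" "b \<noteq> rv a" by blast
    thus "0 \<le> r' b \<and> r' b + r' (rv b) = of_int (z b + z (rv b))"
    proof cases
      case 3
      hence "rv b \<noteq> a" "rv b \<noteq> rv a" using rv_rv b a(1) by metis+
      thus ?thesis using 3 r0[OF b] by (simp add: r')
    qed (use ne' ra a r0[OF a(1)] r0[OF ra(1)] in \<open>auto simp: r'\<close>)
  qed
  show "rc_nonneg r' \<pi>"
    using t a rc_rv[OF a(1), of \<pi>] by (auto simp: rc_nonneg_def r' split: if_splits)
  let ?S = "{b \<in> {1..M}. src b = w}"
  have fin: "finite ?S" by (rule finite_subset[of _ "{1..M}"]) auto
  have "excess r' w = (\<Sum>b\<in>?S. (r b - z b) - (if b = a then 1 else 0) + (if b = rv a then 1 else 0))"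
    unfolding excess_def by (rule sum.cong) (auto simp: r' ne')
  also have "\<dots> = excess r w - (if a \<in> ?S then 1 else 0) + (if rv a \<in> ?S then 1 else 0)"
    using fin by (simp only: sum.distrib sum_subtractf sum.delta excess_def of_int_eq_id id_apply)
  finally show "excess r' w
      = excess r w - (if w = src a then 1 else 0) + (if w = dst a then 1 else 0)"
    using a(1) ra by auto
qed

text \<open>The reduced cost drops only on arcs from a reached to an unreached node, and only by 1.
  If such an arc is residual it is not tight, since the reached set is closed, so its integral
  reduced cost is at least 1.\<close>

lemma state_inv_raise:
  assumes inv: "state_inv r x \<pi> D" and post: "search_post r x \<pi> 0 vis par"
    and \<pi>': "\<And>v. v \<in> {1..k} \<Longrightarrow> \<pi>' v = \<pi> v + (if vis v = 0 then 1 else 0)"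
  shows "state_inv r x \<pi>' (D + 1)"
proof -
  have "rc_nonneg r \<pi>'"
    unfolding rc_nonneg_def
  proof (intro ballI impI)
    fix a assume a: "a \<in> {1..M}" "0 < r a"
    have V: "src a \<in> {1..k}" "dst a \<in> {1..k}" using a src_range dst_range by auto
    have "0 \<le> rc \<pi> a" using inv a by (auto simp: state_inv_def rc_nonneg_def)
    moreover have "rc \<pi> a \<noteq> 0" if "vis (src a) \<noteq> 0" "vis (dst a) = 0"
      using search_postD(1)[OF post V(1)] search_postD(4)[OF post] a that by force
    moreover have "rc \<pi>' a = rc \<pi> a + (if vis (src a) = 0 then 1 else 0) - (if vis (dst a) = 0 then 1 else 0)"
      using V by (simp add: rc_def \<pi>')
    ultimately show "0 \<le> rc \<pi>' a" by (auto split: if_splits)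
  qed
  moreover have "\<pi>' v = 0" if "v \<in> {1..k}" "0 < x v" for v
    using inv search_postD(2)[OF post that] that \<pi>'[OF that(1)] by (simp add: state_inv_def)
  \<comment> \<open>The search found no deficit node, so all of them are unreached and rise
    together.\<close>
  moreover have "\<pi>' v = D + 1" if "v \<in> {1..k}" "x v < 0" for v
  proof -
    have "vis v = 0"
      using search_postD(1)[OF post that(1)] search_postD(5)[OF post refl that(1)] that(2) by force
    thus ?thesis using inv that \<pi>'[OF that(1)] by (simp add: state_inv_def)
  qed
  ultimately show ?thesis using inv by (simp add: state_inv_def)
qed

text \<open>The path is traced backwards from the target, and the stored excess is written only at
  its two ends. Until the root is reached, the stored value at the current node \<open>v\<close> is
  one too large; pushing a unit along the parent arc of \<open>v\<close> moves this discrepancy to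
  the tail.\<close>

definition path_inv where
  "path_inv \<pi> vis par x r v \<longleftrightarrow> residual r \<and> rc_nonneg r \<pi> \<and> v \<in> {1..k} \<and> 0 < vis v \<and>
     (\<forall>w\<in>{1..k}. x w = excess r w + (if w = v then 1 else 0)) \<and>
     (\<forall>w\<in>{1..k}. 0 < vis w \<and> vis w \<le> vis v \<and> par w \<noteq> 0 \<longrightarrow> 0 < r (par w))"

lemma path_inv_start:
  assumes "state_inv r x \<pi> D" "search_post r x \<pi> tgt vis par" "tgt \<noteq> 0"
  shows "path_inv \<pi> vis par (x(tgt := x tgt + 1)) r tgt"
  using assms unfolding state_inv_def search_post_def path_inv_def tree_def by auto

text \<open>Positions in the queue strictly decrease along parent arcs, so the path is simple and the
  residual capacities of its remaining arcs are untouched.\<close>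

lemma path_inv_step:
  assumes tree: "tree r0 x0 \<pi> vis par" and inv: "path_inv \<pi> vis par x r v"
    and a: "a = par v" "a \<noteq> 0"
  shows "path_inv \<pi> vis par x (r(a := r a - 1, rv a := r (rv a) + 1)) (src a)"
    and "vis (src a) < vis v" and "a \<in> {1..M}" and "rv a \<noteq> a"
proof -
  have v: "v \<in> {1..k}" "0 < vis v" using inv by (auto simp: path_inv_def)
  have p: "a \<in> {1..M}" "dst a = v" "rc \<pi> a = 0" "0 < vis (src a)" "vis (src a) < vis v"
    using treeD(2)[OF tree v] a by auto
  show "a \<in> {1..M}" "vis (src a) < vis v" by fact+
  have ne: "src a \<noteq> dst a" using p by auto
  show "rv a \<noteq> a" using ne src_rv[OF p(1)] by metis
  have "0 < r a" using inv v a unfolding path_inv_def by auto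
  let ?r = "r(a := r a - 1, rv a := r (rv a) + 1)"
  note push = push_unit[of r \<pi> a ?r, OF _ _ p(1) \<open>0 < r a\<close> p(3) ne refl]
  have "0 < ?r (par w)" if w: "w \<in> {1..k}" "0 < vis w" "vis w \<le> vis (src a)" "par w \<noteq> 0" for w
  proof -
    have q: "dst (par w) = w" "vis (src (par w)) < vis w"
      using treeD(2)[OF tree w(1,2,4)] by auto
    have "par w \<noteq> a" using q p w(3) by auto
    moreover have "par w \<noteq> rv a" using q p w(3) src_rv[OF p(1)] by auto
    moreover have "0 < r (par w)" using inv w p(5) unfolding path_inv_def by auto
    ultimately show ?thesis by simp
  qed
  thus "path_inv \<pi> vis par x ?r (src a)"
    using inv push p src_range[OF p(1)] ne unfolding path_inv_def by auto
qed

text \<open>The root had positive and the target negative excess, so they are different nodes and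
  each moves one step towards 0. No node acquires a new sign, hence the conditions on
  \<open>\<pi>\<close> remain valid without touching it.\<close>

lemma path_inv_finish:
  assumes inv: "state_inv r0 x \<pi> D" and post: "search_post r0 x \<pi> tgt vis par" "tgt \<noteq> 0"
    and p: "path_inv \<pi> vis par (x(tgt := x tgt + 1)) r v" and v: "par v = 0"
    and x': "x' = (x(tgt := x tgt + 1))(v := (x(tgt := x tgt + 1)) v - 1)"
  shows "state_inv r x' \<pi> D" and "total_excess x' = total_excess x - 1"
proof -
  have vV: "v \<in> {1..k}" and "0 < vis v" using p by (auto simp: path_inv_def)
  hence xv: "0 < x v" using treeD(1)[OF search_postD(3)[OF post(1)]] v by blast
  moreover have t: "tgt \<in> {1..k}" "x tgt < 0" using search_postD(6)[OF post] by auto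
  ultimately have x'': "x' w = x w + (if w = tgt then 1 else 0) - (if w = v then 1 else 0)"
    and max: "max 0 (x' w) = max 0 (x w) - (if w = v then 1 else 0)" for w
    by (auto simp: x')
  show "total_excess x' = total_excess x - 1"
    using vV by (simp add: total_excess_def max sum_subtractf)
  have "x' w = excess r w" if "w \<in> {1..k}" for w
    using p that unfolding path_inv_def by (auto simp: x' split: if_splits)
  moreover have "0 < x w" if "0 < x' w" for w
    using that t(2) x''[of w] by (auto split: if_splits)
  moreover have "x w < 0" if "x' w < 0" for w
    using that xv x''[of w] by (auto split: if_splits)
  moreover have "residual r" "rc_nonneg r \<pi>" using p by (auto simp: path_inv_def)
  ultimately show "state_inv r x' \<pi> D"
    using inv unfolding state_inv_def by blast
qed

definition graph :: "state \<Rightarrow> bool" where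
  "graph s \<longleftrightarrow> scal s ''k'' = k \<and>
     (\<forall>a\<in>{1..M}. arr s ''tail'' a = src a \<and> arr s ''head'' a = dst a \<and>
                 arr s ''cost'' a = cs a \<and> arr s ''rev'' a = rv a) \<and>
     linked src M (arr s ''first'') (arr s ''next'')"

lemma graph_frame:
  assumes "frame c s s'" "graph s" "''k'' \<notin> svars c"
    "avars c \<inter> {''tail'', ''head'', ''cost'', ''rev'', ''first'', ''next''} = {}"
  shows "graph s'"
  using assms unfolding frame_def graph_def by auto

end

section \<open>The primal-dual algorithm\<close>

abbreviation incr :: "string \<Rightarrow> com" where
  "incr x \<equiv> Assign x (Plus (Var x) (Const 1))"

abbreviation incr_at :: "string \<Rightarrow> aexp \<Rightarrow> com" where
  "incr_at a e \<equiv> Write a e (Plus (Read a e) (Const 1))"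

abbreviation decr_at :: "string \<Rightarrow> aexp \<Rightarrow> com" where
  "decr_at a e \<equiv> Write a e (Minus (Read a e) (Const 1))"

definition enqueue :: "string \<Rightarrow> aexp \<Rightarrow> com" where
  "enqueue x e = incr ''qt'' ;; Write ''vis'' (Var x) (Var ''qt'') ;;
     Write ''queue'' (Var ''qt'') (Var x) ;; Write ''par'' (Var x) e"

definition init_body :: com where
  "init_body = incr ''v'' ;;
     If (Less (Const 0) (Read ''exc'' (Var ''v''))) (enqueue ''v'' (Const 0))
        (Write ''vis'' (Var ''v'') (Const 0))"

definition init_queue :: com where
  "init_queue = Assign ''v'' (Const 0) ;; Assign ''qt'' (Const 0) ;;
     While (Less (Var ''v'') (Var ''k'')) init_body"

text \<open>Reduced costs of residual arcs and the entries of \<open>vis\<close> are nonnegative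
  integers, so the comparison with 1 tests for 0.\<close>

definition scan_arc :: com where
  "scan_arc = Assign ''w'' (Read ''head'' (Var ''a'')) ;;
     If (And (Less (Const 0) (Read ''res'' (Var ''a'')))
        (And (Less (Read ''vis'' (Var ''w'')) (Const 1))
             (Less (Minus (Plus (Read ''cost'' (Var ''a'')) (Read ''pi'' (Var ''u'')))
                          (Read ''pi'' (Var ''w''))) (Const 1))))
       (enqueue ''w'' (Var ''a'')) Skip ;;
     Assign ''a'' (Read ''next'' (Var ''a''))"

definition dequeue :: com where
  "dequeue = incr ''qh'' ;; Assign ''u'' (Read ''queue'' (Var ''qh'')) ;;
     Assign ''a'' (Read ''first'' (Var ''u'')) ;;
     If (Less (Read ''exc'' (Var ''u'')) (Const 0)) (Assign ''tgt'' (Var ''u'')) Skip"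

text \<open>One flat loop that either scans an arc or dequeues a node. Its total work is then
  governed by one potential, where nested loops would need a bound for each node.\<close>

definition search :: com where
  "search = Assign ''qh'' (Const 0) ;; Assign ''a'' (Const 0) ;; Assign ''tgt'' (Const 0) ;;
     While (Not (And (Not (Less (Const 0) (Var ''a''))) (Not (Less (Var ''qh'') (Var ''qt'')))))
       (If (Less (Const 0) (Var ''a'')) scan_arc dequeue)"

definition augment :: com where
  "augment = Assign ''v'' (Var ''tgt'') ;; incr_at ''exc'' (Var ''v'') ;;
     While (Less (Const 0) (Read ''par'' (Var ''v'')))
       (Assign ''a'' (Read ''par'' (Var ''v'')) ;; decr_at ''res'' (Var ''a'') ;;
        incr_at ''res'' (Read ''rev'' (Var ''a'')) ;; Assign ''v'' (Read ''tail'' (Var ''a''))) ;;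
     decr_at ''exc'' (Var ''v'') ;; Assign ''E'' (Minus (Var ''E'') (Const 1))"

definition raise :: com where
  "raise = Assign ''v'' (Const 0) ;;
     While (Less (Var ''v'') (Var ''k''))
       (incr ''v'' ;; If (Less (Read ''vis'' (Var ''v'')) (Const 1)) (incr_at ''pi'' (Var ''v'')) Skip) ;;
     incr ''D''"

definition improve :: com where
  "improve = init_queue ;; search ;; If (Less (Const 0) (Var ''tgt'')) augment raise"

definition solve :: com where
  "solve = While (Less (Const 0) (Var ''E'')) improve"

section \<open>Invariants and step counts of the subroutines\<close>

context residual_network
begin

lemma wp_init_queue:
  assumes g: "graph s"
  shows "wp init_queue s (\<lambda>t s'. t \<le> 8 * nat k + 3 \<and>
     queue {1..k} (scal s' ''qt'') (arr s' ''vis'') (arr s' ''queue'') \<and>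
     (\<forall>v\<in>{1..k}. (0 < arr s ''exc'' v \<longleftrightarrow> 0 < arr s' ''vis'' v) \<and>
                 (0 < arr s' ''vis'' v \<longrightarrow> arr s' ''par'' v = 0)))"
proof -
  have k: "scal s ''k'' = k" using g by (simp add: graph_def)
  \<comment> \<open>The queue is described on the nodes up to \<open>v\<close> only;
    \<open>vis\<close> entries beyond \<open>v\<close> may stem from the previous search.\<close>
  define I :: "state \<Rightarrow> bool" where "I = (\<lambda>s'. 0 \<le> scal s' ''v'' \<and> scal s' ''v'' \<le> k \<and>
     queue {1..scal s' ''v''} (scal s' ''qt'') (arr s' ''vis'') (arr s' ''queue'') \<and>
     (\<forall>v\<in>{1..scal s' ''v''}. (0 < arr s ''exc'' v \<longleftrightarrow> 0 < arr s' ''vis'' v) \<and>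
                 (0 < arr s' ''vis'' v \<longrightarrow> arr s' ''par'' v = 0)))"
  let ?W = "While (Less (Var ''v'') (Var ''k'')) init_body"
  let ?s0 = "s\<lparr>scal := (scal s)(''v'' := 0, ''qt'' := 0)\<rparr>"
  have "wp ?W ?s0 (\<lambda>t s'. t + 2 \<le> 8 * nat k + 3 \<and>
     queue {1..k} (scal s' ''qt'') (arr s' ''vis'') (arr s' ''queue'') \<and>
     (\<forall>v\<in>{1..k}. (0 < arr s ''exc'' v \<longleftrightarrow> 0 < arr s' ''vis'' v) \<and>
                 (0 < arr s' ''vis'' v \<longrightarrow> arr s' ''par'' v = 0)))"
  proof (rule wp_while[where I = I and \<Phi> = "\<lambda>s'. 8 * nat (k - scal s' ''v'')"])
    show "I ?s0" using k_nonneg by (simp add: I_def queue_def)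
  next
    fix s' assume I: "I s'" and fr: "frame ?W ?s0 s'"
      and b: "bval (Less (Var ''v'') (Var ''k'')) s'"
    have fr': "scal s' ''k'' = k" "arr s' ''exc'' = arr s ''exc''"
      using frame_scal[OF fr, of "''k''"] frame_arr[OF fr, of "''exc''"] k
      by (simp_all add: init_body_def enqueue_def)
    define v where "v = scal s' ''v''"
    have v: "0 \<le> v" "v < k" using I b fr' by (auto simp: I_def v_def)
    have ins: "{1..v + 1} = insert (v + 1) {1..v}" using v by auto
    have q: "queue {1..v} (scal s' ''qt'') (arr s' ''vis'') (arr s' ''queue'')"
      using I by (simp add: I_def v_def)
    note qs = queue_push[OF q, of "v + 1"] queue_skip[OF q, of "v + 1"]
    have n: "0 \<le> scal s' ''qt''" using q by (simp add: queue_def)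
    have old: "\<forall>w\<in>{1..v}. (0 < arr s ''exc'' w \<longleftrightarrow> 0 < arr s' ''vis'' w) \<and>
                 (0 < arr s' ''vis'' w \<longrightarrow> arr s' ''par'' w = 0)"
      using I by (simp add: I_def v_def)
    show "wp init_body s' (\<lambda>t s''. I s'' \<and>
        8 * nat (k - scal s'' ''v'') + t < 8 * nat (k - scal s' ''v''))"
      using v n old qs
      by (auto simp: init_body_def enqueue_def fr' I_def ins simp flip: v_def)
  next
    fix s' t assume I: "I s'" and fr: "frame ?W ?s0 s'"
      and b: "\<not> bval (Less (Var ''v'') (Var ''k'')) s'"
      and t: "t + 8 * nat (k - scal s' ''v'') \<le> 8 * nat (k - scal ?s0 ''v'') + 1"
    have "scal s' ''k'' = k"
      using frame_scal[OF fr, of "''k''"] k by (simp add: init_body_def enqueue_def)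
    hence v: "scal s' ''v'' = k" using I b by (simp add: I_def)
    show "t + 2 \<le> 8 * nat k + 3 \<and>
     queue {1..k} (scal s' ''qt'') (arr s' ''vis'') (arr s' ''queue'') \<and>
     (\<forall>v\<in>{1..k}. (0 < arr s ''exc'' v \<longleftrightarrow> 0 < arr s' ''vis'' v) \<and>
                 (0 < arr s' ''vis'' v \<longrightarrow> arr s' ''par'' v = 0))"
      using I t by (simp add: I_def v)
  qed
  thus ?thesis
    by (simp add: init_queue_def)
qed

lemma wp_search:
  assumes g: "graph s" and inv: "state_inv (arr s ''res'') (arr s ''exc'') (arr s ''pi'') D"
    and q: "queue {1..k} (scal s ''qt'') (arr s ''vis'') (arr s ''queue'')"
    and start: "\<And>v. v \<in> {1..k} \<Longrightarrow> (0 < arr s ''exc'' v \<longleftrightarrow> 0 < arr s ''vis'' v) \<and>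
                 (0 < arr s ''vis'' v \<longrightarrow> arr s ''par'' v = 0)"
  shows "wp search s (\<lambda>t s'. t \<le> 10 * (nat k + nat M) + 4 \<and> 0 \<le> scal s' ''tgt'' \<and>
     search_post (arr s ''res'') (arr s ''exc'') (arr s ''pi'')
       (scal s' ''tgt'') (arr s' ''vis'') (arr s' ''par''))"
proof -
  let ?r = "arr s ''res''" and ?x = "arr s ''exc''" and ?\<pi> = "arr s ''pi''"
  let ?b = "Not (And (Not (Less (Const 0) (Var ''a''))) (Not (Less (Var ''qh'') (Var ''qt''))))"
  let ?W = "While ?b (If (Less (Const 0) (Var ''a'')) scan_arc dequeue)"
  let ?s0 = "s\<lparr>scal := (scal s)(''qh'' := 0, ''a'' := 0, ''tgt'' := 0)\<rparr>"
  define I :: "state \<Rightarrow> bool" where "I = (\<lambda>s'. search_inv ?r ?x ?\<pi> (scal s' ''qh'') (scal s' ''qt'') (scal s' ''a'')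
     (scal s' ''u'') (scal s' ''tgt'') (arr s' ''vis'') (arr s' ''queue'') (arr s' ''par''))"
  \<comment> \<open>Dequeuing is paid for by \<open>k - qh\<close> and scanning by the pending arcs.
    The weight 10 exceeds the cost of either branch including the loop test.\<close>
  define \<Phi> :: "state \<Rightarrow> nat" where "\<Phi> = (\<lambda>s'. 10 * (nat (k - scal s' ''qh'') +
     card (pending (scal s' ''qh'') (scal s' ''a'') (scal s' ''u'') (arr s' ''vis''))))"
  have "wp ?W ?s0 (\<lambda>t s'. t + 3 \<le> 10 * (nat k + nat M) + 4 \<and> 0 \<le> scal s' ''tgt'' \<and>
     search_post ?r ?x ?\<pi> (scal s' ''tgt'') (arr s' ''vis'') (arr s' ''par''))"
  proof (rule wp_while[where I = I and \<Phi> = \<Phi>])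
    have "tree ?r ?x ?\<pi> (arr s ''vis'') (arr s ''par'')"
      using start by (simp add: tree_def)
    moreover have "0 \<le> scal s ''qt''" using q by (simp add: queue_def)
    ultimately show "I ?s0"
      using q start M_nonneg by (auto simp: I_def search_inv_def)
  next
    fix s' assume I: "I s'" and fr: "frame ?W ?s0 s'" and b: "bval ?b s'"
    have "graph ?s0" using g by (simp add: graph_def)
    hence g': "graph s'"
      using graph_frame[OF fr] by (simp add: scan_arc_def dequeue_def enqueue_def)
    have l: "linked src M (arr s' ''first'') (arr s' ''next'')" using g' by (simp add: graph_def)
    have fr': "arr s' ''res'' = ?r" "arr s' ''exc'' = ?x" "arr s' ''pi'' = ?\<pi>"
      using frame_arr[OF fr, of "''res''"] frame_arr[OF fr, of "''exc''"]
        frame_arr[OF fr, of "''pi''"]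
      by (simp_all add: scan_arc_def dequeue_def enqueue_def)
    note inv' = I[unfolded I_def]
    show "wp (If (Less (Const 0) (Var ''a'')) scan_arc dequeue) s'
            (\<lambda>t s''. I s'' \<and> \<Phi> s'' + t < \<Phi> s')"
    proof (cases "0 < scal s' ''a''")
      case True
      define a where "a = scal s' ''a''"
      have a: "0 < a" "a \<in> {1..M}" "src a = scal s' ''u''"
        using True inv' by (auto simp: a_def search_inv_def)
      have heads: "arr s' ''head'' a = dst a" "arr s' ''cost'' a = cs a"
        using g' a by (auto simp: graph_def)
      have rc_nonneg: "0 < ?r a \<Longrightarrow> 0 \<le> rc ?\<pi> a"
        using inv a by (auto simp: state_inv_def rc_nonneg_def)
      have vis0: "0 \<le> arr s' ''vis'' (dst a)"
        using inv' dst_range[OF a(2)] unfolding search_inv_def queue_def by auto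
      have rc: "rc ?\<pi> a = cs a + ?\<pi> (scal s' ''u'') - ?\<pi> (dst a)"
        by (simp add: rc_def a)
      show ?thesis
      proof (cases "0 < ?r a \<and> arr s' ''vis'' (dst a) < 1 \<and> rc ?\<pi> a < 1")
        case T: True
        hence c: "0 < ?r a" "rc ?\<pi> a = 0" "arr s' ''vis'' (dst a) = 0"
          using rc_nonneg vis0 by auto
        have c': "cs a + ?\<pi> (scal s' ''u'') - ?\<pi> (dst a) < 1" using T rc by simp
        define vis where "vis = (arr s' ''vis'')(dst a := scal s' ''qt'' + 1)"
        note push = search_inv_push[OF inv'[folded a_def] a(1) c vis_def]
        \<comment> \<open>Once enqueued, the head is visited, so the arc can be passed just like one
          that leads nowhere new.\<close>
        have "0 < vis (dst a)"
          using inv' by (auto simp: vis_def search_inv_def)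
        hence "\<not> (0 < ?r a \<and> rc ?\<pi> a = 0) \<or> 0 < vis (dst a)" ..
        note adv = search_inv_advance[OF push(1) a(1) l this]
        show ?thesis
          using True T c' adv push(2)
          by (simp add: scan_arc_def enqueue_def I_def \<Phi>_def heads fr' flip: a_def vis_def)
      next
        case F: False
        hence "\<not> (0 < ?r a \<and> rc ?\<pi> a = 0) \<or> 0 < arr s' ''vis'' (dst a)" by auto
        note adv = search_inv_advance[OF inv'[folded a_def] a(1) l this]
        show ?thesis
          using True F[unfolded rc] adv
          by (auto simp: scan_arc_def I_def \<Phi>_def heads fr' simp flip: a_def)
      qed
    next
      case False
      hence a: "scal s' ''a'' = 0" and lt: "scal s' ''qh'' < scal s' ''qt''"
        using b inv' by (auto simp: search_inv_def)
      note pop = search_inv_pop[OF inv'[unfolded a] lt l refl refl]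
      have "nat (k - (scal s' ''qh'' + 1)) < nat (k - scal s' ''qh'')"
        using pop(2) by simp
      then show ?thesis
        using pop(1,3) a
        by (cases "?x (arr s' ''queue'' (scal s' ''qh'' + 1)) < 0")
           (simp_all add: dequeue_def I_def \<Phi>_def fr')
    qed
  next
    fix s' t assume I: "I s'" and b: "\<not> bval ?b s'" and t: "t + \<Phi> s' \<le> \<Phi> ?s0 + 1"
    have "\<Phi> ?s0 \<le> 10 * (nat k + nat M)"
      using card_pending_le by (simp add: \<Phi>_def)
    moreover have "0 \<le> scal s' ''tgt''"
      using I by (auto simp: I_def search_inv_def split: if_splits)
    ultimately show "t + 3 \<le> 10 * (nat k + nat M) + 4 \<and> 0 \<le> scal s' ''tgt'' \<and>
       search_post ?r ?x ?\<pi> (scal s' ''tgt'') (arr s' ''vis'') (arr s' ''par'')"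
      using t b search_inv_exit[OF I[unfolded I_def]] by auto
  qed
  thus ?thesis
    by (simp add: search_def)
qed

lemma wp_augment:
  assumes g: "graph s" and inv: "state_inv (arr s ''res'') (arr s ''exc'') (arr s ''pi'') D"
    and post: "search_post (arr s ''res'') (arr s ''exc'') (arr s ''pi'')
       (scal s ''tgt'') (arr s ''vis'') (arr s ''par'')" "scal s ''tgt'' \<noteq> 0"
  shows "wp augment s (\<lambda>t s'. t \<le> 6 * nat k + 5 \<and>
     state_inv (arr s' ''res'') (arr s' ''exc'') (arr s ''pi'') D \<and>
     total_excess (arr s' ''exc'') = total_excess (arr s ''exc'') - 1 \<and>
     scal s' ''E'' = scal s ''E'' - 1)"
proof -
  let ?r = "arr s ''res''" and ?x = "arr s ''exc''" and ?\<pi> = "arr s ''pi''"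
    and ?tgt = "scal s ''tgt''" and ?vis = "arr s ''vis''" and ?par = "arr s ''par''"
  let ?b = "Less (Const 0) (Read ''par'' (Var ''v''))"
  let ?c = "Assign ''a'' (Read ''par'' (Var ''v'')) ;; decr_at ''res'' (Var ''a'') ;;
        incr_at ''res'' (Read ''rev'' (Var ''a'')) ;; Assign ''v'' (Read ''tail'' (Var ''a''))"
  define x1 where "x1 = ?x(?tgt := ?x ?tgt + 1)"
  let ?s0 = "s\<lparr>scal := (scal s)(''v'' := ?tgt), arr := (arr s)(''exc'' := x1)\<rparr>"
  let ?fin = "decr_at ''exc'' (Var ''v'') ;; Assign ''E'' (Minus (Var ''E'') (Const 1))"
  define I :: "state \<Rightarrow> bool" where
    "I = (\<lambda>s'. path_inv ?\<pi> ?vis ?par x1 (arr s' ''res'') (scal s' ''v''))"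
  have tree: "tree ?r ?x ?\<pi> ?vis ?par" using search_postD(3)[OF post(1)] .
  have "wp (While ?b ?c) ?s0 (\<lambda>t s'. t \<le> 6 * nat k + 1 \<and> I s' \<and> ?par (scal s' ''v'') = 0)"
  \<comment> \<open>The queue position of the current node decreases along parent arcs and starts at
    most at \<open>k\<close>.\<close>
  proof (rule wp_while[where I = I and \<Phi> = "\<lambda>s'. 6 * nat (?vis (scal s' ''v''))"])
    show "I ?s0" using path_inv_start[OF inv post] by (simp add: I_def x1_def)
  next
    fix s' assume I: "I s'" and fr: "frame (While ?b ?c) ?s0 s'" and b: "bval ?b s'"
    have "graph ?s0" using g by (simp add: graph_def)
    hence g': "graph s'" using graph_frame[OF fr] by simp
    have par: "arr s' ''par'' = ?par" using frame_arr[OF fr, of "''par''"] by simp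
    define a where "a = ?par (scal s' ''v'')"
    have a: "a \<noteq> 0" using b by (simp add: a_def par)
    note step = path_inv_step[OF tree I[unfolded I_def] a_def a]
    have rv: "arr s' ''rev'' a = rv a" "arr s' ''tail'' a = src a"
      using g' step(3) by (auto simp: graph_def)
    have "0 < ?vis (src a)" using step(1) by (simp add: path_inv_def)
    thus "wp ?c s' (\<lambda>t s''. I s'' \<and>
        6 * nat (?vis (scal s'' ''v'')) + t < 6 * nat (?vis (scal s' ''v'')))"
      using step by (simp add: par rv I_def flip: a_def)
  next
    fix s' t assume I: "I s'" and fr: "frame (While ?b ?c) ?s0 s'" and b: "\<not> bval ?b s'"
      and t: "t + 6 * nat (?vis (scal s' ''v'')) \<le> 6 * nat (?vis (scal ?s0 ''v'')) + 1"
    have par: "arr s' ''par'' = ?par" using frame_arr[OF fr, of "''par''"] by simp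
    have v: "scal s' ''v'' \<in> {1..k}" "0 < ?vis (scal s' ''v'')"
      using I by (auto simp: I_def path_inv_def)
    have "?par (scal s' ''v'') = 0"
      using treeD(2)[OF tree v] b by (auto simp: par)
    moreover have "?vis ?tgt \<le> k"
      using search_postD(1)[OF post(1)] search_postD(6)[OF post] by blast
    ultimately show "t \<le> 6 * nat k + 1 \<and> I s' \<and> ?par (scal s' ''v'') = 0"
      using I t by auto
  qed
  hence "wp (While ?b ?c) ?s0 (\<lambda>t s'. wp ?fin s' (\<lambda>t' s''. t + t' + 2 \<le> 6 * nat k + 5 \<and>
     state_inv (arr s'' ''res'') (arr s'' ''exc'') ?\<pi> D \<and>
     total_excess (arr s'' ''exc'') = total_excess ?x - 1 \<and> scal s'' ''E'' = scal s ''E'' - 1))"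
  proof (rule wp_conseq)
    fix t s' assume I: "t \<le> 6 * nat k + 1 \<and> I s' \<and> ?par (scal s' ''v'') = 0"
      and fr: "frame (While ?b ?c) ?s0 s'"
    have exc: "arr s' ''exc'' = x1" and E: "scal s' ''E'' = scal s ''E''"
      using frame_arr[OF fr, of "''exc''"] frame_scal[OF fr, of "''E''"] by simp_all
    have p: "path_inv ?\<pi> ?vis ?par x1 (arr s' ''res'') (scal s' ''v'')"
      "?par (scal s' ''v'') = 0"
      using I by (auto simp: I_def)
    define x where "x = x1(scal s' ''v'' := x1 (scal s' ''v'') - 1)"
    note finish = path_inv_finish[OF inv post p[unfolded x1_def] x_def[unfolded x1_def]]
    show "wp ?fin s' (\<lambda>t' s''. t + t' + 2 \<le> 6 * nat k + 5 \<and>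
       state_inv (arr s'' ''res'') (arr s'' ''exc'') ?\<pi> D \<and>
       total_excess (arr s'' ''exc'') = total_excess ?x - 1 \<and> scal s'' ''E'' = scal s ''E'' - 1)"
      using I finish by (simp add: exc E flip: x_def)
  qed
  thus ?thesis by (simp add: augment_def x1_def)
qed

lemma wp_raise:
  assumes g: "graph s"
    and inv: "state_inv (arr s ''res'') (arr s ''exc'') (arr s ''pi'') (scal s ''D'')"
    and post: "search_post (arr s ''res'') (arr s ''exc'') (arr s ''pi'') 0 (arr s ''vis'') par"
  shows "wp raise s (\<lambda>t s'. t \<le> 4 * nat k + 3 \<and>
     state_inv (arr s ''res'') (arr s ''exc'') (arr s' ''pi'') (scal s' ''D'') \<and>
     scal s' ''D'' = scal s ''D'' + 1)"
proof -
  let ?\<pi> = "arr s ''pi''" and ?vis = "arr s ''vis''"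
  let ?b = "Less (Var ''v'') (Var ''k'')"
  let ?c = "incr ''v'' ;;
    If (Less (Read ''vis'' (Var ''v'')) (Const 1)) (incr_at ''pi'' (Var ''v'')) Skip"
  let ?s0 = "s\<lparr>scal := (scal s)(''v'' := 0)\<rparr>"
  have k: "scal s ''k'' = k" using g by (simp add: graph_def)
  define I :: "state \<Rightarrow> bool" where
    "I = (\<lambda>s'. 0 \<le> scal s' ''v'' \<and> scal s' ''v'' \<le> k \<and>
       (\<forall>v\<in>{1..k}. arr s' ''pi'' v = ?\<pi> v + (if ?vis v = 0 \<and> v \<le> scal s' ''v'' then 1 else 0)))"
  have "wp (While ?b ?c) ?s0 (\<lambda>t s'. t + 2 \<le> 4 * nat k + 3 \<and> scal s' ''D'' = scal s ''D'' \<and>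
      (\<forall>v\<in>{1..k}. arr s' ''pi'' v = ?\<pi> v + (if ?vis v = 0 then 1 else 0)))"
  proof (rule wp_while[where I = I and \<Phi> = "\<lambda>s'. 4 * nat (k - scal s' ''v'')"])
    show "I ?s0" using k_nonneg by (simp add: I_def)
  next
    fix s' assume I: "I s'" and fr: "frame (While ?b ?c) ?s0 s'" and b: "bval ?b s'"
    have fr': "scal s' ''k'' = k" "arr s' ''vis'' = ?vis"
      using frame_scal[OF fr, of "''k''"] frame_arr[OF fr, of "''vis''"] k by simp_all
    define v where "v = scal s' ''v''"
    have v: "0 \<le> v" "v < k" using I b fr' by (auto simp: I_def v_def)
    have "0 \<le> ?vis (v + 1)" using search_postD(1)[OF post, of "v + 1"] v by auto
    moreover have "w \<le> v + 1 \<longleftrightarrow> w \<le> v \<or> w = v + 1" for w by auto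
    ultimately show "wp ?c s' (\<lambda>t s''. I s'' \<and>
        4 * nat (k - scal s'' ''v'') + t < 4 * nat (k - scal s' ''v''))"
      using v I by (auto simp: I_def fr' simp flip: v_def)
  next
    fix s' t assume I: "I s'" and fr: "frame (While ?b ?c) ?s0 s'" and b: "\<not> bval ?b s'"
      and t: "t + 4 * nat (k - scal s' ''v'') \<le> 4 * nat (k - scal ?s0 ''v'') + 1"
    have "scal s' ''k'' = k" and D: "scal s' ''D'' = scal s ''D''"
      using frame_scal[OF fr, of "''k''"] frame_scal[OF fr, of "''D''"] k by simp_all
    hence "scal s' ''v'' = k" using I b by (simp add: I_def)
    thus "t + 2 \<le> 4 * nat k + 3 \<and> scal s' ''D'' = scal s ''D'' \<and>
        (\<forall>v\<in>{1..k}. arr s' ''pi'' v = ?\<pi> v + (if ?vis v = 0 then 1 else 0))"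
      using I t D by (simp add: I_def)
  qed
  hence "wp (While ?b ?c) ?s0 (\<lambda>t s'. t + 2 \<le> 4 * nat k + 3 \<and>
      state_inv (arr s ''res'') (arr s ''exc'') (arr s' ''pi'') (scal s' ''D'' + 1) \<and>
      scal s' ''D'' + 1 = scal s ''D'' + 1)"
    by (rule wp_conseq) (auto intro!: state_inv_raise[OF inv post])
  thus ?thesis
    by (simp add: raise_def)
qed

section \<open>The outer loop\<close>

definition solve_inv :: "state \<Rightarrow> bool" where
  "solve_inv s \<longleftrightarrow> graph s \<and>
     state_inv (arr s ''res'') (arr s ''exc'') (arr s ''pi'') (scal s ''D'') \<and>
     scal s ''E'' = total_excess (arr s ''exc'')"

text \<open>The coefficient is 24 = 8 + 10 + 6, from initialising the queue, searching and
  augmenting; a raise costs less than an augmentation. The constant is 13 = 3 + 4 + 1 + 5, with 1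
  for the test on \<open>tgt\<close>.\<close>

lemma wp_improve:
  assumes "solve_inv s"
  shows "wp improve s (\<lambda>t s'. t \<le> 24 * (nat k + nat M) + 13 \<and> solve_inv s' \<and>
     (scal s' ''D'' = scal s ''D'' \<and> scal s' ''E'' = scal s ''E'' - 1 \<or>
      scal s' ''D'' = scal s ''D'' + 1 \<and> scal s' ''E'' = scal s ''E''))"
proof -
  let ?r = "arr s ''res''" and ?x = "arr s ''exc''" and ?\<pi> = "arr s ''pi''"
  let ?D = "scal s ''D''" and ?E = "scal s ''E''"
  \<comment> \<open>What initialisation and search preserve. Their only effect that matters later is
    the search forest and the target.\<close>
  define same where "same s' \<longleftrightarrow> graph s' \<and> arr s' ''res'' = ?r \<and> arr s' ''exc'' = ?x \<and>
    arr s' ''pi'' = ?\<pi> \<and> scal s' ''D'' = ?D \<and> scal s' ''E'' = ?E" for s'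
  have g: "graph s" and inv: "state_inv ?r ?x ?\<pi> ?D" and E: "?E = total_excess ?x"
    using assms by (auto simp: solve_inv_def)
  define Q where "Q t s' \<longleftrightarrow> t \<le> 24 * (nat k + nat M) + 13 \<and> solve_inv s' \<and>
     (scal s' ''D'' = ?D \<and> scal s' ''E'' = ?E - 1 \<or>
      scal s' ''D'' = ?D + 1 \<and> scal s' ''E'' = ?E)" for t :: nat and s'
  have fin: "wp (If (Less (Const 0) (Var ''tgt'')) augment raise) s2
      (\<lambda>t. Q (t1 + (t2 + t)))"
    if s: "same s2" and tgt: "0 \<le> scal s2 ''tgt''"
      and post: "search_post ?r ?x ?\<pi> (scal s2 ''tgt'') (arr s2 ''vis'') (arr s2 ''par'')"
      and t: "t1 \<le> 8 * nat k + 3" "t2 \<le> 10 * (nat k + nat M) + 4" for s2 t1 t2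
  proof (cases "0 < scal s2 ''tgt''")
    case True
    have "wp augment s2 (\<lambda>t s'. t \<le> 6 * nat k + 5 \<and>
       state_inv (arr s' ''res'') (arr s' ''exc'') (arr s2 ''pi'') ?D \<and>
       total_excess (arr s' ''exc'') = total_excess (arr s2 ''exc'') - 1 \<and>
       scal s' ''E'' = scal s2 ''E'' - 1)"
      using True s inv post by (intro wp_augment) (auto simp: same_def)
    hence "wp augment s2 (\<lambda>t. Q (t1 + (t2 + Suc t)))"
    proof (rule wp_conseq)
      fix t s' assume *: "t \<le> 6 * nat k + 5 \<and>
       state_inv (arr s' ''res'') (arr s' ''exc'') (arr s2 ''pi'') ?D \<and>
       total_excess (arr s' ''exc'') = total_excess (arr s2 ''exc'') - 1 \<and>
       scal s' ''E'' = scal s2 ''E'' - 1" and fr: "frame augment s2 s'"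
      have "graph s'" using graph_frame[OF fr] s by (simp add: augment_def same_def)
      moreover have "arr s' ''pi'' = ?\<pi>" "scal s' ''D'' = ?D"
        using frame_arr[OF fr, of "''pi''"] frame_scal[OF fr, of "''D''"] s
        by (simp_all add: augment_def same_def)
      ultimately show "Q (t1 + (t2 + Suc t)) s'"
        using * s t E by (simp add: Q_def solve_inv_def same_def)
    qed
    thus ?thesis using True by simp
  next
    case False
    hence "scal s2 ''tgt'' = 0" using tgt by simp
    hence "wp raise s2 (\<lambda>t s'. t \<le> 4 * nat k + 3 \<and>
       state_inv (arr s2 ''res'') (arr s2 ''exc'') (arr s' ''pi'') (scal s' ''D'') \<and>
       scal s' ''D'' = scal s2 ''D'' + 1)"
      using s inv post by (intro wp_raise) (auto simp: same_def)
    hence "wp raise s2 (\<lambda>t. Q (t1 + (t2 + Suc t)))"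
    proof (rule wp_conseq)
      fix t s' assume *: "t \<le> 4 * nat k + 3 \<and>
       state_inv (arr s2 ''res'') (arr s2 ''exc'') (arr s' ''pi'') (scal s' ''D'') \<and>
       scal s' ''D'' = scal s2 ''D'' + 1" and fr: "frame raise s2 s'"
      have "graph s'" using graph_frame[OF fr] s by (simp add: raise_def same_def)
      moreover have "arr s' ''res'' = ?r" "arr s' ''exc'' = ?x" "scal s' ''E'' = ?E"
        using frame_arr[OF fr, of "''res''"] frame_arr[OF fr, of "''exc''"]
          frame_scal[OF fr, of "''E''"] s
        by (simp_all add: raise_def same_def)
      ultimately show "Q (t1 + (t2 + Suc t)) s'"
        using * s t E by (auto simp: Q_def solve_inv_def same_def)
    qed
    thus ?thesis using False by simp
  qed
  have "wp (init_queue ;; search ;; If (Less (Const 0) (Var ''tgt'')) augment raise) s Q"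
    unfolding wp_simps(4)
  proof (rule wp_conseq[OF wp_init_queue[OF g]])
    fix t1 s1 assume 1: "t1 \<le> 8 * nat k + 3 \<and>
       queue {1..k} (scal s1 ''qt'') (arr s1 ''vis'') (arr s1 ''queue'') \<and>
       (\<forall>v\<in>{1..k}. (0 < ?x v \<longleftrightarrow> 0 < arr s1 ''vis'' v) \<and>
                   (0 < arr s1 ''vis'' v \<longrightarrow> arr s1 ''par'' v = 0))"
      and fr: "frame init_queue s s1"
    have s1: "same s1"
      using graph_frame[OF fr g] frame_arr[OF fr] frame_scal[OF fr]
      by (simp add: same_def init_queue_def init_body_def enqueue_def)
    have "wp search s1 (\<lambda>t s'. t \<le> 10 * (nat k + nat M) + 4 \<and> 0 \<le> scal s' ''tgt'' \<and>
       search_post (arr s1 ''res'') (arr s1 ''exc'') (arr s1 ''pi'')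
         (scal s' ''tgt'') (arr s' ''vis'') (arr s' ''par''))"
      using s1 1 inv by (intro wp_search) (auto simp: same_def)
    thus "wp search s1 (\<lambda>t s'. wp (If (Less (Const 0) (Var ''tgt'')) augment raise) s'
        (\<lambda>t'. Q (t1 + (t + t'))))"
    proof (rule wp_conseq)
      fix t2 s2 assume 2: "t2 \<le> 10 * (nat k + nat M) + 4 \<and> 0 \<le> scal s2 ''tgt'' \<and>
       search_post (arr s1 ''res'') (arr s1 ''exc'') (arr s1 ''pi'')
         (scal s2 ''tgt'') (arr s2 ''vis'') (arr s2 ''par'')" and fr: "frame search s1 s2"
      have "same s2"
        using graph_frame[OF fr] s1 frame_arr[OF fr] frame_scal[OF fr]
        by (simp add: same_def search_def scan_arc_def dequeue_def enqueue_def)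
      thus "wp (If (Less (Const 0) (Var ''tgt'')) augment raise) s2 (\<lambda>t'. Q (t1 + (t2 + t')))"
        using 1 2 s1 by (intro fin) (auto simp: same_def)
    qed
  qed
  thus ?thesis unfolding improve_def Q_def .
qed

lemma wp_solve:
  assumes "solve_inv s" and D: "scal s ''D'' = 0" and n: "cost_bound \<le> n" "scal s ''E'' \<le> n"
  shows "wp solve s (\<lambda>t s'. t \<le> (24 * (nat k + nat M) + 14) * (2 * nat n) + 1 \<and>
     solve_inv s' \<and> (\<forall>v\<in>{1..k}. excess (arr s' ''res'') v = 0))"
proof -
  let ?C = "24 * (nat k + nat M) + 14"
  let ?b = "Less (Const 0) (Var ''E'')"
  define I :: "state \<Rightarrow> bool" where
    "I = (\<lambda>s'. solve_inv s' \<and> 0 \<le> scal s' ''D'' \<and> 0 \<le> scal s' ''E'' \<and> scal s' ''E'' \<le> n)"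
  have E_nonneg: "0 \<le> scal s' ''E''" if "solve_inv s'" for s'
    using that by (simp add: solve_inv_def total_excess_def sum_nonneg)
  \<comment> \<open>From \<open>D * E \<le> n\<close>: one unit of remaining excess already forces
    \<open>D \<le> n\<close>.\<close>
  have D_le: "scal s' ''D'' \<le> n" if "solve_inv s'" "0 < scal s' ''E''" for s'
  proof -
    have "state_inv (arr s' ''res'') (arr s' ''exc'') (arr s' ''pi'') (scal s' ''D'')"
      and E: "scal s' ''E'' = total_excess (arr s' ''exc'')"
      using that by (auto simp: solve_inv_def)
    hence "scal s' ''D'' * scal s' ''E'' \<le> n" and "0 \<le> scal s' ''D''"
      using distance_bound n by (force, simp add: state_inv_def)
    moreover have "scal s' ''D'' * 1 \<le> scal s' ''D'' * scal s' ''E''"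
      using that calculation by (intro mult_left_mono) auto
    ultimately show ?thesis by simp
  qed
  have "wp (While ?b improve) s (\<lambda>t s'. t \<le> ?C * (2 * nat n) + 1 \<and>
     solve_inv s' \<and> (\<forall>v\<in>{1..k}. excess (arr s' ''res'') v = 0))"
  proof (rule wp_while[where I = I and
        \<Phi> = "\<lambda>s'. ?C * (nat (scal s' ''E'') + nat (n - scal s' ''D''))"])
    show "I s" using assms E_nonneg by (simp add: I_def)
  next
    fix s' assume I: "I s'" and b: "bval ?b s'"
    have inv: "solve_inv s'" and E: "0 < scal s' ''E''" using I b by (auto simp: I_def)
    show "wp improve s' (\<lambda>t s''. I s'' \<and>
        ?C * (nat (scal s'' ''E'') + nat (n - scal s'' ''D'')) + t
        < ?C * (nat (scal s' ''E'') + nat (n - scal s' ''D'')))"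
    proof (rule wp_conseq[OF wp_improve[OF inv]])
      fix t s''
      assume *: "t \<le> 24 * (nat k + nat M) + 13 \<and> solve_inv s'' \<and>
        (scal s'' ''D'' = scal s' ''D'' \<and> scal s'' ''E'' = scal s' ''E'' - 1 \<or>
         scal s'' ''D'' = scal s' ''D'' + 1 \<and> scal s'' ''E'' = scal s' ''E'')"
      let ?m = "\<lambda>s. nat (scal s ''E'') + nat (n - scal s ''D'')"
      \<comment> \<open>After a raise \<open>E\<close> is still positive, so the bound applies to
        the new \<open>D\<close>. Therefore \<open>n - D\<close> really drops by 1 and is not cut
        off at 0 by \<open>nat\<close>.\<close>
      have "?m s'' + 1 \<le> ?m s'"
        using * E D_le[of s''] by auto
      hence "?C * (?m s'' + 1) \<le> ?C * ?m s'" by (rule mult_left_mono) simp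
      thus "I s'' \<and> ?C * ?m s'' + t < ?C * ?m s'"
        using * I E_nonneg[of s''] unfolding I_def by (auto simp: algebra_simps)
    qed
  next
    fix s' t assume I: "I s'" and b: "\<not> bval ?b s'"
      and t: "t + ?C * (nat (scal s' ''E'') + nat (n - scal s' ''D''))
        \<le> ?C * (nat (scal s ''E'') + nat (n - scal s ''D'')) + 1"
    have inv: "state_inv (arr s' ''res'') (arr s' ''exc'') (arr s' ''pi'') (scal s' ''D'')"
      and "total_excess (arr s' ''exc'') = 0"
      using I b by (auto simp: I_def solve_inv_def)
    hence "\<forall>v\<in>{1..k}. max 0 (arr s' ''exc'' v) = 0"
      unfolding total_excess_def by (subst (asm) sum_nonneg_eq_0_iff) auto
    moreover have x: "arr s' ''exc'' v = excess (arr s' ''res'') v" if "v \<in> {1..k}" for v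
      using inv that by (simp add: state_inv_def)
    ultimately have "\<forall>v\<in>{1..k}. excess (arr s' ''res'') v \<le> 0"
      by (metis max.cobounded2)
    \<comment> \<open>No excess is positive and they sum to 0, so the deficits vanish too.\<close>
    moreover have "(\<Sum>v\<in>{1..k}. - excess (arr s' ''res'') v) = 0"
      using sum_excess inv by (simp add: state_inv_def sum_negf)
    ultimately have "\<forall>v\<in>{1..k}. excess (arr s' ''res'') v = 0"
      by (subst (asm) sum_nonneg_eq_0_iff) auto
    moreover have "nat (scal s ''E'') + nat (n - scal s ''D'') \<le> 2 * nat n"
      using n D by simp
    hence "?C * (nat (scal s ''E'') + nat (n - scal s ''D'')) \<le> ?C * (2 * nat n)"
      by (rule mult_left_mono) simp
    hence "t \<le> ?C * (2 * nat n) + 1" using t by linarith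
    ultimately show "t \<le> ?C * (2 * nat n) + 1 \<and>
        solve_inv s' \<and> (\<forall>v\<in>{1..k}. excess (arr s' ''res'') v = 0)"
      using I by (simp add: I_def)
  qed
  thus ?thesis by (simp add: solve_def)
qed

end

section \<open>The residual network of a list of cells\<close>

text \<open>The new arc has the largest number so far, so inserting it at the front keeps every list
  decreasing.\<close>

lemma linked_extend:
  assumes "linked src A first nxt" "0 \<le> A"
  shows "linked src (A + 1) (first(src (A + 1) := A + 1)) (nxt(A + 1 := first (src (A + 1))))"
proof -
  have ins: "{1..A + 1} = insert (A + 1) {1..A}" "{1..<A + 1} = {1..A}" using assms(2) by auto
  have f: "0 \<le> first v" "first v \<le> A" "0 < first v \<Longrightarrow> src (first v) = v"
    "\<And>b. b \<in> {1..A} \<Longrightarrow> src b = v \<Longrightarrow> b \<le> first v" for v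
    using assms(1) unfolding linked_def by auto
  have "first v \<le> A + 1" for v using f(2)[of v] by simp
  moreover have n: "\<forall>a\<in>{1..A}. nxt a \<in> {0..<a} \<and> (0 < nxt a \<longrightarrow> src (nxt a) = src a) \<and>
          (\<forall>b\<in>{1..<a}. src b = src a \<longrightarrow> b \<le> nxt a)"
    using assms(1) unfolding linked_def by blast
  moreover have "\<forall>a\<in>{1..A}. a \<noteq> A + 1" by auto
  moreover have "first v < A + 1" for v using f(2)[of v] by simp
  ultimately show ?thesis
    unfolding linked_def ins using f assms(2) by (auto simp: ins)
qed

lemma sum_arcs:
  fixes g :: "int \<Rightarrow> 'b::comm_monoid_add"
  shows "(\<Sum>a\<in>{1..4 * int m}. g a) =
    (\<Sum>c<m. g (4 * int c + 1) + g (4 * int c + 2) + g (4 * int c + 3) + g (4 * int c + 4))"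
proof (induction m)
  case (Suc m)
  have "{1..4 * int (Suc m)} = {1..4 * int m} \<union>
      {4 * int m + 1, 4 * int m + 2, 4 * int m + 3, 4 * int m + 4}" by auto
  moreover have "{1..4 * int m} \<inter>
      {4 * int m + 1, 4 * int m + 2, 4 * int m + 3, 4 * int m + 4} = {}" by auto
  ultimately have "(\<Sum>a\<in>{1..4 * int (Suc m)}. g a) = (\<Sum>a\<in>{1..4 * int m}. g a) +
      (\<Sum>a\<in>{4 * int m + 1, 4 * int m + 2, 4 * int m + 3, 4 * int m + 4}. g a)"
    by (simp only: sum.union_disjoint finite_atLeastAtMost_int finite_insert finite.emptyI)
  thus ?case by (simp only: Suc sum.lessThan_Suc) (simp add: add.assoc)
qed simp

lemma arc_cases:
  assumes "a \<in> {1..4 * int m}"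
  obtains c where "c < m"
    "a = 4 * int c + 1 \<or> a = 4 * int c + 2 \<or> a = 4 * int c + 3 \<or> a = 4 * int c + 4"
proof (rule that[of "nat ((a - 1) div 4)"])
  show "nat ((a - 1) div 4) < m" using assms by auto
  have "0 \<le> (a - 1) div 4" using assms by (simp add: pos_imp_zdiv_nonneg_iff)
  moreover have "a = 4 * ((a - 1) div 4) + 1 \<or> a = 4 * ((a - 1) div 4) + 2 \<or>
      a = 4 * ((a - 1) div 4) + 3 \<or> a = 4 * ((a - 1) div 4) + 4" by presburger
  ultimately show "a = 4 * int (nat ((a - 1) div 4)) + 1 \<or> a = 4 * int (nat ((a - 1) div 4)) + 2 \<or>
    a = 4 * int (nat ((a - 1) div 4)) + 3 \<or> a = 4 * int (nat ((a - 1) div 4)) + 4"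
    by simp
qed

text \<open>Tabulates a function on arc numbers by four functions on cells. Through
  \<open>arc_val_simps\<close>, claims about arcs reduce to evaluation at the four numbers of a
  cell.\<close>

definition arc_val :: "(nat \<Rightarrow> 'b) \<Rightarrow> (nat \<Rightarrow> 'b) \<Rightarrow> (nat \<Rightarrow> 'b) \<Rightarrow> (nat \<Rightarrow> 'b) \<Rightarrow> int \<Rightarrow> 'b" where
  "arc_val p q r s a = (let c = nat ((a - 1) div 4); i = (a - 1) mod 4 in
     if i = 0 then p c else if i = 1 then q c else if i = 2 then r c else s c)"

lemma arc_val_simps [simp]:
  "arc_val p q r s (4 * int c + 1) = p c"
  "arc_val p q r s (4 * int c + 2) = q c"
  "arc_val p q r s (4 * int c + 3) = r c"
  "arc_val p q r s (4 * int c + 4) = s c"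
  by (simp_all add: arc_val_def)

text \<open>The residual arcs of cell \<open>c\<close>, with \<open>i = rown c\<close> and \<open>j = coln c\<close>, are
  \<open>4c + 1 : j \<rightarrow> i\<close> (select a control sample), \<open>4c + 3 : j \<rightarrow> i\<close> (give up a treatment sample,
  at cost 1), and their reversals \<open>4c + 2\<close> and \<open>4c + 4\<close>.\<close>

locale cell_network =
  fixes m :: nat and k k1 :: int and rown coln tcap ccap :: "nat \<Rightarrow> int"
  assumes rown: "c < m \<Longrightarrow> 1 \<le> rown c \<and> rown c \<le> k1"
    and coln: "c < m \<Longrightarrow> k1 < coln c \<and> coln c \<le> k"
    and caps: "c < m \<Longrightarrow> 0 \<le> tcap c \<and> 0 \<le> ccap c"
    and k1_bounds: "0 \<le> k1" "k1 \<le> k"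
begin

definition asrc :: "int \<Rightarrow> int" where "asrc = arc_val coln rown coln rown"
definition adst :: "int \<Rightarrow> int" where "adst = arc_val rown coln rown coln"
definition acost :: "int \<Rightarrow> int" where "acost = arc_val (\<lambda>_. 0) (\<lambda>_. 0) (\<lambda>_. 1) (\<lambda>_. - 1)"
definition arev :: "int \<Rightarrow> int" where
  "arev = arc_val (\<lambda>c. 4 * int c + 2) (\<lambda>c. 4 * int c + 1) (\<lambda>c. 4 * int c + 4) (\<lambda>c. 4 * int c + 3)"

text \<open>The residual capacities when cell \<open>c\<close> carries the flow \<open>f c\<close> of treatment samples and \<open>g c\<close> of
  control samples.\<close>

definition flow_res :: "(nat \<Rightarrow> 'b) \<Rightarrow> (nat \<Rightarrow> 'b) \<Rightarrow> int \<Rightarrow> 'b::linordered_idom" where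
  "flow_res f g = arc_val (\<lambda>c. of_int (ccap c) - g c) g f (\<lambda>c. of_int (tcap c) - f c)"

abbreviation zero_res :: "int \<Rightarrow> int" where
  "zero_res \<equiv> flow_res (\<lambda>_. 0) (\<lambda>_. 0)"

lemmas arc_defs = asrc_def adst_def acost_def arev_def flow_res_def

sublocale residual_network k "4 * int m" asrc adst acost arev zero_res
proof
  fix a assume "a \<in> {1..4 * int m}"
  then obtain c where c: "c < m"
    and a: "a = 4 * int c + 1 \<or> a = 4 * int c + 2 \<or> a = 4 * int c + 3 \<or> a = 4 * int c + 4"
    by (rule arc_cases)
  have c4: "4 * int c + 4 \<le> 4 * int m" using c by simp
  note facts = rown[OF c] coln[OF c] caps[OF c] k1_bounds
  show "asrc a \<in> {1..k}" "adst a \<in> {1..k}"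
    using a facts by (auto simp: arc_defs)
  show "arev a \<in> {1..4 * int m}"
    using a c4 by (elim disjE) (simp_all add: arc_defs)
  show "arev (arev a) = a" "asrc (arev a) = adst a" "acost (arev a) = - acost a"
    using a by (elim disjE; simp add: arc_defs)+
  show "0 \<le> zero_res a"
    using a facts by (auto simp: arc_defs)
qed (use k1_bounds in auto)

section \<open>Cell flows as residual capacities\<close>

lemma residual_flow_res_iff:
  fixes f g :: "nat \<Rightarrow> 'b::linordered_idom"
  shows "residual (flow_res f g) \<longleftrightarrow>
    (\<forall>c<m. 0 \<le> f c \<and> f c \<le> of_int (tcap c) \<and> 0 \<le> g c \<and> g c \<le> of_int (ccap c))"
proof
  assume r: "residual (flow_res f g)"
  show "\<forall>c<m. 0 \<le> f c \<and> f c \<le> of_int (tcap c) \<and> 0 \<le> g c \<and> g c \<le> of_int (ccap c)"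
  proof (intro allI impI)
    fix c assume "c < m"
    hence "4 * int c + 1 \<in> {1..4 * int m}" "4 * int c + 2 \<in> {1..4 * int m}"
      "4 * int c + 3 \<in> {1..4 * int m}" "4 * int c + 4 \<in> {1..4 * int m}" by auto
    hence "0 \<le> flow_res f g (4 * int c + 1) \<and> 0 \<le> flow_res f g (4 * int c + 2) \<and>
        0 \<le> flow_res f g (4 * int c + 3) \<and> 0 \<le> flow_res f g (4 * int c + 4)"
      using r unfolding residual_def by blast
    thus "0 \<le> f c \<and> f c \<le> of_int (tcap c) \<and> 0 \<le> g c \<and> g c \<le> of_int (ccap c)"
      by (simp add: flow_res_def)
  qed
next
  assume fg: "\<forall>c<m. 0 \<le> f c \<and> f c \<le> of_int (tcap c) \<and> 0 \<le> g c \<and> g c \<le> of_int (ccap c)"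
  show "residual (flow_res f g)"
    unfolding residual_def
  proof
    fix a assume "a \<in> {1..4 * int m}"
    then obtain c where c: "c < m"
      and a: "a = 4 * int c + 1 \<or> a = 4 * int c + 2 \<or> a = 4 * int c + 3 \<or> a = 4 * int c + 4"
      by (rule arc_cases)
    show "0 \<le> flow_res f g a \<and>
        flow_res f g a + flow_res f g (arev a) = of_int (zero_res a + zero_res (arev a))"
      using a fg c by (elim disjE) (simp_all add: arc_defs)
  qed
qed

text \<open>The two fixed pair sums of a cell determine its other two capacities from
  \<open>4c + 2\<close> and \<open>4c + 3\<close>, which hold the flows themselves.\<close>

lemma residual_eq_flow_res:
  fixes r :: "int \<Rightarrow> int"
  assumes "residual r" "a \<in> {1..4 * int m}"
  shows "r a = flow_res (\<lambda>c. r (4 * int c + 3)) (\<lambda>c. r (4 * int c + 2)) a"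
proof -
  obtain c where c: "c < m"
    and a: "a = 4 * int c + 1 \<or> a = 4 * int c + 2 \<or> a = 4 * int c + 3 \<or> a = 4 * int c + 4"
    using assms(2) by (rule arc_cases)
  have "4 * int c + 1 \<in> {1..4 * int m}" "4 * int c + 3 \<in> {1..4 * int m}" using c by auto
  hence "r (4 * int c + 1) + r (arev (4 * int c + 1))
      = of_int (zero_res (4 * int c + 1) + zero_res (arev (4 * int c + 1)))"
    "r (4 * int c + 3) + r (arev (4 * int c + 3))
      = of_int (zero_res (4 * int c + 3) + zero_res (arev (4 * int c + 3)))"
    using assms(1) unfolding residual_def by blast+
  hence "r (4 * int c + 1) = ccap c - r (4 * int c + 2)"
    "r (4 * int c + 4) = tcap c - r (4 * int c + 3)"
    by (simp_all add: arc_defs)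
  thus ?thesis using a by (elim disjE) (simp_all add: flow_res_def)
qed

lemma excess_flow_res:
  "excess (flow_res f g) v =
    (\<Sum>c<m. (if coln c = v then f c - g c else 0) - (if rown c = v then f c - g c else 0))"
proof -
  have "excess (flow_res f g) v = (\<Sum>a\<in>{1..4 * int m}.
      if asrc a = v then flow_res f g a - of_int (zero_res a) else 0)"
    unfolding excess_def by (rule sum.inter_filter) simp
  also have "\<dots> = (\<Sum>c<m. (if coln c = v then f c - g c else 0) - (if rown c = v then f c - g c else 0))"
    unfolding sum_arcs by (rule sum.cong) (simp_all add: arc_defs)
  finally show ?thesis .
qed

lemma excess_cong:
  assumes "\<And>a. a \<in> {1..4 * int m} \<Longrightarrow> r a = r' a"
  shows "excess r v = excess r' v"
  unfolding excess_def by (rule sum.cong) (use assms in auto)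

lemma excess_residual:
  assumes "residual r"
  shows "excess r v = (\<Sum>c<m.
    (if coln c = v then r (4 * int c + 3) - r (4 * int c + 2) else 0) -
    (if rown c = v then r (4 * int c + 3) - r (4 * int c + 2) else (0::int)))"
  using excess_cong[OF residual_eq_flow_res[OF assms]] by (simp add: excess_flow_res)

lemma residual_bounds:
  fixes r :: "int \<Rightarrow> int"
  assumes "residual r" "c < m"
  shows "0 \<le> r (4 * int c + 3) \<and> r (4 * int c + 3) \<le> tcap c \<and>
    0 \<le> r (4 * int c + 2) \<and> r (4 * int c + 2) \<le> ccap c"
proof -
  have "residual (flow_res (\<lambda>c. r (4 * int c + 3)) (\<lambda>c. r (4 * int c + 2)))"
    using assms(1) residual_eq_flow_res[OF assms(1)] rv_range
    unfolding residual_def by metis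
  thus ?thesis using assms(2) by (simp add: residual_flow_res_iff)
qed

text \<open>At zero excess the potential term of \<open>weak_duality\<close> vanishes. Arcs
  \<open>4c + 3\<close> and \<open>4c + 4\<close> contribute the same difference and control arcs
  are free, so what remains is twice the difference of the numbers of selected treatment
  samples.\<close>

lemma optimal_flow:
  fixes f g :: "nat \<Rightarrow> 'b::linordered_idom"
  assumes r: "residual r" "rc_nonneg r \<pi>" "\<And>v. v \<in> {1..k} \<Longrightarrow> excess r v = 0"
    and fg: "\<And>c. c < m \<Longrightarrow> 0 \<le> f c \<and> f c \<le> of_int (tcap c) \<and> 0 \<le> g c \<and> g c \<le> of_int (ccap c)"
    and bal: "\<And>v. v \<in> {1..k} \<Longrightarrow> excess (flow_res f g) v = 0"
  shows "(\<Sum>c<m. f c) \<le> of_int (\<Sum>c<m. r (4 * int c + 3))"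
proof -
  have h: "residual (flow_res f g)" using fg by (simp add: residual_flow_res_iff)
  have "(\<Sum>v\<in>{1..k}. \<pi> v * excess r v) = 0" using r(3) by simp
  hence "0 \<le> (\<Sum>a\<in>{1..4 * int m}. of_int (acost a) * (of_int (r a) - flow_res f g a))"
    using weak_duality[OF r(1,2) h bal] by simp
  also have "\<dots> = (\<Sum>a\<in>{1..4 * int m}. of_int (acost a) *
      (of_int (flow_res (\<lambda>c. r (4 * int c + 3)) (\<lambda>c. r (4 * int c + 2)) a) - flow_res f g a))"
    by (rule sum.cong) (simp_all add: residual_eq_flow_res[OF r(1), symmetric])
  also have "\<dots> = (\<Sum>c<m. 2 * (of_int (r (4 * int c + 3)) - f c))"
    unfolding sum_arcs by (rule sum.cong) (simp_all add: arc_defs)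
  also have "\<dots> = 2 * (of_int (\<Sum>c<m. r (4 * int c + 3)) - (\<Sum>c<m. f c))"
    by (simp add: sum_subtractf flip: sum_distrib_left)
  finally show ?thesis by simp
qed

text \<open>\<open>A\<close> counts arcs rather than cells, so that the invariant also makes sense
  halfway through a cell; the stored excess is the corresponding partial sum.\<close>

definition built :: "int \<Rightarrow> state \<Rightarrow> bool" where
  "built A s \<longleftrightarrow> scal s ''a'' = A \<and>
     (\<forall>a\<in>{1..A}. arr s ''tail'' a = asrc a \<and> arr s ''head'' a = adst a \<and>
        arr s ''cost'' a = acost a \<and> arr s ''rev'' a = arev a \<and>
        arr s ''res'' a = flow_res tcap (\<lambda>_. 0) a) \<and>
     linked asrc A (arr s ''first'') (arr s ''next'') \<and>
     (\<forall>v. arr s ''exc'' v = (\<Sum>a\<in>{a\<in>{1..A}. asrc a = v}. flow_res tcap (\<lambda>_. 0) a - zero_res a))"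

end

section \<open>Writing the network into memory\<close>

definition add_arc :: "string \<Rightarrow> string \<Rightarrow> int \<Rightarrow> aexp \<Rightarrow> aexp \<Rightarrow> int \<Rightarrow> com" where
  "add_arc u v w r z d = incr ''a'' ;;
     Write ''tail'' (Var ''a'') (Var u) ;; Write ''head'' (Var ''a'') (Var v) ;;
     Write ''cost'' (Var ''a'') (Const w) ;; Write ''rev'' (Var ''a'') (Plus (Var ''a'') (Const d)) ;;
     Write ''res'' (Var ''a'') r ;;
     Write ''next'' (Var ''a'') (Read ''first'' (Var u)) ;; Write ''first'' (Var u) (Var ''a'') ;;
     Write ''exc'' (Var u) (Plus (Read ''exc'' (Var u)) (Minus r z))"

definition add_cell :: com where
  "add_cell = Assign ''i'' (Read ''row'' (Var ''c'')) ;;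
     Assign ''j'' (Plus (Var ''k1'') (Read ''col'' (Var ''c''))) ;;
     Assign ''tcap'' (Minus (Read ''toff'' (Plus (Var ''c'') (Const 1))) (Read ''toff'' (Var ''c''))) ;;
     Assign ''ccap'' (Minus (Read ''coff'' (Plus (Var ''c'') (Const 1))) (Read ''coff'' (Var ''c''))) ;;
     add_arc ''j'' ''i'' 0 (Var ''ccap'') (Var ''ccap'') 1 ;;
     add_arc ''i'' ''j'' 0 (Const 0) (Const 0) (- 1) ;;
     add_arc ''j'' ''i'' 1 (Var ''tcap'') (Const 0) 1 ;;
     add_arc ''i'' ''j'' (- 1) (Const 0) (Var ''tcap'') (- 1) ;;
     incr ''c''"

text \<open>The last offset is the number of treatment samples, which is the total excess of the
  starting flow.\<close>

definition build :: com where
  "build = Assign ''k'' (Plus (Var ''k1'') (Var ''k2'')) ;;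
     While (Less (Var ''c'') (Var ''m'')) add_cell ;;
     Assign ''E'' (Read ''toff'' (Var ''m''))"

context cell_network
begin

text \<open>The expressions \<open>r\<close> and \<open>z\<close> are evaluated after the arc
  counter and several arrays have changed, so their values must depend on the other scalars alone.
  The separate name \<open>A'\<close> allows instances of the form \<open>4 * int c + 2\<close>, on
  which \<open>arc_val_simps\<close> works.\<close>

lemma wp_add_arc:
  assumes b: "built A s" and A: "0 \<le> A" "A' = A + 1"
    and u: "scal s u = asrc A'" "u \<noteq> ''a''" and v: "scal s v = adst A'" "v \<noteq> ''a''"
    and w: "w = acost A'" and d: "A' + d = arev A'"
    and r: "\<And>s'. (\<And>x. x \<noteq> ''a'' \<Longrightarrow> scal s' x = scal s x) \<Longrightarrow>
              aval r s' = flow_res tcap (\<lambda>_. 0) A'"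
    and z: "\<And>s'. (\<And>x. x \<noteq> ''a'' \<Longrightarrow> scal s' x = scal s x) \<Longrightarrow> aval z s' = zero_res A'"
  shows "wp (add_arc u v w r z d) s (\<lambda>t s'. t = 9 \<and> built A' s' \<and>
           (\<forall>x. x \<noteq> ''a'' \<longrightarrow> scal s' x = scal s x))"
proof -
  note A' = A(2) and A = A(1)
  note u = u[unfolded A'] and v = v[unfolded A'] and w = w[unfolded A'] and d = d[unfolded A']
    and r = r[unfolded A'] and z = z[unfolded A']
  have a: "scal s ''a'' = A" using b by (simp add: built_def)
  have l: "linked asrc A (arr s ''first'') (arr s ''next'')" using b by (simp add: built_def)
  have ins: "{1..A + 1} = insert (A + 1) {1..A}" using A by auto
  have old: "\<forall>a\<in>{1..A}. arr s ''tail'' a = asrc a \<and> arr s ''head'' a = adst a \<and>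
        arr s ''cost'' a = acost a \<and> arr s ''rev'' a = arev a \<and>
        arr s ''res'' a = flow_res tcap (\<lambda>_. 0) a"
    and exc: "\<And>v. arr s ''exc'' v = (\<Sum>a\<in>{a\<in>{1..A}. asrc a = v}. flow_res tcap (\<lambda>_. 0) a - zero_res a)"
    using b by (auto simp: built_def)
  have S: "{a \<in> {1..A + 1}. asrc a = v} =
      (if asrc (A + 1) = v then insert (A + 1) {a\<in>{1..A}. asrc a = v} else {a\<in>{1..A}. asrc a = v})" for v
    unfolding ins by auto
  have fin: "finite {a\<in>{1..A}. asrc a = v}" for v
    by (rule finite_subset[of _ "{1..A}"]) auto
  have exc': "(\<Sum>a\<in>{a\<in>{1..A + 1}. asrc a = v}. flow_res tcap (\<lambda>_. 0) a - zero_res a) =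
      (if asrc (A + 1) = v then arr s ''exc'' v + (flow_res tcap (\<lambda>_. 0) (A + 1) - zero_res (A + 1))
       else arr s ''exc'' v)" for v
    unfolding S using fin[of v] by (simp add: exc)
  have ne: "b \<noteq> A + 1" if "b \<in> {1..A}" for b using that by auto
  have lin: "linked asrc (A + 1) ((arr s ''first'')(asrc (A + 1) := A + 1))
      ((arr s ''next'')(A + 1 := arr s ''first'' (asrc (A + 1))))"
    by (rule linked_extend[OF l A])
  define x where "x = (arr s ''exc'')(asrc (A + 1) :=
      arr s ''exc'' (asrc (A + 1)) + (flow_res tcap (\<lambda>_. 0) (A + 1) - zero_res (A + 1)))"
  define f where "f = (arr s ''first'')(asrc (A + 1) := A + 1)"
  define n where "n = (arr s ''next'')(A + 1 := arr s ''first'' (asrc (A + 1)))"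
  have x: "x v = (\<Sum>a\<in>{a\<in>{1..A + 1}. asrc a = v}. flow_res tcap (\<lambda>_. 0) a - zero_res a)" for v
    unfolding exc' by (simp add: x_def)
  have "built (A + 1) (s\<lparr>scal := (scal s)(''a'' := A + 1),
     arr := (arr s)(''tail'' := (arr s ''tail'')(A + 1 := asrc (A + 1)),
       ''head'' := (arr s ''head'')(A + 1 := adst (A + 1)),
       ''cost'' := (arr s ''cost'')(A + 1 := acost (A + 1)),
       ''rev'' := (arr s ''rev'')(A + 1 := arev (A + 1)),
       ''res'' := (arr s ''res'')(A + 1 := flow_res tcap (\<lambda>_. 0) (A + 1)),
       ''next'' := n, ''first'' := f, ''exc'' := x)\<rparr>)"
    unfolding built_def
  proof (intro conjI)
    show "\<forall>v. arr (s\<lparr>scal := (scal s)(''a'' := A + 1),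
     arr := (arr s)(''tail'' := (arr s ''tail'')(A + 1 := asrc (A + 1)),
       ''head'' := (arr s ''head'')(A + 1 := adst (A + 1)),
       ''cost'' := (arr s ''cost'')(A + 1 := acost (A + 1)),
       ''rev'' := (arr s ''rev'')(A + 1 := arev (A + 1)),
       ''res'' := (arr s ''res'')(A + 1 := flow_res tcap (\<lambda>_. 0) (A + 1)),
       ''next'' := n, ''first'' := f, ''exc'' := x)\<rparr>) ''exc'' v =
       (\<Sum>a\<in>{a\<in>{1..A + 1}. asrc a = v}. flow_res tcap (\<lambda>_. 0) a - zero_res a)"
      unfolding x[symmetric] by simp
  qed (use old ne lin ins in \<open>simp_all add: f_def n_def\<close>)
  thus ?thesis
    using u v by (simp add: A' add_arc_def a w d r z flip: x_def f_def n_def)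
qed

text \<open>The 41 steps are four assignments, four arcs of nine commands each, and the increment of
  \<open>c\<close>.\<close>

lemma wp_add_cell:
  assumes b: "built (4 * int c) s" and c: "c < m" "scal s ''c'' = int c"
    and row: "arr s ''row'' (int c) = rown c"
    and col: "scal s ''k1'' + arr s ''col'' (int c) = coln c"
    and toff: "arr s ''toff'' (int c + 1) - arr s ''toff'' (int c) = tcap c"
    and coff: "arr s ''coff'' (int c + 1) - arr s ''coff'' (int c) = ccap c"
  shows "wp add_cell s (\<lambda>t s'. t = 41 \<and> built (4 * int (Suc c)) s' \<and>
     scal s' ''c'' = int (Suc c))"
proof -
  define s0 where "s0 = s\<lparr>scal := (scal s)(''i'' := rown c, ''j'' := coln c,
    ''tcap'' := tcap c, ''ccap'' := ccap c)\<rparr>"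
  have b0: "built (4 * int c) s0" using b by (simp add: built_def s0_def)
  define same where "same s' \<longleftrightarrow> (\<forall>x. x \<noteq> ''a'' \<longrightarrow> scal s' x = scal s0 x)" for s' :: state
  have vars: "scal s' ''i'' = rown c" "scal s' ''j'' = coln c" "scal s' ''tcap'' = tcap c"
    "scal s' ''ccap'' = ccap c" if "same s'" for s'
    using that by (simp_all add: same_def s0_def)
  have Suc4: "4 * int (Suc c) = 4 * int c + 4" by simp
  note step = wp_conseq[OF wp_add_arc]
  have 4: "wp (add_arc ''i'' ''j'' (- 1) (Const 0) (Var ''tcap'') (- 1)) s3
      (\<lambda>t s'. t = 9 \<and> built (4 * int c + 4) s' \<and> same s')" if "same s3" "built (4 * int c + 3) s3" for s3
    by (rule step[OF that(2)]) (use that vars[OF that(1)] in \<open>auto simp: arc_defs same_def\<close>)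
  have 3: "wp (add_arc ''j'' ''i'' 1 (Var ''tcap'') (Const 0) 1) s2
      (\<lambda>t s'. t = 9 \<and> built (4 * int c + 3) s' \<and> same s')" if "same s2" "built (4 * int c + 2) s2" for s2
    by (rule step[OF that(2)]) (use that vars[OF that(1)] in \<open>auto simp: arc_defs same_def\<close>)
  have 2: "wp (add_arc ''i'' ''j'' 0 (Const 0) (Const 0) (- 1)) s1
      (\<lambda>t s'. t = 9 \<and> built (4 * int c + 2) s' \<and> same s')" if "same s1" "built (4 * int c + 1) s1" for s1
    by (rule step[OF that(2)]) (use that vars[OF that(1)] in \<open>auto simp: arc_defs same_def\<close>)
  have 1: "wp (add_arc ''j'' ''i'' 0 (Var ''ccap'') (Var ''ccap'') 1) s0
      (\<lambda>t s'. t = 9 \<and> built (4 * int c + 1) s' \<and> same s')"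
    by (rule step[OF b0]) (auto simp: arc_defs same_def s0_def)
  have "wp (add_arc ''j'' ''i'' 0 (Var ''ccap'') (Var ''ccap'') 1 ;;
     add_arc ''i'' ''j'' 0 (Const 0) (Const 0) (- 1) ;;
     add_arc ''j'' ''i'' 1 (Var ''tcap'') (Const 0) 1 ;;
     add_arc ''i'' ''j'' (- 1) (Const 0) (Var ''tcap'') (- 1) ;;
     incr ''c'') s0 (\<lambda>t s'. t = 37 \<and> built (4 * int (Suc c)) s' \<and> scal s' ''c'' = int (Suc c))"
    unfolding wp_simps(4) Suc4
    apply (rule wp_conseq[OF 1])
    apply (rule wp_conseq[OF 2]; (elim conjE)?)
      apply assumption+
    apply (rule wp_conseq[OF 3]; (elim conjE)?)
      apply assumption+
    apply (rule wp_conseq[OF 4]; (elim conjE)?)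
      apply assumption+
    using c by (simp add: built_def same_def s0_def)
  thus ?thesis
    by (simp add: add_cell_def c row col toff coff flip: s0_def)
qed

definition input :: "state \<Rightarrow> bool" where
  "input s \<longleftrightarrow> scal s ''m'' = int m \<and> scal s ''k1'' = k1 \<and> scal s ''k1'' + scal s ''k2'' = k \<and>
     (\<forall>c<m. arr s ''row'' (int c) = rown c \<and> k1 + arr s ''col'' (int c) = coln c \<and>
        arr s ''toff'' (int c + 1) - arr s ''toff'' (int c) = tcap c \<and>
        arr s ''coff'' (int c + 1) - arr s ''coff'' (int c) = ccap c) \<and>
     arr s ''toff'' (int m) = (\<Sum>c<m. tcap c)"

section \<open>The starting flow\<close>

lemma excess_initial:
  assumes "v \<in> {1..k}"
  shows "max 0 (excess (flow_res tcap (\<lambda>_. 0)) v) = (\<Sum>c<m. if coln c = v then tcap c else 0)"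
proof (cases "v \<le> k1")
  case True
  hence "coln c \<noteq> v" if "c < m" for c using coln[OF that] by auto
  hence "excess (flow_res tcap (\<lambda>_. 0)) v = (\<Sum>c<m. - (if rown c = v then tcap c else 0))"
    "(\<Sum>c<m. if coln c = v then tcap c else 0) = 0"
    unfolding excess_flow_res by (auto intro!: sum.cong)
  moreover have "(\<Sum>c<m. - (if rown c = v then tcap c else 0)) \<le> 0"
    using caps by (intro sum_nonpos) auto
  ultimately show ?thesis by simp
next
  case False
  hence "rown c \<noteq> v" if "c < m" for c using rown[OF that] by auto
  hence "excess (flow_res tcap (\<lambda>_. 0)) v = (\<Sum>c<m. if coln c = v then tcap c else 0)"
    unfolding excess_flow_res by (auto intro!: sum.cong)
  moreover have "0 \<le> (\<Sum>c<m. if coln c = v then tcap c else 0)"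
    using caps by (intro sum_nonneg) auto
  ultimately show ?thesis by simp
qed

lemma total_excess_initial:
  "total_excess (excess (flow_res tcap (\<lambda>_. 0))) = (\<Sum>c<m. tcap c)"
proof -
  have "total_excess (excess (flow_res tcap (\<lambda>_. 0)))
      = (\<Sum>v\<in>{1..k}. \<Sum>c<m. if coln c = v then tcap c else 0)"
    unfolding total_excess_def by (rule sum.cong) (simp_all add: excess_initial del: max_def)
  also have "\<dots> = (\<Sum>c<m. \<Sum>v\<in>{1..k}. if coln c = v then tcap c else 0)"
    by (rule sum.swap)
  also have "\<dots> = (\<Sum>c<m. tcap c)"
  proof (rule sum.cong)
    fix c assume "c \<in> {..<m}"
    hence "coln c \<in> {1..k}" using coln[of c] k1_bounds by auto
    thus "(\<Sum>v\<in>{1..k}. if coln c = v then tcap c else 0) = tcap c" by simp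
  qed simp
  finally show ?thesis .
qed

text \<open>The only arcs of negative cost are the \<open>4c + 4\<close>, which select a treatment
  sample. They have residual capacity 0 when everything is selected, so the zero potential is dual
  feasible.\<close>

lemma state_inv_initial:
  assumes "\<And>v. v \<in> {1..k} \<Longrightarrow> x v = excess (flow_res tcap (\<lambda>_. 0)) v"
    and "\<And>a. a \<in> {1..4 * int m} \<Longrightarrow> r a = flow_res tcap (\<lambda>_. 0) a"
  shows "state_inv r x (\<lambda>_. 0) 0"
proof -
  have "residual (flow_res tcap (\<lambda>_. 0))"
    using caps by (simp add: residual_flow_res_iff)
  hence "residual r"
    using assms(2) rv_range by (simp add: residual_def)
  moreover have "rc_nonneg r (\<lambda>_. 0)"
    unfolding rc_nonneg_def
  proof (intro ballI impI)
    fix a assume a: "a \<in> {1..4 * int m}" "0 < r a"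
    obtain c where "c < m"
      "a = 4 * int c + 1 \<or> a = 4 * int c + 2 \<or> a = 4 * int c + 3 \<or> a = 4 * int c + 4"
      using a(1) by (rule arc_cases)
    hence "0 \<le> acost a"
      using a(2) assms(2)[OF a(1)] by (elim disjE) (simp_all add: arc_defs)
    thus "0 \<le> rc (\<lambda>_. 0) a" by (simp add: rc_def)
  qed
  ultimately show ?thesis
    using assms(1) excess_cong[of r "flow_res tcap (\<lambda>_. 0)"] assms(2)
    by (simp add: state_inv_def)
qed

text \<open>Only the arcs \<open>4c + 4\<close> can have both nonzero cost and nonzero capacity in
  the zero circulation.\<close>

lemma cost_bound_eq: "cost_bound = (\<Sum>c<m. tcap c)"
  unfolding cost_bound_def sum_arcs by (rule sum.cong) (simp_all add: arc_defs)

lemma wp_build: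
  assumes i: "input s" and zero: "scal s ''c'' = 0" "scal s ''a'' = 0" "scal s ''D'' = 0"
    "arr s ''first'' = (\<lambda>_. 0)" "arr s ''exc'' = (\<lambda>_. 0)" "arr s ''pi'' = (\<lambda>_. 0)"
  shows "wp build s (\<lambda>t s'. t \<le> 42 * m + 3 \<and> solve_inv s' \<and> scal s' ''D'' = 0 \<and>
     scal s' ''E'' = (\<Sum>c<m. tcap c))"
proof -
  let ?b = "Less (Var ''c'') (Var ''m'')"
  let ?s0 = "s\<lparr>scal := (scal s)(''k'' := k)\<rparr>"
  define I :: "state \<Rightarrow> bool" where "I = (\<lambda>s'. 0 \<le> scal s' ''c'' \<and> scal s' ''c'' \<le> int m \<and>
    built (4 * scal s' ''c'') s')"
  define fin where "fin s' \<longleftrightarrow> scal s' ''m'' = int m \<and> scal s' ''k'' = k \<and> scal s' ''D'' = 0 \<and>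
    built (4 * int m) s' \<and> arr s' ''pi'' = (\<lambda>_. 0) \<and>
    arr s' ''toff'' (int m) = (\<Sum>c<m. tcap c)" for s' :: state
  have "wp (While ?b add_cell) ?s0 (\<lambda>t s'. t + 2 \<le> 42 * m + 3 \<and> fin s')"
  proof (rule wp_while[where I = I and \<Phi> = "\<lambda>s'. 42 * nat (int m - scal s' ''c'')"])
    \<comment> \<open>Memory that is 0 everywhere already represents the network without arcs: all
      lists are empty and all excesses are 0.\<close>
    show "I ?s0"
      using zero by (auto simp: I_def built_def linked_def intro!: sum.neutral)
  next
    fix s' assume I: "I s'" and fr: "frame (While ?b add_cell) ?s0 s'" and b: "bval ?b s'"
    have same: "scal s' ''m'' = int m" "scal s' ''k1'' = k1"
      "arr s' ''row'' = arr s ''row''" "arr s' ''col'' = arr s ''col''"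
      "arr s' ''toff'' = arr s ''toff''" "arr s' ''coff'' = arr s ''coff''"
      using frame_scal[OF fr] frame_arr[OF fr] i
      by (simp_all add: add_cell_def add_arc_def input_def)
    define c where "c = nat (scal s' ''c'')"
    have c: "scal s' ''c'' = int c" "c < m" using I b same by (auto simp: I_def c_def)
    have "wp add_cell s' (\<lambda>t s'. t = 41 \<and> built (4 * int (Suc c)) s' \<and>
        scal s' ''c'' = int (Suc c))"
      using I c i by (intro wp_add_cell) (auto simp: I_def same input_def)
    thus "wp add_cell s' (\<lambda>t s''. I s'' \<and>
        42 * nat (int m - scal s'' ''c'') + t < 42 * nat (int m - scal s' ''c''))"
      by (rule wp_conseq) (use c in \<open>auto simp: I_def\<close>)
  next
    fix s' t assume I: "I s'" and fr: "frame (While ?b add_cell) ?s0 s'" and b: "\<not> bval ?b s'"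
      and t: "t + 42 * nat (int m - scal s' ''c'') \<le> 42 * nat (int m - scal ?s0 ''c'') + 1"
    have same: "scal s' ''m'' = int m" "scal s' ''k'' = k" "scal s' ''D'' = 0"
      "arr s' ''pi'' = (\<lambda>_. 0)" "arr s' ''toff'' = arr s ''toff''"
      using frame_scal[OF fr] frame_arr[OF fr] i zero
      by (simp_all add: add_cell_def add_arc_def input_def)
    have "scal s' ''c'' = int m" using I b same by (auto simp: I_def)
    thus "t + 2 \<le> 42 * m + 3 \<and> fin s'"
      using I t same i zero by (simp add: I_def fin_def input_def)
  qed
  hence "wp (While ?b add_cell) ?s0 (\<lambda>t s'. t + 2 \<le> 42 * m + 3 \<and>
     solve_inv (s'\<lparr>scal := (scal s')(''E'' := arr s' ''toff'' (scal s' ''m''))\<rparr>) \<and>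
     scal s' ''D'' = 0 \<and> arr s' ''toff'' (scal s' ''m'') = (\<Sum>c<m. tcap c))"
  proof (rule wp_conseq)
    fix t s' assume *: "t + 2 \<le> 42 * m + 3 \<and> fin s'"
    hence b: "built (4 * int m) s'" by (simp add: fin_def)
    have x: "arr s' ''exc'' = excess (flow_res tcap (\<lambda>_. 0))"
      using b by (simp add: built_def excess_def fun_eq_iff)
    have "state_inv (arr s' ''res'') (arr s' ''exc'') (\<lambda>_. 0) 0"
      using b by (intro state_inv_initial) (simp_all add: built_def x)
    thus "t + 2 \<le> 42 * m + 3 \<and>
     solve_inv (s'\<lparr>scal := (scal s')(''E'' := arr s' ''toff'' (scal s' ''m''))\<rparr>) \<and>
     scal s' ''D'' = 0 \<and> arr s' ''toff'' (scal s' ''m'') = (\<Sum>c<m. tcap c)"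
      using * by (simp add: fin_def solve_inv_def graph_def built_def x total_excess_initial)
  qed
  moreover have "scal s ''k1'' + scal s ''k2'' = k" using i by (simp add: input_def)
  ultimately show ?thesis by (simp add: build_def)
qed

lemma wp_build_solve:
  assumes i: "input s" and zero: "scal s ''c'' = 0" "scal s ''a'' = 0" "scal s ''D'' = 0"
    "arr s ''first'' = (\<lambda>_. 0)" "arr s ''exc'' = (\<lambda>_. 0)" "arr s ''pi'' = (\<lambda>_. 0)"
    and n: "int n = (\<Sum>c<m. tcap c)"
  shows "wp (build ;; solve) s (\<lambda>t s'. t \<le> (24 * (nat k + 4 * m) + 14) * (2 * n) + 42 * m + 4 \<and>
     residual (arr s' ''res'') \<and> (\<exists>\<pi>. rc_nonneg (arr s' ''res'') \<pi>) \<and>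
     (\<forall>v\<in>{1..k}. excess (arr s' ''res'') v = 0))"
  unfolding wp_simps(4)
proof (rule wp_conseq[OF wp_build[OF i zero]])
  fix t s' assume 1: "t \<le> 42 * m + 3 \<and> solve_inv s' \<and> scal s' ''D'' = 0 \<and>
     scal s' ''E'' = (\<Sum>c<m. tcap c)"
  have "cost_bound \<le> int n" "scal s' ''E'' \<le> int n" "solve_inv s'" "scal s' ''D'' = 0"
    using 1 n by (simp_all add: cost_bound_eq)
  from wp_solve[OF this(3,4,1,2)]
  show "wp solve s' (\<lambda>t' s'. t + t' \<le> (24 * (nat k + 4 * m) + 14) * (2 * n) + 42 * m + 4 \<and>
     residual (arr s' ''res'') \<and> (\<exists>\<pi>. rc_nonneg (arr s' ''res'') \<pi>) \<and>
     (\<forall>v\<in>{1..k}. excess (arr s' ''res'') v = 0))"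
  proof (rule wp_conseq)
    fix t' s'' assume 2: "t' \<le> (24 * (nat k + nat (4 * int m)) + 14) * (2 * nat (int n)) + 1 \<and>
      solve_inv s'' \<and> (\<forall>v\<in>{1..k}. excess (arr s'' ''res'') v = 0)"
    have "nat (4 * int m) = 4 * m" by simp
    moreover have "residual (arr s'' ''res'')" "rc_nonneg (arr s'' ''res'') (arr s'' ''pi'')"
      using 2 by (simp_all add: solve_inv_def state_inv_def)
    ultimately show "t + t' \<le> (24 * (nat k + 4 * m) + 14) * (2 * n) + 42 * m + 4 \<and>
     residual (arr s'' ''res'') \<and> (\<exists>\<pi>. rc_nonneg (arr s'' ''res'') \<pi>) \<and>
     (\<forall>v\<in>{1..k}. excess (arr s'' ''res'') v = 0)"
      using 1 2 by auto
  qed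
qed

end

section \<open>Reading off the selections\<close>

definition copy :: "string \<Rightarrow> string \<Rightarrow> string \<Rightarrow> string \<Rightarrow> string \<Rightarrow> com" where
  "copy from off flow to num = Assign ''p'' (Read off (Var ''c'')) ;;
     Assign ''q'' (Plus (Var ''p'') (Read flow (Var ''c''))) ;;
     While (Less (Var ''p'') (Var ''q''))
       (Write to (Var num) (Read from (Var ''p'')) ;; incr num ;; incr ''p'')"

definition emit_cell :: com where
  "emit_cell =
     Write ''tflow'' (Var ''c'') (Read ''res'' (Plus (Var ''e'') (Const 3))) ;;
     Write ''cflow'' (Var ''c'') (Read ''res'' (Plus (Var ''e'') (Const 2))) ;;
     copy ''treated'' ''toff'' ''tflow'' ''S'' ''numS'' ;;
     copy ''control'' ''coff'' ''cflow'' ''S2'' ''numS2'' ;;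
     Assign ''e'' (Plus (Var ''e'') (Const 4)) ;; incr ''c''"

definition emit :: com where
  "emit = Assign ''c'' (Const 0) ;; Assign ''e'' (Const 0) ;;
     While (Less (Var ''c'') (Var ''m'')) emit_cell"

definition stores :: "state \<Rightarrow> string \<Rightarrow> string \<Rightarrow> nat list \<Rightarrow> bool" where
  "stores s x a xs \<longleftrightarrow> scal s x = int (length xs) \<and>
     (\<forall>i<length xs. arr s a (int i) = int (xs ! i))"

lemma holds_set_stores:
  "distinct xs \<Longrightarrow> stores s x a xs \<Longrightarrow> holds_set s x a (set xs)"
  by (auto simp: holds_set_def stores_def)

lemma stores_snoc:
  assumes "stores s num to xs" "num \<noteq> ''p''"
  shows "stores (s\<lparr>arr := (arr s)(to := (arr s to)(scal s num := int y)),
    scal := (scal s)(num := scal s num + 1, ''p'' := p)\<rparr>) num to (xs @ [y])"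
  using assms by (auto simp: stores_def nth_append less_Suc_eq)

lemma wp_copy:
  assumes xs: "stores s num to xs"
    and ys: "arr s flow (scal s ''c'') = int (length ys)"
      "\<And>i. i < length ys \<Longrightarrow> arr s from (arr s off (scal s ''c'') + int i) = int (ys ! i)"
    and names: "num \<notin> {''p'', ''q'', ''c''}" "from \<noteq> to"
  shows "wp (copy from off flow to num) s (\<lambda>t s'. t \<le> 4 * length ys + 3 \<and> stores s' num to (xs @ ys))"
proof -
  let ?o = "arr s off (scal s ''c'')"
  let ?q = "?o + int (length ys)"
  let ?s0 = "s\<lparr>scal := (scal s)(''p'' := ?o, ''q'' := ?q)\<rparr>"
  let ?b = "Less (Var ''p'') (Var ''q'')"
  let ?c = "Write to (Var num) (Read from (Var ''p'')) ;; incr num ;; incr ''p''"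
  define I :: "state \<Rightarrow> bool" where
    "I = (\<lambda>s'. \<exists>n\<le>length ys. scal s' ''p'' = ?o + int n \<and> stores s' num to (xs @ take n ys))"
  have "wp (While ?b ?c) ?s0
      (\<lambda>t s'. t + 2 \<le> 4 * length ys + 3 \<and> stores s' num to (xs @ ys))"
  proof (rule wp_while[where I = I and \<Phi> = "\<lambda>s'. 4 * nat (?q - scal s' ''p'')"])
    have "scal ?s0 ''p'' = ?o + int 0 \<and> stores ?s0 num to (xs @ take 0 ys)"
      using xs names by (simp add: stores_def)
    thus "I ?s0" unfolding I_def by blast
  next
    fix s' assume I: "I s'" and fr: "frame (While ?b ?c) ?s0 s'" and b: "bval ?b s'"
    have same: "scal s' ''q'' = ?q" "arr s' from = arr s from"
      using frame_scal[OF fr, of "''q''"] frame_arr[OF fr, of "from"] names by auto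
    obtain n where n: "n \<le> length ys" "scal s' ''p'' = ?o + int n"
      and st: "stores s' num to (xs @ take n ys)" using I by (auto simp: I_def)
    have nlt: "n < length ys" using b n same by simp
    define s'' where "s'' = s'\<lparr>arr := (arr s')(to := (arr s' to)(scal s' num := int (ys ! n))),
      scal := (scal s')(num := scal s' num + 1, ''p'' := scal s' ''p'' + 1)\<rparr>"
    have "stores s'' num to ((xs @ take n ys) @ [ys ! n])"
      unfolding s''_def by (rule stores_snoc[OF st]) (use names in simp)
    moreover have "(xs @ take n ys) @ [ys ! n] = xs @ take (Suc n) ys"
      using nlt by (simp add: take_Suc_conv_app_nth)
    moreover have p: "scal s'' ''p'' = ?o + int (Suc n)" using n by (simp add: s''_def)
    ultimately have "I s''" using nlt unfolding I_def by (metis Suc_leI)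
    moreover have "arr s' from (scal s' ''p'') = int (ys ! n)"
      using ys(2)[OF nlt] n same by simp
    ultimately show "wp ?c s' (\<lambda>t s''. I s'' \<and>
        4 * nat (?q - scal s'' ''p'') + t < 4 * nat (?q - scal s' ''p''))"
      using names n nlt by (auto simp: s''_def)
  next
    fix s' t assume I: "I s'" and fr: "frame (While ?b ?c) ?s0 s'" and b: "\<not> bval ?b s'"
      and t: "t + 4 * nat (?q - scal s' ''p'') \<le> 4 * nat (?q - scal ?s0 ''p'') + 1"
    have "scal s' ''q'' = ?q"
      using frame_scal[OF fr, of "''q''"] names by auto
    moreover obtain n where "n \<le> length ys" "scal s' ''p'' = ?o + int n"
      "stores s' num to (xs @ take n ys)" using I by (auto simp: I_def)
    ultimately show "t + 2 \<le> 4 * length ys + 3 \<and> stores s' num to (xs @ ys)"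
      using b t by simp
  qed
  thus ?thesis by (simp add: copy_def ys(1))
qed

lemma array_of_concat:
  assumes "c < length xss" "i < length (xss ! c)"
  shows "array_of (concat xss) (int (length (concat (take c xss))) + int i) = int (xss ! c ! i)"
proof -
  have eq: "concat xss = concat (take c xss) @ xss ! c @ concat (drop (Suc c) xss)"
    using assms(1) by (metis concat.simps(2) concat_append id_take_nth_drop)
  have "concat xss ! (length (concat (take c xss)) + i) = xss ! c ! i"
    by (subst eq) (use assms in \<open>simp add: nth_append\<close>)
  moreover have "length (concat (take c xss)) + i < length (concat xss)"
    using arg_cong[OF eq, of length] assms by simp
  ultimately show ?thesis
    by (simp add: array_of_def nat_int_add)
qed

lemma array_of_offsets:
  "c \<le> length xss \<Longrightarrow> array_of (offsets xss) (int c) = int (length (concat (take c xss)))"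
  by (simp add: array_of_def offsets_def nth_append)

text \<open>Samples of one cell are interchangeable for balance, so a prefix of the right length is
  as good as any other choice.\<close>

definition selected :: "nat list list \<Rightarrow> (nat \<Rightarrow> nat) \<Rightarrow> nat \<Rightarrow> nat list" where
  "selected xss f n = concat (map (\<lambda>c. take (f c) (xss ! c)) [0..<n])"

lemma selected_Suc: "selected xss f (Suc n) = selected xss f n @ take (f n) (xss ! n)"
  by (simp add: selected_def)

lemma wp_emit:
  assumes m: "scal s ''m'' = int m" "length ts = m" "length us = m"
    and inp: "arr s ''toff'' = array_of (offsets ts)" "arr s ''treated'' = array_of (concat ts)"
      "arr s ''coff'' = array_of (offsets us)" "arr s ''control'' = array_of (concat us)"
    and num: "scal s ''numS'' = 0" "scal s ''numS2'' = 0"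
    and f: "\<And>c. c < m \<Longrightarrow> arr s ''res'' (4 * int c + 3) = int (f c) \<and> f c \<le> length (ts ! c)"
    and g: "\<And>c. c < m \<Longrightarrow> arr s ''res'' (4 * int c + 2) = int (g c) \<and> g c \<le> length (us ! c)"
  shows "wp emit s (\<lambda>t s'. t \<le> (\<Sum>c<m. 11 + 4 * f c + 4 * g c) + 3 \<and>
     stores s' ''numS'' ''S'' (selected ts f m) \<and> stores s' ''numS2'' ''S2'' (selected us g m) \<and>
     (\<forall>c<m. arr s' ''tflow'' (int c) = int (f c) \<and> arr s' ''cflow'' (int c) = int (g c)))"
proof -
  let ?b = "Less (Var ''c'') (Var ''m'')"
  let ?s0 = "s\<lparr>scal := (scal s)(''c'' := 0, ''e'' := 0)\<rparr>"
  define J where "J n s' \<longleftrightarrow> scal s' ''c'' = int n \<and> scal s' ''e'' = 4 * int n \<and>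
     stores s' ''numS'' ''S'' (selected ts f n) \<and> stores s' ''numS2'' ''S2'' (selected us g n) \<and>
     (\<forall>c<n. arr s' ''tflow'' (int c) = int (f c) \<and> arr s' ''cflow'' (int c) = int (g c))"
    for n and s' :: state
  \<comment> \<open>The 11 counts two writes, the overhead 3 of each of the two copies, two
    assignments and the loop test. Copying a sample costs 4.\<close>
  define w where "w c = 11 + 4 * f c + 4 * g c" for c
  \<comment> \<open>Cells cost different amounts, so the budget is the sum over those still to
    come.\<close>
  define \<Phi> :: "state \<Rightarrow> nat" where "\<Phi> = (\<lambda>s'. \<Sum>c\<in>{nat (scal s' ''c'')..<m}. w c)"
  have step: "wp emit_cell s' (\<lambda>t s''. J (Suc n) s'' \<and> t + 1 \<le> w n)"
    if J: "J n s'" and n: "n < m" and fr: "frame (While ?b emit_cell) ?s0 s'" for n s'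
  proof -
    have same: "arr s' ''res'' = arr s ''res''" "arr s' ''toff'' = array_of (offsets ts)"
      "arr s' ''treated'' = array_of (concat ts)" "arr s' ''coff'' = array_of (offsets us)"
      "arr s' ''control'' = array_of (concat us)"
      using frame_arr[OF fr] inp by (simp_all add: emit_cell_def copy_def)
    define s1 where "s1 = s'\<lparr>arr := (arr s')
      (''tflow'' := (arr s' ''tflow'')(int n := int (f n)),
       ''cflow'' := (arr s' ''cflow'')(int n := int (g n)))\<rparr>"
    have J1: "scal s1 ''c'' = int n" "scal s1 ''e'' = 4 * int n"
      "stores s1 ''numS'' ''S'' (selected ts f n)" "stores s1 ''numS2'' ''S2'' (selected us g n)"
      "\<forall>c<Suc n. arr s1 ''tflow'' (int c) = int (f c) \<and> arr s1 ''cflow'' (int c) = int (g c)"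
      using J by (auto simp: J_def s1_def stores_def less_Suc_eq)
    have same1: "arr s1 ''toff'' = array_of (offsets ts)"
      "arr s1 ''treated'' = array_of (concat ts)" "arr s1 ''coff'' = array_of (offsets us)"
      "arr s1 ''control'' = array_of (concat us)"
      using same by (simp_all add: s1_def)
    have copy1: "wp (copy ''treated'' ''toff'' ''tflow'' ''S'' ''numS'') s1
      (\<lambda>t s'. t \<le> 4 * length (take (f n) (ts ! n)) + 3 \<and>
        stores s' ''numS'' ''S'' (selected ts f n @ take (f n) (ts ! n)))"
      using J1 same1 f[OF n] n m
      by (intro wp_copy) (auto simp: array_of_concat array_of_offsets)
    have "wp (copy ''treated'' ''toff'' ''tflow'' ''S'' ''numS'' ;;
        copy ''control'' ''coff'' ''cflow'' ''S2'' ''numS2'' ;;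
        Assign ''e'' (Plus (Var ''e'') (Const 4)) ;; incr ''c'') s1
      (\<lambda>t s''. J (Suc n) s'' \<and> Suc (Suc (Suc t)) \<le> w n)"
      unfolding wp_simps(4)
    proof (rule wp_conseq[OF copy1])
      fix t2 s2 assume 2: "t2 \<le> 4 * length (take (f n) (ts ! n)) + 3 \<and>
          stores s2 ''numS'' ''S'' (selected ts f n @ take (f n) (ts ! n))"
        and fr2: "frame (copy ''treated'' ''toff'' ''tflow'' ''S'' ''numS'') s1 s2"
      have same2: "scal s2 ''c'' = int n" "scal s2 ''e'' = 4 * int n"
        "scal s2 ''numS2'' = scal s1 ''numS2''" "arr s2 ''S2'' = arr s1 ''S2''"
        "arr s2 ''tflow'' = arr s1 ''tflow''" "arr s2 ''cflow'' = arr s1 ''cflow''"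
        "arr s2 ''coff'' = array_of (offsets us)" "arr s2 ''control'' = array_of (concat us)"
        using frame_scal[OF fr2] frame_arr[OF fr2] J1 same1 by (simp_all add: copy_def)
      have "stores s2 ''numS2'' ''S2'' (selected us g n)"
        using J1 same2 by (simp add: stores_def)
      hence copy2: "wp (copy ''control'' ''coff'' ''cflow'' ''S2'' ''numS2'') s2
        (\<lambda>t s'. t \<le> 4 * length (take (g n) (us ! n)) + 3 \<and>
          stores s' ''numS2'' ''S2'' (selected us g n @ take (g n) (us ! n)))"
        using J1 same2 g[OF n] n m
        by (intro wp_copy) (auto simp: array_of_concat array_of_offsets)
      show "wp (copy ''control'' ''coff'' ''cflow'' ''S2'' ''numS2'') s2
        (\<lambda>t s'. wp (Assign ''e'' (Plus (Var ''e'') (Const 4))) s'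
          (\<lambda>t' s'. wp (incr ''c'') s' (\<lambda>t'' s''. J (Suc n) s'' \<and> Suc (Suc (Suc (t2 + (t + (t' + t''))))) \<le> w n)))"
      proof (rule wp_conseq[OF copy2])
        fix t3 s3 assume 3: "t3 \<le> 4 * length (take (g n) (us ! n)) + 3 \<and>
          stores s3 ''numS2'' ''S2'' (selected us g n @ take (g n) (us ! n))"
          and fr3: "frame (copy ''control'' ''coff'' ''cflow'' ''S2'' ''numS2'') s2 s3"
        have same3: "scal s3 ''c'' = int n" "scal s3 ''e'' = 4 * int n"
          "scal s3 ''numS'' = scal s2 ''numS''" "arr s3 ''S'' = arr s2 ''S''"
          "arr s3 ''tflow'' = arr s1 ''tflow''" "arr s3 ''cflow'' = arr s1 ''cflow''"
          using frame_scal[OF fr3] frame_arr[OF fr3] same2 by (simp_all add: copy_def)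
        have "length (take (f n) (ts ! n)) \<le> f n" "length (take (g n) (us ! n)) \<le> g n" by simp_all
        hence "t2 + t3 + 5 \<le> w n" using 2 3 unfolding w_def by linarith
        moreover have "stores s3 ''numS'' ''S'' (selected ts f n @ take (f n) (ts ! n))"
          using 2 same3 by (simp add: stores_def)
        ultimately show "wp (Assign ''e'' (Plus (Var ''e'') (Const 4))) s3
          (\<lambda>t' s'. wp (incr ''c'') s' (\<lambda>t'' s''. J (Suc n) s'' \<and> Suc (Suc (Suc (t2 + (t3 + (t' + t''))))) \<le> w n))"
          using 3 J1(5) same3 by (simp add: J_def selected_Suc stores_def)
      qed
    qed
    thus ?thesis
      using J f[OF n] g[OF n] by (simp add: emit_cell_def J_def same s1_def)
  qed
  have "wp (While ?b emit_cell) ?s0 (\<lambda>t s'. t + 2 \<le> (\<Sum>c<m. w c) + 3 \<and> J m s')"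
  proof (rule wp_while[where I = "\<lambda>s'. \<exists>n\<le>m. J n s'" and \<Phi> = \<Phi>])
    have "J 0 ?s0" using num by (simp add: J_def stores_def selected_def)
    thus "\<exists>n\<le>m. J n ?s0" by blast
  next
    fix s' assume "\<exists>n\<le>m. J n s'" and fr: "frame (While ?b emit_cell) ?s0 s'"
      and b: "bval ?b s'"
    then obtain n where J: "J n s'" "n \<le> m" by blast
    have "scal s' ''m'' = int m"
      using frame_scal[OF fr, of "''m''"] m by (simp add: emit_cell_def copy_def)
    hence n: "n < m" using b J by (simp add: J_def)
    hence split: "{n..<m} = insert n {Suc n..<m}" by auto
    show "wp emit_cell s' (\<lambda>t s''. (\<exists>n\<le>m. J n s'') \<and> \<Phi> s'' + t < \<Phi> s')"
    proof (rule wp_conseq[OF step[OF J(1) n fr]])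
      fix t s'' assume *: "J (Suc n) s'' \<and> t + 1 \<le> w n"
      hence "scal s'' ''c'' = int (Suc n)" unfolding J_def by blast
      hence "\<Phi> s'' = (\<Sum>c\<in>{Suc n..<m}. w c)" by (simp only: \<Phi>_def nat_int)
      moreover have "\<Phi> s' = w n + (\<Sum>c\<in>{Suc n..<m}. w c)"
        using J split by (simp add: \<Phi>_def J_def)
      ultimately show "(\<exists>n\<le>m. J n s'') \<and> \<Phi> s'' + t < \<Phi> s'"
        using * n by (auto intro: exI[of _ "Suc n"])
    qed
  next
    fix s' t assume "\<exists>n\<le>m. J n s'" and fr: "frame (While ?b emit_cell) ?s0 s'"
      and b: "\<not> bval ?b s'" and t: "t + \<Phi> s' \<le> \<Phi> ?s0 + 1"
    then obtain n where J: "J n s'" "n \<le> m" by blast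
    have "scal s' ''m'' = int m"
      using frame_scal[OF fr, of "''m''"] m by (simp add: emit_cell_def copy_def)
    hence "n = m" using b J by (simp add: J_def)
    moreover have "\<Phi> ?s0 = (\<Sum>c<m. w c)" by (simp add: \<Phi>_def lessThan_atLeast0)
    ultimately show "t + 2 \<le> (\<Sum>c<m. w c) + 3 \<and> J m s'" using J t by simp
  qed
  hence "wp (While ?b emit_cell) ?s0 (\<lambda>t s'. Suc (Suc t) \<le> (\<Sum>c<m. w c) + 3 \<and>
     stores s' ''numS'' ''S'' (selected ts f m) \<and> stores s' ''numS2'' ''S2'' (selected us g m) \<and>
     (\<forall>c<m. arr s' ''tflow'' (int c) = int (f c) \<and> arr s' ''cflow'' (int c) = int (g c)))"
    by (rule wp_conseq) (simp add: J_def)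
  thus ?thesis unfolding emit_def w_def by simp
qed

section \<open>Flows and selections of an FBS instance\<close>

locale fbs =
  fixes I :: fbs_instance
  assumes valid: "valid_instance I"
begin

declare One_nat_def [simp del]

abbreviation net where "net \<equiv> fbs_network I"

definition tcell :: "nat \<times> nat \<Rightarrow> nat set" where
  "tcell c = tpart I 1 (fst c) \<inter> tpart I 2 (snd c)"

definition ccell :: "nat \<times> nat \<Rightarrow> nat set" where
  "ccell c = cpart I 1 (fst c) \<inter> cpart I 2 (snd c)"

definition tarc :: "nat \<times> nat \<Rightarrow> (nat \<times> nat) \<times> (nat \<times> nat)" where
  "tarc c = ((1, fst c), (2, snd c))"

definition carc :: "nat \<times> nat \<Rightarrow> (nat \<times> nat) \<times> (nat \<times> nat)" where
  "carc c = ((2, snd c), (1, fst c))"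

text \<open>The flow of a cell through an arc that the network may lack.\<close>

definition tval :: "((nat \<times> nat) \<times> (nat \<times> nat) \<Rightarrow> real) \<Rightarrow> nat \<times> nat \<Rightarrow> real" where
  "tval f c = (if tcell c = {} then 0 else f (tarc c))"

definition cval :: "((nat \<times> nat) \<times> (nat \<times> nat) \<Rightarrow> real) \<Rightarrow> nat \<times> nat \<Rightarrow> real" where
  "cval f c = (if ccell c = {} then 0 else f (carc c))"

lemma finite_samples: "finite (treated I)" "finite (control I)"
  using valid by (auto simp: valid_instance_def)

lemma finite_cells [simp]: "finite (tcell c)" "finite (ccell c)"
  using finite_samples by (auto simp: tcell_def ccell_def tpart_def cpart_def)

lemma cells_eq: "cells I = {c. tcell c \<noteq> {} \<or> ccell c \<noteq> {}}"
  by (auto simp: cells_def tcell_def ccell_def)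

lemma cells_levels: "cells I \<subseteq> {1..levels I 1} \<times> {1..levels I 2}"
  using valid by (auto simp: cells_def valid_instance_def tpart_def cpart_def)

lemma finite_cells_set [simp]: "finite (cells I)"
  by (rule finite_subset[OF cells_levels]) simp

text \<open>Indexing the arcs by cells brings every flow sum over a finite common index set, shared
  with the listing that the machine receives.\<close>

lemma arcs_eq: "arcs net = tarc ` {c\<in>cells I. tcell c \<noteq> {}} \<union> carc ` {c\<in>cells I. ccell c \<noteq> {}}"
proof -
  have "arcs net = {tarc (i, j) | i j. tcell (i, j) \<noteq> {}} \<union> {carc (i, j) | i j. ccell (i, j) \<noteq> {}}"
    by (simp add: fbs_network_def tcell_def ccell_def tarc_def carc_def)
  also have "{tarc (i, j) | i j. tcell (i, j) \<noteq> {}} = tarc ` {c. tcell c \<noteq> {}}" by auto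
  also have "{carc (i, j) | i j. ccell (i, j) \<noteq> {}} = carc ` {c. ccell c \<noteq> {}}" by auto
  also have "{c. tcell c \<noteq> {}} = {c\<in>cells I. tcell c \<noteq> {}}" by (auto simp: cells_eq)
  also have "{c. ccell c \<noteq> {}} = {c\<in>cells I. ccell c \<noteq> {}}" by (auto simp: cells_eq)
  finally show ?thesis .
qed

lemma cost_arcs [simp]: "cost net (tarc c) = - 1" "cost net (carc c) = 0"
  by (simp_all add: fbs_network_def tarc_def carc_def)

lemma capacity_arcs [simp]:
  "capacity net (tarc c) = real (card (tcell c))" "capacity net (carc c) = real (card (ccell c))"
  by (simp_all add: fbs_network_def tcell_def ccell_def tarc_def carc_def)

lemma sum_arcs_net:
  "(\<Sum>a\<in>{a\<in>arcs net. P a}. g a) =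
    (\<Sum>c\<in>cells I. (if tcell c \<noteq> {} \<and> P (tarc c) then g (tarc c) else 0) +
                  (if ccell c \<noteq> {} \<and> P (carc c) then g (carc c) else 0))"
proof -
  let ?T = "{c\<in>cells I. tcell c \<noteq> {} \<and> P (tarc c)}"
    and ?C = "{c\<in>cells I. ccell c \<noteq> {} \<and> P (carc c)}"
  have "{a\<in>arcs net. P a} = tarc ` ?T \<union> carc ` ?C" unfolding arcs_eq by auto
  moreover have "tarc ` ?T \<inter> carc ` ?C = {}" by (auto simp: tarc_def carc_def)
  moreover have "inj_on tarc ?T" "inj_on carc ?C"
    by (auto simp: inj_on_def tarc_def carc_def prod_eq_iff)
  ultimately have "(\<Sum>a\<in>{a\<in>arcs net. P a}. g a) = (\<Sum>c\<in>?T. g (tarc c)) + (\<Sum>c\<in>?C. g (carc c))"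
    by (simp add: sum.union_disjoint sum.reindex)
  thus ?thesis by (simp add: sum.inter_filter sum.distrib)
qed

text \<open>With absent arcs read as 0, conservation at a level becomes a sum over its row or column
  of cells. At column nodes the sign is reversed, which is harmless for an equation with 0.\<close>

lemma feasible_flow_iff:
  "feasible_flow net f \<longleftrightarrow>
    (\<forall>c\<in>cells I. 0 \<le> tval f c \<and> tval f c \<le> real (card (tcell c)) \<and>
                 0 \<le> cval f c \<and> cval f c \<le> real (card (ccell c))) \<and>
    (\<forall>i\<in>{1..levels I 1}. (\<Sum>c\<in>cells I. if fst c = i then tval f c - cval f c else 0) = 0) \<and>
    (\<forall>j\<in>{1..levels I 2}. (\<Sum>c\<in>cells I. if snd c = j then tval f c - cval f c else 0) = 0)"
proof -
  have bounds: "(\<forall>a\<in>arcs net. 0 \<le> f a \<and> f a \<le> capacity net a) \<longleftrightarrow>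
    (\<forall>c\<in>cells I. 0 \<le> tval f c \<and> tval f c \<le> real (card (tcell c)) \<and>
                 0 \<le> cval f c \<and> cval f c \<le> real (card (ccell c)))"
  proof -
    have t: "(0 \<le> tval f c \<and> tval f c \<le> real (card (tcell c))) \<longleftrightarrow>
        (tcell c \<noteq> {} \<longrightarrow> 0 \<le> f (tarc c) \<and> f (tarc c) \<le> capacity net (tarc c))" for c
      by (simp add: tval_def)
    have u: "(0 \<le> cval f c \<and> cval f c \<le> real (card (ccell c))) \<longleftrightarrow>
        (ccell c \<noteq> {} \<longrightarrow> 0 \<le> f (carc c) \<and> f (carc c) \<le> capacity net (carc c))" for c
      by (simp add: cval_def)
    have "(\<forall>a\<in>arcs net. 0 \<le> f a \<and> f a \<le> capacity net a) \<longleftrightarrow> (\<forall>c\<in>cells I.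
        (tcell c \<noteq> {} \<longrightarrow> 0 \<le> f (tarc c) \<and> f (tarc c) \<le> capacity net (tarc c)) \<and>
        (ccell c \<noteq> {} \<longrightarrow> 0 \<le> f (carc c) \<and> f (carc c) \<le> capacity net (carc c)))"
      unfolding arcs_eq ball_Un by blast
    thus ?thesis unfolding t[symmetric] u[symmetric] conj_assoc .
  qed
  have 1: "(\<Sum>a\<in>{a\<in>arcs net. fst a = (1, i)}. f a) - (\<Sum>a\<in>{a\<in>arcs net. snd a = (1, i)}. f a)
      = (\<Sum>c\<in>cells I. if fst c = i then tval f c - cval f c else 0)" for i
    unfolding sum_arcs_net sum_subtractf[symmetric]
    by (rule sum.cong) (auto simp: tval_def cval_def tarc_def carc_def)
  have 2: "(\<Sum>a\<in>{a\<in>arcs net. fst a = (2, j)}. f a) - (\<Sum>a\<in>{a\<in>arcs net. snd a = (2, j)}. f a)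
      = - (\<Sum>c\<in>cells I. if snd c = j then tval f c - cval f c else 0)" for j
    unfolding sum_arcs_net sum_subtractf[symmetric] sum_negf[symmetric]
    by (rule sum.cong) (auto simp: tval_def cval_def tarc_def carc_def)
  have nodes: "(\<forall>v\<in>nodes net. P v) \<longleftrightarrow>
      (\<forall>i\<in>{1..levels I 1}. P (1, i)) \<and> (\<forall>j\<in>{1..levels I 2}. P (2, j))" for P
    by (auto simp: fbs_network_def)
  have "balance net = (\<lambda>_. 0)" by (simp add: fbs_network_def)
  thus ?thesis
    unfolding feasible_flow_def bounds nodes 1 2 by simp
qed

lemma flow_cost_eq: "flow_cost net f = - (\<Sum>c\<in>cells I. tval f c)"
proof -
  have "flow_cost net f = (\<Sum>a\<in>{a\<in>arcs net. True}. cost net a * f a)"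
    by (simp add: flow_cost_def)
  also have "\<dots> = - (\<Sum>c\<in>cells I. tval f c)"
    unfolding sum_arcs_net sum_negf[symmetric] by (rule sum.cong) (auto simp: tval_def)
  finally show ?thesis .
qed

section \<open>Selections as integral flows\<close>

abbreviation sel where "sel \<equiv> selection_flow I"

lemma sel_arcs [simp]:
  "sel S S' (tarc c) = real (card (S \<inter> tcell c))" "sel S S' (carc c) = real (card (S' \<inter> ccell c))"
  by (simp_all add: selection_flow_def tcell_def ccell_def tarc_def carc_def)

lemma tval_sel [simp]: "tval (sel S S') c = real (card (S \<inter> tcell c))"
  and cval_sel [simp]: "cval (sel S S') c = real (card (S' \<inter> ccell c))"
  by (auto simp: tval_def cval_def)

lemma treated_in_cell: "s \<in> treated I \<Longrightarrow> s \<in> tcell (tlevel I 1 s, tlevel I 2 s)"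
  by (simp add: tcell_def tpart_def)

lemma control_in_cell: "s \<in> control I \<Longrightarrow> s \<in> ccell (clevel I 1 s, clevel I 2 s)"
  by (simp add: ccell_def cpart_def)

lemma tcell_mem: "s \<in> tcell c \<longleftrightarrow> s \<in> treated I \<and> c = (tlevel I 1 s, tlevel I 2 s)"
  by (auto simp: tcell_def tpart_def prod_eq_iff)

lemma ccell_mem: "s \<in> ccell c \<longleftrightarrow> s \<in> control I \<and> c = (clevel I 1 s, clevel I 2 s)"
  by (auto simp: ccell_def cpart_def prod_eq_iff)

lemma cells_mem_t: "s \<in> treated I \<Longrightarrow> (tlevel I 1 s, tlevel I 2 s) \<in> cells I"
  using treated_in_cell unfolding cells_eq by blast

lemma cells_mem_c: "s \<in> control I \<Longrightarrow> (clevel I 1 s, clevel I 2 s) \<in> cells I"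
  using control_in_cell unfolding cells_eq by blast

lemma sum_card_tcell:
  assumes "A = (\<Union>c\<in>{c\<in>cells I. P c}. S \<inter> tcell c)"
  shows "(\<Sum>c\<in>cells I. if P c then card (S \<inter> tcell c) else 0) = card A"
proof -
  have "card A = (\<Sum>c\<in>{c\<in>cells I. P c}. card (S \<inter> tcell c))"
    unfolding assms by (rule card_UN_disjoint) (auto simp: tcell_mem)
  thus ?thesis by (simp add: sum.inter_filter)
qed

lemma sum_card_ccell:
  assumes "A = (\<Union>c\<in>{c\<in>cells I. P c}. S \<inter> ccell c)"
  shows "(\<Sum>c\<in>cells I. if P c then card (S \<inter> ccell c) else 0) = card A"
proof -
  have "card A = (\<Sum>c\<in>{c\<in>cells I. P c}. card (S \<inter> ccell c))"
    unfolding assms by (rule card_UN_disjoint) (auto simp: ccell_mem)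
  thus ?thesis by (simp add: sum.inter_filter)
qed

lemma sum_card_levels:
  "(\<Sum>c\<in>cells I. if fst c = i then card (S \<inter> tcell c) else 0) = card (S \<inter> tpart I 1 i)"
  "(\<Sum>c\<in>cells I. if snd c = i then card (S \<inter> tcell c) else 0) = card (S \<inter> tpart I 2 i)"
  "(\<Sum>c\<in>cells I. if fst c = i then card (S \<inter> ccell c) else 0) = card (S \<inter> cpart I 1 i)"
  "(\<Sum>c\<in>cells I. if snd c = i then card (S \<inter> ccell c) else 0) = card (S \<inter> cpart I 2 i)"
  by (rule sum_card_tcell sum_card_ccell;
      force simp: tcell_mem ccell_mem tpart_def cpart_def intro: cells_mem_t cells_mem_c)+

lemma sum_card_cells:
  "S \<subseteq> treated I \<Longrightarrow> (\<Sum>c\<in>cells I. card (S \<inter> tcell c)) = card S"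
  "S \<subseteq> control I \<Longrightarrow> (\<Sum>c\<in>cells I. card (S \<inter> ccell c)) = card S"
proof -
  show "(\<Sum>c\<in>cells I. card (S \<inter> tcell c)) = card S" if "S \<subseteq> treated I"
    using sum_card_tcell[where A = S and P = "\<lambda>_. True" and S = S] that cells_mem_t by (force simp: tcell_mem)
  show "(\<Sum>c\<in>cells I. card (S \<inter> ccell c)) = card S" if "S \<subseteq> control I"
    using sum_card_ccell[where A = S and P = "\<lambda>_. True" and S = S] that cells_mem_c by (force simp: ccell_mem)
qed

lemma feasible_sel_iff:
  assumes "S \<subseteq> treated I" "S' \<subseteq> control I"
  shows "feasible_flow net (sel S S') \<longleftrightarrow> fbs_feasible I S S'"
proof -
  have diff: "(\<Sum>c\<in>X. if P c then real (a c) - real (b c) else 0)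
      = real (\<Sum>c\<in>X. if P c then a c else 0) - real (\<Sum>c\<in>X. if P c then b c else 0)"
    for X :: "(nat \<times> nat) set" and P a b
    unfolding of_nat_sum sum_subtractf[symmetric] by (rule sum.cong) auto
  have "card (S \<inter> tcell c) \<le> card (tcell c)" "card (S' \<inter> ccell c) \<le> card (ccell c)" for c
    by (auto intro: card_mono)
  thus ?thesis
    using assms unfolding feasible_flow_iff tval_sel cval_sel diff sum_card_levels
    by (simp add: fbs_feasible_def fine_balance_def)
qed

lemma flow_cost_sel: "S \<subseteq> treated I \<Longrightarrow> flow_cost net (sel S S') = - real (card S)"
  by (simp add: flow_cost_eq sum_card_cells flip: of_nat_sum)

lemma min_cost_imp_optimal:
  assumes "S \<subseteq> treated I" "S' \<subseteq> control I" "min_cost_flow net (sel S S')"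
  shows "fbs_optimal I S S'"
proof -
  have "card R \<le> card S" if R: "fbs_feasible I R R'" for R R'
  proof -
    have sub: "R \<subseteq> treated I" "R' \<subseteq> control I" using R by (auto simp: fbs_feasible_def)
    hence "flow_cost net (sel S S') \<le> flow_cost net (sel R R')"
      using assms(3) R by (simp add: min_cost_flow_def feasible_sel_iff)
    thus ?thesis using sub assms by (simp add: flow_cost_sel)
  qed
  thus ?thesis
    using assms by (simp add: fbs_optimal_def min_cost_flow_def feasible_sel_iff)
qed

text \<open>Functions representing flows are arbitrary off the arcs; \<open>tval\<close> and
  \<open>cval\<close> never look there.\<close>

lemma min_cost_flow_cong:
  assumes "\<And>a. a \<in> arcs net \<Longrightarrow> f a = g a"
  shows "min_cost_flow net f \<longleftrightarrow> min_cost_flow net g"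
proof -
  have eq: "tval f c = tval g c" "cval f c = cval g c" for c
    using assms by (auto simp: tval_def cval_def arcs_eq cells_eq)
  have "feasible_flow net f \<longleftrightarrow> feasible_flow net g" "flow_cost net f = flow_cost net g"
    unfolding feasible_flow_iff flow_cost_eq eq by simp_all
  thus ?thesis by (simp add: min_cost_flow_def)
qed

text \<open>Each cell has enough samples for a subset of the size prescribed by the flow. Cells are
  disjoint, so the union of these subsets meets every cell in exactly the chosen one.\<close>

lemma integral_min_cost_flow:
  assumes f: "min_cost_flow net f" "\<forall>a\<in>arcs net. f a \<in> \<int>"
  shows "\<exists>S S'. fbs_optimal I S S' \<and> (\<forall>a\<in>arcs net. sel S S' a = f a)"
proof -
  have bounds: "0 \<le> tval f c \<and> tval f c \<le> real (card (tcell c)) \<and>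
      0 \<le> cval f c \<and> cval f c \<le> real (card (ccell c))" if "c \<in> cells I" for c
    using f(1) that by (simp add: min_cost_flow_def feasible_flow_iff)
  have int: "tval f c \<in> \<int>" "cval f c \<in> \<int>" if "c \<in> cells I" for c
    using f(2) that by (auto simp: tval_def cval_def arcs_eq)
  have "\<exists>A\<subseteq>tcell c. real (card A) = tval f c" if c: "c \<in> cells I" for c
  proof -
    obtain n where "tval f c = real n"
      using int(1)[OF c] bounds[OF c] by (metis Ints_cases of_int_0_le_iff of_nat_nat of_int_of_nat_eq)
    thus ?thesis using bounds[OF c] obtain_subset_with_card_n[of n "tcell c"] by auto
  qed
  then obtain A where A: "\<And>c. c \<in> cells I \<Longrightarrow> A c \<subseteq> tcell c \<and> real (card (A c)) = tval f c"
    by metis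
  have "\<exists>B\<subseteq>ccell c. real (card B) = cval f c" if c: "c \<in> cells I" for c
  proof -
    obtain n where "cval f c = real n"
      using int(2)[OF c] bounds[OF c] by (metis Ints_cases of_int_0_le_iff of_nat_nat of_int_of_nat_eq)
    thus ?thesis using bounds[OF c] obtain_subset_with_card_n[of n "ccell c"] by auto
  qed
  then obtain B where B: "\<And>c. c \<in> cells I \<Longrightarrow> B c \<subseteq> ccell c \<and> real (card (B c)) = cval f c"
    by metis
  define S where "S = (\<Union>c\<in>cells I. A c)"
  define S' where "S' = (\<Union>c\<in>cells I. B c)"
  have memA: "s \<in> treated I \<and> c = (tlevel I 1 s, tlevel I 2 s)"
    if "c \<in> cells I" "s \<in> A c" for s c using A that tcell_mem by blast
  have memB: "s \<in> control I \<and> c = (clevel I 1 s, clevel I 2 s)"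
    if "c \<in> cells I" "s \<in> B c" for s c using B that ccell_mem by blast
  have ST: "S \<inter> tcell c = A c" "S' \<inter> ccell c = B c" if c: "c \<in> cells I" for c
  proof -
    have "A c' = A c" if "c' \<in> cells I" "s \<in> A c'" "s \<in> tcell c" for s c'
      using memA[OF that(1,2)] that(3) by (simp add: tcell_mem)
    thus "S \<inter> tcell c = A c" using A[OF c] c unfolding S_def by blast
    have "B c' = B c" if "c' \<in> cells I" "s \<in> B c'" "s \<in> ccell c" for s c'
      using memB[OF that(1,2)] that(3) by (simp add: ccell_mem)
    thus "S' \<inter> ccell c = B c" using B[OF c] c unfolding S'_def by blast
  qed
  have sub: "S \<subseteq> treated I" "S' \<subseteq> control I"
    using memA memB unfolding S_def S'_def by blast+
  have eq: "sel S S' a = f a" if a: "a \<in> arcs net" for a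
  proof -
    consider c where "c \<in> cells I" "tcell c \<noteq> {}" "a = tarc c"
      | c where "c \<in> cells I" "ccell c \<noteq> {}" "a = carc c"
      using a unfolding arcs_eq by blast
    thus ?thesis
    proof cases
      case 1
      hence "real (card (A c)) = f (tarc c)" using A by (simp add: tval_def)
      thus ?thesis using 1 ST by simp
    next
      case 2
      hence "real (card (B c)) = f (carc c)" using B by (simp add: cval_def)
      thus ?thesis using 2 ST by simp
    qed
  qed
  hence "min_cost_flow net (sel S S')" using f(1) min_cost_flow_cong by blast
  thus ?thesis using min_cost_imp_optimal[OF sub] eq by blast
qed

text \<open>Each cell lies in exactly one row, so adding up conservation over the rows counts it
  once. This is what bounds the number of control samples written by that of treatment
  samples.\<close>

lemma sum_tval_eq_sum_cval:
  assumes "feasible_flow net f"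
  shows "(\<Sum>c\<in>cells I. tval f c) = (\<Sum>c\<in>cells I. cval f c)"
proof -
  have "(\<Sum>c\<in>cells I. tval f c - cval f c)
      = (\<Sum>c\<in>cells I. \<Sum>i\<in>{1..levels I 1}. if fst c = i then tval f c - cval f c else 0)"
    using cells_levels by (intro sum.cong) auto
  also have "\<dots> = (\<Sum>i\<in>{1..levels I 1}. \<Sum>c\<in>cells I. if fst c = i then tval f c - cval f c else 0)"
    by (rule sum.swap)
  also have "\<dots> = 0" using assms by (simp add: feasible_flow_iff)
  finally show ?thesis by (simp add: sum_subtractf)
qed

lemma ex_listing: "\<exists>cs ts us. cell_listing I cs ts us"
proof -
  obtain cs where cs: "distinct cs" "set cs = cells I"
    using finite_distinct_list finite_cells_set by blast
  have "cell_listing I cs (map (\<lambda>c. sorted_list_of_set (tcell c)) cs)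
    (map (\<lambda>c. sorted_list_of_set (ccell c)) cs)"
    using cs by (simp add: cell_listing_def split_beta flip: tcell_def ccell_def)
  thus ?thesis by blast
qed

end

section \<open>Correctness and running time of the program\<close>

lemma selected_spec:
  assumes dist: "\<And>c. c < m \<Longrightarrow> distinct (xss ! c)"
    and disj: "\<And>c d. c < m \<Longrightarrow> d < m \<Longrightarrow> c \<noteq> d \<Longrightarrow> set (xss ! c) \<inter> set (xss ! d) = {}"
    and f: "\<And>c. c < m \<Longrightarrow> f c \<le> length (xss ! c)"
  shows "distinct (selected xss f m)"
    and "set (selected xss f m) \<subseteq> (\<Union>c<m. set (xss ! c))"
    and "c < m \<Longrightarrow> card (set (selected xss f m) \<inter> set (xss ! c)) = f c"
proof -
  have set: "set (selected xss f n) = (\<Union>c<n. set (take (f c) (xss ! c)))" for n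
    by (auto simp: selected_def)
  show "set (selected xss f m) \<subseteq> (\<Union>c<m. set (xss ! c))"
    using set_take_subset unfolding set by fastforce
  have "distinct (selected xss f n)" if "n \<le> m" for n
    using that
  proof (induction n)
    case (Suc n)
    have "set (xss ! c) \<inter> set (xss ! n) = {}" if "c < n" for c
      using disj that Suc.prems by simp
    hence "set (selected xss f n) \<inter> set (take (f n) (xss ! n)) = {}"
      unfolding set using set_take_subset by fastforce
    thus ?case using Suc dist[of n] by (simp add: selected_Suc)
  qed (simp add: selected_def)
  thus "distinct (selected xss f m)" by simp
  show "card (set (selected xss f m) \<inter> set (xss ! c)) = f c" if c: "c < m"
  proof -
    have "x \<in> set (take (f c) (xss ! c))"
      if "d < m" "x \<in> set (take (f d) (xss ! d))" "x \<in> set (xss ! c)" for d x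
      using disj[OF that(1) c] that(2,3) set_take_subset[of "f d" "xss ! d"] by (cases "d = c") auto
    hence "set (selected xss f m) \<inter> set (xss ! c) = set (take (f c) (xss ! c))"
      unfolding set using c set_take_subset[of "f c" "xss ! c"] by auto
    thus ?thesis using f[OF c] dist[OF c] by (simp add: distinct_card)
  qed
qed

definition fbs_program :: com where
  "fbs_program = (build ;; solve) ;; emit"

section \<open>A listed instance as a network of cells\<close>

locale fbs_listing = fbs +
  fixes cs :: "(nat \<times> nat) list" and ts us :: "nat list list"
  assumes listing: "cell_listing I cs ts us"
begin

abbreviation "l1 \<equiv> levels I 1"
abbreviation "l2 \<equiv> levels I 2"

lemma cs: "distinct cs" "set cs = cells I" "length ts = length cs" "length us = length cs"
  using listing by (auto simp: cell_listing_def)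

lemma ts: "c < length cs \<Longrightarrow> distinct (ts ! c)" "c < length cs \<Longrightarrow> set (ts ! c) = tcell (cs ! c)"
  and us: "c < length cs \<Longrightarrow> distinct (us ! c)" "c < length cs \<Longrightarrow> set (us ! c) = ccell (cs ! c)"
  using listing by (auto simp: cell_listing_def tcell_def ccell_def split_beta)

lemma cs_levels:
  "c < length cs \<Longrightarrow> 1 \<le> fst (cs ! c) \<and> fst (cs ! c) \<le> l1 \<and> 1 \<le> snd (cs ! c) \<and> snd (cs ! c) \<le> l2"
  using cells_levels nth_mem[of c cs] cs(2) by (auto simp: mem_Times_iff)

lemma lengths:
  "c < length cs \<Longrightarrow> length (ts ! c) = card (tcell (cs ! c))"
  "c < length cs \<Longrightarrow> length (us ! c) = card (ccell (cs ! c))"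
  using distinct_card[OF ts(1)] distinct_card[OF us(1)] ts(2) us(2) by auto

lemma sum_cells: "(\<Sum>c\<in>cells I. g c) = (\<Sum>c<length cs. g (cs ! c))"
  using sum.reindex_bij_betw[OF bij_betw_nth[OF cs(1) refl cs(2)[symmetric]], of g] by simp

sublocale cell_network "length cs" "int l1 + int l2" "int l1" "\<lambda>c. int (fst (cs ! c))"
  "\<lambda>c. int l1 + int (snd (cs ! c))" "\<lambda>c. int (length (ts ! c))" "\<lambda>c. int (length (us ! c))"
proof
  fix c assume "c < length cs"
  from cs_levels[OF this]
  show "1 \<le> int (fst (cs ! c)) \<and> int (fst (cs ! c)) \<le> int l1"
    "int l1 < int l1 + int (snd (cs ! c)) \<and> int l1 + int (snd (cs ! c)) \<le> int l1 + int l2"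
    by auto
qed auto

lemma excess_row:
  assumes "i \<in> {1..l1}"
  shows "excess (flow_res f g) (int i)
    = - (\<Sum>c<length cs. if fst (cs ! c) = i then f c - g c else 0)"
  unfolding excess_flow_res sum_negf[symmetric]
proof (rule sum.cong)
  fix c assume "c \<in> {..<length cs}"
  hence "int l1 + int (snd (cs ! c)) \<noteq> int i" using assms cs_levels[of c] by auto
  thus "(if int l1 + int (snd (cs ! c)) = int i then f c - g c else 0) -
      (if int (fst (cs ! c)) = int i then f c - g c else 0) =
      - (if fst (cs ! c) = i then f c - g c else 0)" by simp
qed simp

lemma excess_col:
  assumes "j \<in> {1..l2}"
  shows "excess (flow_res f g) (int l1 + int j)
    = (\<Sum>c<length cs. if snd (cs ! c) = j then f c - g c else 0)"
  unfolding excess_flow_res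
proof (rule sum.cong)
  fix c assume "c \<in> {..<length cs}"
  hence "int (fst (cs ! c)) \<noteq> int l1 + int j" using assms cs_levels[of c] by auto
  thus "(if int l1 + int (snd (cs ! c)) = int l1 + int j then f c - g c else 0) -
      (if int (fst (cs ! c)) = int l1 + int j then f c - g c else 0) =
      (if snd (cs ! c) = j then f c - g c else 0)" by simp
qed simp

text \<open>The bridge between real flows of the FBS network and residual capacities of the machine:
  row levels are the nodes up to \<open>l1\<close>, column levels follow after a shift by
  \<open>l1\<close>.\<close>

lemma feasible_flow_net_iff:
  "feasible_flow net h \<longleftrightarrow>
    (\<forall>c<length cs. 0 \<le> tval h (cs ! c) \<and> tval h (cs ! c) \<le> real_of_int (int (length (ts ! c))) \<and>
                  0 \<le> cval h (cs ! c) \<and> cval h (cs ! c) \<le> real_of_int (int (length (us ! c)))) \<and>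
    (\<forall>v\<in>{1..int l1 + int l2}. excess (flow_res (\<lambda>c. tval h (cs ! c)) (\<lambda>c. cval h (cs ! c))) v = 0)"
proof -
  have "(\<forall>c\<in>cells I. P c) \<longleftrightarrow> (\<forall>c<length cs. P (cs ! c))" for P
    unfolding cs(2)[symmetric] by (auto simp: all_set_conv_all_nth)
  moreover have "(\<forall>v\<in>{1..int l1 + int l2}. P v) \<longleftrightarrow>
      (\<forall>i\<in>{1..l1}. P (int i)) \<and> (\<forall>j\<in>{1..l2}. P (int l1 + int j))" for P
  proof (intro iffI conjI ballI)
    fix v assume P: "(\<forall>i\<in>{1..l1}. P (int i)) \<and> (\<forall>j\<in>{1..l2}. P (int l1 + int j))"
      and v: "v \<in> {1..int l1 + int l2}"
    show "P v"
    proof (cases "v \<le> int l1")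
      case True
      hence "nat v \<in> {1..l1}" "v = int (nat v)" using v by auto
      thus ?thesis using P by metis
    next
      case False
      hence "nat (v - int l1) \<in> {1..l2}" "v = int l1 + int (nat (v - int l1))" using v by auto
      thus ?thesis using P by metis
    qed
  qed auto
  ultimately show ?thesis
    by (simp add: feasible_flow_iff sum_cells lengths excess_row excess_col)
qed

lemma card_treated: "card (treated I) = (\<Sum>c<length cs. length (ts ! c))"
proof -
  have "card (treated I) = (\<Sum>c\<in>cells I. card (treated I \<inter> tcell c))"
    by (rule sum_card_cells(1)[symmetric]) simp
  also have "\<dots> = (\<Sum>c\<in>cells I. card (tcell c))"
    by (intro sum.cong arg_cong[of _ _ card]) (auto simp: tcell_mem)
  finally show ?thesis by (simp add: sum_cells lengths)
qed

lemma input_input_state: "input (input_state I cs ts us)"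
proof -
  have off: "array_of (offsets xss) (int c + 1) - array_of (offsets xss) (int c) = int (length (xss ! c))"
    if "c < length xss" for c and xss :: "nat list list"
  proof -
    have "int c + 1 = int (Suc c)" by simp
    thus ?thesis
      using that by (simp only: array_of_offsets Suc_leI less_imp_le)
        (simp add: take_Suc_conv_app_nth)
  qed
  have "array_of (offsets ts) (int (length cs)) = int (\<Sum>c<length cs. length (ts ! c))"
    using cs(3) array_of_offsets[of "length cs" ts]
    by (simp add: length_concat sum_list_sum_nth lessThan_atLeast0)
  moreover have "array_of (map p cs) (int c) = int (p (cs ! c))" if "c < length cs"
    for p :: "nat \<times> nat \<Rightarrow> nat" and c
    using that by (simp add: array_of_def)
  ultimately show ?thesis
    using cs by (simp add: input_def input_state_def off)
qed

text \<open>The dual certificate is integral, but \<open>optimal_flow\<close> is applied at type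
  \<open>real\<close>. The selection therefore beats every feasible real flow.\<close>

lemma selection_correct:
  assumes r: "residual r" "rc_nonneg r \<pi>" "\<forall>v\<in>{1..int l1 + int l2}. excess r v = 0"
    and S: "S \<subseteq> treated I" "\<And>c. c < length cs \<Longrightarrow> int (card (S \<inter> tcell (cs ! c))) = r (4 * int c + 3)"
    and S': "S' \<subseteq> control I" "\<And>c. c < length cs \<Longrightarrow> int (card (S' \<inter> ccell (cs ! c))) = r (4 * int c + 2)"
  shows "min_cost_flow net (sel S S')"
proof -
  have rS: "real (card (S \<inter> tcell (cs ! c))) = real_of_int (r (4 * int c + 3))"
    "real (card (S' \<inter> ccell (cs ! c))) = real_of_int (r (4 * int c + 2))" if "c < length cs" for c
    using S(2)[OF that] S'(2)[OF that] by (metis of_int_of_nat_eq)+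
  have ex: "excess (flow_res (\<lambda>c. tval (sel S S') (cs ! c)) (\<lambda>c. cval (sel S S') (cs ! c))) v
      = real_of_int (excess r v)" for v
    unfolding excess_flow_res excess_residual[OF r(1)] of_int_sum
    by (rule sum.cong) (auto simp: rS)
  have feas: "feasible_flow net (sel S S')"
    unfolding feasible_flow_net_iff ex
  proof (intro conjI allI impI)
    fix c assume c: "c < length cs"
    show "0 \<le> tval (sel S S') (cs ! c)" "0 \<le> cval (sel S S') (cs ! c)" by simp_all
    show "tval (sel S S') (cs ! c) \<le> real_of_int (int (length (ts ! c)))"
      "cval (sel S S') (cs ! c) \<le> real_of_int (int (length (us ! c)))"
      using residual_bounds[OF r(1) c] c by (simp_all add: rS)
  qed (use r(3) in simp)
  have "flow_cost net (sel S S') \<le> flow_cost net h" if h: "feasible_flow net h" for h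
  proof -
    have "(\<Sum>c<length cs. tval h (cs ! c)) \<le> real_of_int (\<Sum>c<length cs. r (4 * int c + 3))"
      by (rule optimal_flow[where g = "\<lambda>c. cval h (cs ! c)" and \<pi> = \<pi>])
        (use h r in \<open>auto simp: feasible_flow_net_iff\<close>)
    also have "\<dots> = (\<Sum>c<length cs. tval (sel S S') (cs ! c))"
      by (simp add: rS)
    finally show ?thesis by (simp add: flow_cost_eq sum_cells)
  qed
  thus ?thesis using feas by (simp add: min_cost_flow_def)
qed

text \<open>The constants add up those of \<open>wp_build_solve\<close> and \<open>wp_emit\<close>:
  53 = 42 + 11 per cell, 8 = 4 + 4 per treatment sample for the two copies, and 7 = 4 + 3.\<close>

lemma wp_fbs_program:
  "wp fbs_program (input_state I cs ts us) (\<lambda>t s'. \<exists>S S'. S \<subseteq> treated I \<and> S' \<subseteq> control I \<and>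
     t \<le> (24 * (l1 + l2 + 4 * length cs) + 14) * (2 * card (treated I)) + 53 * length cs +
          8 * card (treated I) + 7 \<and>
     holds_set s' ''numS'' ''S'' S \<and> holds_set s' ''numS2'' ''S2'' S' \<and>
     holds_flow s' cs (sel S S') \<and> min_cost_flow net (sel S S'))"
proof -
  let ?s = "input_state I cs ts us" and ?m = "length cs"
  let ?B = "(24 * (l1 + l2 + 4 * ?m) + 14) * (2 * card (treated I))"
  have n: "int (card (treated I)) = (\<Sum>c<?m. int (length (ts ! c)))"
    by (simp add: card_treated)
  have "wp (build ;; solve) ?s (\<lambda>t s'. t \<le> (24 * (nat (int l1 + int l2) + 4 * ?m) + 14) * (2 * card (treated I)) + 42 * ?m + 4 \<and>
     residual (arr s' ''res'') \<and> (\<exists>\<pi>. rc_nonneg (arr s' ''res'') \<pi>) \<and>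
     (\<forall>v\<in>{1..int l1 + int l2}. excess (arr s' ''res'') v = 0))"
    by (rule wp_build_solve[OF input_input_state]) (simp_all add: input_state_def n)
  thus ?thesis
    unfolding fbs_program_def wp_simps(4)[of "build ;; solve"]
  proof (rule wp_conseq)
    fix t1 s1
    assume 1: "t1 \<le> (24 * (nat (int l1 + int l2) + 4 * ?m) + 14) * (2 * card (treated I)) + 42 * ?m + 4 \<and>
      residual (arr s1 ''res'') \<and> (\<exists>\<pi>. rc_nonneg (arr s1 ''res'') \<pi>) \<and>
      (\<forall>v\<in>{1..int l1 + int l2}. excess (arr s1 ''res'') v = 0)"
      and fr: "frame (build ;; solve) ?s s1"
    let ?r = "arr s1 ''res''"
    have r: "residual ?r" "\<forall>v\<in>{1..int l1 + int l2}. excess ?r v = 0" using 1 by auto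
    obtain \<pi> where \<pi>: "rc_nonneg ?r \<pi>" using 1 by auto
    define f where "f c = nat (?r (4 * int c + 3))" for c
    define g where "g c = nat (?r (4 * int c + 2))" for c
    have fg: "?r (4 * int c + 3) = int (f c) \<and> f c \<le> length (ts ! c)"
      "?r (4 * int c + 2) = int (g c) \<and> g c \<le> length (us ! c)" if "c < ?m" for c
      using residual_bounds[OF r(1) that] by (auto simp: f_def g_def)
    define S where "S = set (selected ts f ?m)"
    define S' where "S' = set (selected us g ?m)"
    have ne: "cs ! c \<noteq> cs ! d" if "c < ?m" "d < ?m" "c \<noteq> d" for c d
      using that cs(1) by (simp add: nth_eq_iff_index_eq)
    have disj: "set (ts ! c) \<inter> set (ts ! d) = {}" "set (us ! c) \<inter> set (us ! d) = {}"
      if "c < ?m" "d < ?m" "c \<noteq> d" for c d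
      using ne[OF that] that by (auto simp: ts(2) us(2) tcell_mem ccell_mem)
    note spec = selected_spec[of ?m ts f, OF ts(1) disj(1), folded S_def]
    note spec' = selected_spec[of ?m us g, OF us(1) disj(2), folded S'_def]
    have sub: "S \<subseteq> treated I" "S' \<subseteq> control I"
      using spec(2) spec'(2) fg ts(2) us(2) by (auto simp: subset_iff tcell_mem ccell_mem)
    have card: "card (S \<inter> tcell (cs ! c)) = f c" "card (S' \<inter> ccell (cs ! c)) = g c" if "c < ?m" for c
      using spec(3) spec'(3) fg that by (simp_all add: ts us)
    have opt: "min_cost_flow net (sel S S')"
      using fg by (intro selection_correct[OF r(1) \<pi> r(2) sub(1) _ sub(2)]) (auto simp: card)
    \<comment> \<open>Charges the output of control samples to \<open>n\<close> instead of
      \<open>n'\<close>.\<close>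
    have "real (\<Sum>c<?m. f c) = real (\<Sum>c<?m. g c)"
      using sum_tval_eq_sum_cval[of "sel S S'"] opt
      by (simp add: min_cost_flow_def sum_cells card)
    hence fg_eq: "(\<Sum>c<?m. f c) = (\<Sum>c<?m. g c)" by (simp only: of_nat_eq_iff)
    have f_le: "(\<Sum>c<?m. f c) \<le> card (treated I)"
      unfolding card_treated using fg by (intro sum_mono) auto
    have sum: "(\<Sum>c<?m. 11 + 4 * f c + 4 * g c) \<le> 11 * ?m + 8 * card (treated I)"
      using f_le fg_eq by (simp add: sum.distrib flip: sum_distrib_left)
    have same: "scal s1 ''m'' = int ?m" "arr s1 ''toff'' = array_of (offsets ts)"
      "arr s1 ''treated'' = array_of (concat ts)" "arr s1 ''coff'' = array_of (offsets us)"
      "arr s1 ''control'' = array_of (concat us)" "scal s1 ''numS'' = 0" "scal s1 ''numS2'' = 0"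
      using frame_scal[OF fr] frame_arr[OF fr]
      by (simp_all add: input_state_def build_def add_cell_def add_arc_def solve_def improve_def
          init_queue_def init_body_def enqueue_def search_def scan_arc_def dequeue_def
          augment_def raise_def)
    show "wp emit s1 (\<lambda>t s'. \<exists>S S'. S \<subseteq> treated I \<and> S' \<subseteq> control I \<and>
       t1 + t \<le> ?B + 53 * ?m + 8 * card (treated I) + 7 \<and>
       holds_set s' ''numS'' ''S'' S \<and> holds_set s' ''numS2'' ''S2'' S' \<and>
       holds_flow s' cs (sel S S') \<and> min_cost_flow net (sel S S'))"
    proof (rule wp_conseq[OF wp_emit[OF same(1) cs(3,4) same(2-7) fg]])
      fix t2 s2
      assume 2: "t2 \<le> (\<Sum>c<?m. 11 + 4 * f c + 4 * g c) + 3 \<and>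
        stores s2 ''numS'' ''S'' (selected ts f ?m) \<and>
        stores s2 ''numS2'' ''S2'' (selected us g ?m) \<and>
        (\<forall>c<?m. arr s2 ''tflow'' (int c) = int (f c) \<and> arr s2 ''cflow'' (int c) = int (g c))"
      have "holds_set s2 ''numS'' ''S'' S" "holds_set s2 ''numS2'' ''S2'' S'"
        using 2 fg spec(1) spec'(1) unfolding S_def S'_def by (auto intro!: holds_set_stores)
      moreover have "holds_flow s2 cs (sel S S')"
        unfolding holds_flow_def split_beta tarc_def[symmetric] carc_def[symmetric]
        using 2 by (simp add: card)
      moreover have "t1 + t2 \<le> ?B + 53 * ?m + 8 * card (treated I) + 7"
        using 1 2 sum by (simp add: nat_int_add)
      ultimately show "\<exists>S S'. S \<subseteq> treated I \<and> S' \<subseteq> control I \<and>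
         t1 + t2 \<le> ?B + 53 * ?m + 8 * card (treated I) + 7 \<and>
         holds_set s2 ''numS'' ''S'' S \<and> holds_set s2 ''numS2'' ''S2'' S' \<and>
         holds_flow s2 cs (sel S S') \<and> min_cost_flow net (sel S S')"
        using sub opt by blast
    qed auto
  qed
qed

lemma length_cs_le: "length cs \<le> min (card (treated I) + card (control I)) (l1 * l2)"
proof -
  have "length cs = card (cells I)" using cs distinct_card by metis
  moreover have "card (cells I) \<le> l1 * l2"
    using card_mono[OF _ cells_levels] by simp
  moreover have "card (cells I) \<le> card (treated I) + card (control I)"
  proof -
    have "cells I \<subseteq> (\<lambda>s. (tlevel I 1 s, tlevel I 2 s)) ` treated I \<union>
        (\<lambda>s. (clevel I 1 s, clevel I 2 s)) ` control I"
      unfolding cells_eq by (force simp: tcell_mem ccell_mem)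
    hence "card (cells I) \<le> card ((\<lambda>s. (tlevel I 1 s, tlevel I 2 s)) ` treated I \<union>
        (\<lambda>s. (clevel I 1 s, clevel I 2 s)) ` control I)"
      using finite_samples by (intro card_mono) auto
    also have "\<dots> \<le> card ((\<lambda>s. (tlevel I 1 s, tlevel I 2 s)) ` treated I) +
        card ((\<lambda>s. (clevel I 1 s, clevel I 2 s)) ` control I)"
      by (rule card_Un_le)
    also have "\<dots> \<le> card (treated I) + card (control I)"
      using finite_samples by (intro add_mono card_image_le)
    finally show ?thesis .
  qed
  ultimately show ?thesis by simp
qed

lemma steps_le_time_bound:
  assumes t: "t \<le> (24 * (l1 + l2 + 4 * length cs) + 14) * (2 * card (treated I)) + 53 * length cs +
          8 * card (treated I) + 7"
    and ne: "treated I \<noteq> {}"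
  shows "real t \<le> 300 * time_bound I"
proof -
  let ?n = "card (treated I)" and ?m = "length cs" and ?k = "l1 + l2"
  \<comment> \<open>A treatment sample provides a cell and a level of each covariate. So
    \<open>n\<close> and the number of cells are at least 1 and there are at least 2 levels, enough
    to absorb lower-order terms and to have logarithm at least 1.\<close>
  have n: "1 \<le> ?n" using ne finite_samples(1) card_gt_0_iff[of "treated I"] by linarith
  obtain s where "s \<in> treated I" using ne by blast
  hence c: "(tlevel I 1 s, tlevel I 2 s) \<in> cells I" by (rule cells_mem_t)
  hence m: "1 \<le> ?m" using cs(2) by (cases cs) auto
  have k: "2 \<le> ?k" using c cells_levels by fastforce
  \<comment> \<open>The coefficients of all terms bounded by \<open>?n * ?m\<close> sum to 192 + 36
    + 53 + 7 = 288, rounded up to 300; that of \<open>?n * ?k\<close> is 48.\<close>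
  have "t \<le> ?n * (300 * (?m + ?k))"
  proof -
    have "?m \<le> ?n * ?m" "?n \<le> ?n * ?m" using n m by simp_all
    moreover have "1 * 1 \<le> ?n * ?m" using n m by (rule mult_le_mono)
    moreover have "t \<le> 48 * (?n * ?k) + 192 * (?n * ?m) + 36 * ?n + 53 * ?m + 7"
      using t by (simp add: algebra_simps)
    ultimately have "t \<le> 300 * (?n * ?m) + 300 * (?n * ?k)" by linarith
    also have "\<dots> = ?n * (300 * (?m + ?k))" by (simp add: algebra_simps)
    finally show ?thesis .
  qed
  hence "real t \<le> real (?n * (300 * (?m + ?k)))" by (rule of_nat_mono)
  also have "\<dots> = 300 * (real ?n * (real ?m + real ?k))" by simp
  also have "\<dots> \<le> 300 * (real ?n * (real (min (?n + card (control I)) (l1 * l2)) +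
      real ?k * log 2 (real ?k)))"
  proof (intro mult_left_mono add_mono)
    show "real ?m \<le> real (min (?n + card (control I)) (l1 * l2))"
      using length_cs_le of_nat_mono by blast
    have "1 \<le> log 2 (real ?k)" using k by (simp add: le_log_iff)
    hence "real ?k * 1 \<le> real ?k * log 2 (real ?k)" by (intro mult_left_mono) auto
    thus "real ?k \<le> real ?k * log 2 (real ?k)" by simp
  qed auto
  finally show ?thesis by (simp add: time_bound_def Let_def)
qed

end

section \<open>Integrality obtained from the program\<close>

context fbs
begin

text \<open>The halting run of the verified program on some listing is itself the existence
  proof.\<close>

lemma ex_min_cost_selection:
  "\<exists>S S'. S \<subseteq> treated I \<and> S' \<subseteq> control I \<and> min_cost_flow net (sel S S')"
proof -
  obtain cs ts us where "cell_listing I cs ts us" using ex_listing by blast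
  then interpret fbs_listing I cs ts us by unfold_locales
  show ?thesis using wp_fbs_program unfolding wp_def by blast
qed

text \<open>The selection produced by the program costs no more than any real flow, so a largest balanced
  selection does not either.\<close>

lemma optimal_imp_min_cost:
  assumes "fbs_optimal I S S'"
  shows "min_cost_flow net (sel S S')"
proof -
  have sub: "S \<subseteq> treated I" "S' \<subseteq> control I" and feas: "fbs_feasible I S S'"
    using assms by (auto simp: fbs_optimal_def fbs_feasible_def)
  obtain R R' where R: "R \<subseteq> treated I" "R' \<subseteq> control I" "min_cost_flow net (sel R R')"
    using ex_min_cost_selection by blast
  hence "fbs_feasible I R R'" by (simp add: min_cost_flow_def feasible_sel_iff)
  hence "card R \<le> card S" using assms unfolding fbs_optimal_def by blast
  hence "flow_cost net (sel S S') \<le> flow_cost net (sel R R')"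
    using sub R by (simp add: flow_cost_sel)
  thus ?thesis
    using R(3) feas sub by (auto simp: min_cost_flow_def feasible_sel_iff)
qed

end

theorem theorem3p3:
  shows "(\<forall>I. valid_instance I \<longrightarrow>
            (\<forall>S S'. S \<subseteq> treated I \<and> S' \<subseteq> control I \<longrightarrow>
               (fbs_optimal I S S' \<longleftrightarrow> min_cost_flow (fbs_network I) (selection_flow I S S'))) \<and>
            (\<forall>f. min_cost_flow (fbs_network I) f \<and> (\<forall>a\<in>arcs (fbs_network I). f a \<in> \<int>) \<longrightarrow>
               (\<exists>S S'. fbs_optimal I S S' \<and>
                  (\<forall>a\<in>arcs (fbs_network I). selection_flow I S S' a = f a)))) \<and>
         (\<exists>(prog :: com) (K :: real). \<forall>I cs ts us.
            valid_instance I \<and> treated I \<noteq> {} \<and> cell_listing I cs ts us \<longrightarrow>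
            (\<exists>t s' S S'.
               run prog (input_state I cs ts us) t s' \<and>
               real t \<le> K * time_bound I \<and>
               holds_set s' ''numS'' ''S'' S \<and> holds_set s' ''numS2'' ''S2'' S' \<and>
               fbs_optimal I S S' \<and>
               holds_flow s' cs (selection_flow I S S') \<and>
               min_cost_flow (fbs_network I) (selection_flow I S S')))"
proof (intro conjI allI impI exI[of _ fbs_program] exI[of _ "300 :: real"])
  fix I S S'
  assume "valid_instance I" and sub: "S \<subseteq> treated I \<and> S' \<subseteq> control I"
  then interpret fbs I by unfold_locales
  show "fbs_optimal I S S' \<longleftrightarrow> min_cost_flow (fbs_network I) (selection_flow I S S')"
    using sub min_cost_imp_optimal optimal_imp_min_cost by blast
next
  fix I f
  assume "valid_instance I"
    and f: "min_cost_flow (fbs_network I) f \<and> (\<forall>a\<in>arcs (fbs_network I). f a \<in> \<int>)"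
  then interpret fbs I by unfold_locales
  show "\<exists>S S'. fbs_optimal I S S' \<and> (\<forall>a\<in>arcs (fbs_network I). selection_flow I S S' a = f a)"
    using f integral_min_cost_flow by blast
next
  fix I cs ts us
  assume a: "valid_instance I \<and> treated I \<noteq> {} \<and> cell_listing I cs ts us"
  then interpret fbs_listing I cs ts us by unfold_locales auto
  obtain t s' S S' where "run fbs_program (input_state I cs ts us) t s'"
    "S \<subseteq> treated I" "S' \<subseteq> control I"
    "t \<le> (24 * (levels I 1 + levels I 2 + 4 * length cs) + 14) * (2 * card (treated I)) +
      53 * length cs + 8 * card (treated I) + 7"
    "holds_set s' ''numS'' ''S'' S" "holds_set s' ''numS2'' ''S2'' S'"
    "holds_flow s' cs (selection_flow I S S')"
    "min_cost_flow (fbs_network I) (selection_flow I S S')"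
    using wp_fbs_program unfolding wp_def by blast
  thus "\<exists>t s' S S'. run fbs_program (input_state I cs ts us) t s' \<and>
      real t \<le> 300 * time_bound I \<and>
      holds_set s' ''numS'' ''S'' S \<and> holds_set s' ''numS2'' ''S2'' S' \<and>
      fbs_optimal I S S' \<and>
      holds_flow s' cs (selection_flow I S S') \<and>
      min_cost_flow (fbs_network I) (selection_flow I S S')"
    using a steps_le_time_bound min_cost_imp_optimal by blast
qed

end
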